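(* There is a constant $c_0$ such that for any graph $G$, $\mathrm{box}(G)\le c_0\,\mu(G)^4(\log\mu(G))^2$.
   Context: Graphs are finite and simple. A $d$-box is a Cartesian product $[x_1,y_1]\times\cdots\times[x_d,y_d]$ of $d$ closed intervals of the real line. The boxicity $\mathrm{box}(G)$ of a graph $G$ is the smallest integer $d\ge 1$ such that $G$ is the intersection graph of a collection of $d$-boxes, i.e. one can assign to each vertex $v$ a $d$-box $B_v$ such that two distinct vertices $u,v$ are adjacent if and only if $B_u\cap B_v\neq\emptyset$ (distinct vertices may be assigned the same box). The Colin de Verdière invariant $\mu(G)$ of a graph $G$ with vertex set $\{1,\dots,n\}$ is the maximum corank (dimension of the kernel) of a real symmetric $n\times n$ matrix $M$ such that: (i) for $i\ne j$, $M_{ij}<0$ if $ij$ is an edge of $G$ and $M_{ij}=0$ otherwise (the diagonal entries are arbitrary); (ii) $M$ has exactly one negative eigenvalue, of multiplicity $1$; (iii) (Strong Arnold Property) there is no nonzero real symmetric $n\times n$ matrix $X$ with $MX=0$ and $X_{ij}=0$ whenever $i=j$ or $ij$ is an edge of $G$. (Up to replacing $M$ by $-M$ and shifting by a multiple of the identity, this is the maximal multiplicity of the second largest eigenvalue of matrices with arbitrary diagonal, positive entries on edges and zero entries on non-edges, subject to the Strong Arnold Property.) The logarithm is the natural logarithm.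
   Formalization: The bound is stated only for nonempty graphs with μ(G) ≥ 2, since for μ(G) ≤ 1 the right-hand side is 0 or undefined while box(G) ≥ 1; vertices are natural numbers, which covers every finite graph up to isomorphism. *)

theory Defs
  imports
    Complex_Main
    "HOL-Library.FuncSet"
    "Graph_Theory.Pair_Digraph"
    "Jordan_Normal_Form.Char_Poly"
    "Jordan_Normal_Form.Matrix_Kernel"
begin

text \<open>
  A finite simple graph is a \<open>pair_pre_digraph\<close> satisfying \<open>pair_graph\<close>: finitely many
  vertices, an irreflexive and symmetric arc relation. An edge \<open>uv\<close> is present as both
  arcs \<open>(u, v)\<close> and \<open>(v, u)\<close>.
\<close>

text \<open>
  Points of \<open>d\<close>-dimensional space are extensional functions on \<open>{..<d}\<close>. The side
  intervals are required to be nonempty.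
\<close>

definition is_box :: "nat \<Rightarrow> (nat \<Rightarrow> real) set \<Rightarrow> bool" where
  "is_box d B \<longleftrightarrow> (\<exists>x y. (\<forall>i<d. x i \<le> y i) \<and> B = (\<Pi>\<^sub>E i\<in>{..<d}. {x i..y i}))"

definition box_representation ::
    "'a pair_pre_digraph \<Rightarrow> nat \<Rightarrow> ('a \<Rightarrow> (nat \<Rightarrow> real) set) \<Rightarrow> bool" where
  "box_representation G d B \<longleftrightarrow>
     (\<forall>v\<in>pverts G. is_box d (B v)) \<and>
     (\<forall>u\<in>pverts G. \<forall>v\<in>pverts G. u \<noteq> v \<longrightarrow> ((u, v) \<in> parcs G \<longleftrightarrow> B u \<inter> B v \<noteq> {}))"

definition boxicity :: "'a pair_pre_digraph \<Rightarrow> nat" where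
  "boxicity G = (LEAST d. d \<ge> 1 \<and> (\<exists>B. box_representation G d B))"

definition symmetric_real_mat :: "nat \<Rightarrow> real mat \<Rightarrow> bool" where
  "symmetric_real_mat n M \<longleftrightarrow> M \<in> carrier_mat n n \<and> transpose_mat M = M"

text \<open>
  Below, the list \<open>vs\<close> enumerates the vertices without repetition; row and column \<open>i\<close> of a
  matrix belong to the vertex \<open>vs ! i\<close>.
\<close>

definition strong_arnold_property ::
    "'a pair_pre_digraph \<Rightarrow> 'a list \<Rightarrow> real mat \<Rightarrow> bool" where
  "strong_arnold_property G vs M \<longleftrightarrow>
     (let n = length vs in
       \<not> (\<exists>X. symmetric_real_mat n X \<and> X \<noteq> 0\<^sub>m n n \<and> M * X = 0\<^sub>m n n \<and>
            (\<forall>i<n. \<forall>j<n. i = j \<or> (vs ! i, vs ! j) \<in> parcs G \<longrightarrow> X $$ (i, j) = 0)))"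

text \<open>
  The multiplicity of the negative eigenvalue is taken in the characteristic polynomial;
  for symmetric matrices it is the dimension of the eigenspace.
\<close>

definition colin_de_verdiere_matrix ::
    "'a pair_pre_digraph \<Rightarrow> 'a list \<Rightarrow> real mat \<Rightarrow> bool" where
  "colin_de_verdiere_matrix G vs M \<longleftrightarrow>
     (let n = length vs in
       symmetric_real_mat n M \<and>
       (\<forall>i<n. \<forall>j<n. i \<noteq> j \<longrightarrow>
          (if (vs ! i, vs ! j) \<in> parcs G then M $$ (i, j) < 0 else M $$ (i, j) = 0)) \<and>
       (\<exists>!k. k < 0 \<and> eigenvalue M k) \<and>
       (\<forall>k. k < 0 \<and> eigenvalue M k \<longrightarrow> Polynomial.order k (char_poly M) = 1) \<and>
       strong_arnold_property G vs M)"

text \<open>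
  The corank does not depend on the enumeration \<open>vs\<close>. The set below is bounded by the number
  of vertices, and it is nonempty if \<open>G\<close> has a vertex; on the graph without vertices
  the value is unspecified.
\<close>

definition colin_de_verdiere :: "'a pair_pre_digraph \<Rightarrow> nat" where
  "colin_de_verdiere G =
     Max {kernel_dim M | M vs. distinct vs \<and> set vs = pverts G \<and> colin_de_verdiere_matrix G vs M}"

end

theory Submission
  imports Defs
begin

text \<open>
  If \<open>G\<close> contains \<open>t\<close> disjoint connected pairwise adjacent vertex sets then \<open>t \<le> \<mu>(G) + 1\<close>: give the
  edges inside a branch set weight \<open>1\<close> and all other edges weights of order \<open>\<epsilon> = e\<^sup>2\<close>. For suitable
  weights between the branch sets, found by a contraction argument for small \<open>e\<close>, eliminating all
  vertices but one root per branch set leaves \<open>- \<epsilon> J\<close>, where \<open>J\<close> is the all-ones matrix of size \<open>t\<close>,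
  and the eliminated part is positive definite. This gives one negative eigenvalue and corank \<open>t - 1\<close>;
  the Strong Arnold Property holds since the kernel is close to that of a complete graph blown up to
  the branch sets.

  A graph without such a family of \<open>t\<close> sets can be decomposed into connected pieces, each a union of fewer
  than \<open>t\<close> geodesics of what was left (van den Heuvel, Ossona de Mendez, Quiroz, Rabinovich, Siebertz), and
  so has an ordering in which each vertex strongly reaches at most \<open>5 t\<^sup>2\<close> smaller vertices in two steps.
  A greedy colouring along this ordering has the property that any two colour classes induce a forest.
  A forest is an intersection of two interval graphs, and with one such pair for every pair of colours
  one obtains a box representation of dimension \<open>O(t\<^sup>4)\<close>.
\<close>

section \<open>Symmetric real matrices\<close>

text \<open>Corank is destroyed by the slightest perturbation, so weights that are right to leading
  order are of no use: what remains at the roots has to equal \<open>- \<epsilon> J\<close> exactly.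
  Diagonal entries may be chosen freely, so only the pairs \<open>i < j\<close> of branch sets
  impose equations, and one common weight for all edges between two branch sets gives one unknown
  per equation. To leading order it is the reciprocal of the number of these edges. The square root
  \<open>e\<close> enters as follows: the extension of a unit vector at a root differs from the
  indicator of its branch set by order \<open>e\<^sup>2\<close>. Written as \<open>e\<close> times a
  correction that is itself of order \<open>e\<close>, this turns the equations for weights and
  corrections alike into one system \<open>x = x0 + e F(e, x)\<close> with \<open>F\<close> bounded
  and Lipschitz. On the other side, each vertex reaches \<open>O(t\<^sup>2)\<close> earlier ones,
  which is also the number of colours, and the dimension is twice its square. As
  \<open>\<mu> \<ge> 2\<close>, the logarithm is at least \<open>ln 2\<close> and goes into the
  constant.\<close>

lemma kernel_dim_ge:
  fixes A :: "'a::field mat"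
  assumes A: "A \<in> carrier_mat m n"
    and w: "\<And>i. i < d \<Longrightarrow> w i \<in> mat_kernel A"
    and s: "\<And>i. i < d \<Longrightarrow> s i < n"
    and unit: "\<And>i j. i < d \<Longrightarrow> j < d \<Longrightarrow> w i $ s j = (if i = j then 1 else 0)"
  shows "d \<le> kernel_dim A"
proof -
  interpret kernel m n A using A by unfold_locales
  have inj: "inj_on w {..<d}"
  proof (rule inj_onI)
    fix i j assume "i \<in> {..<d}" "j \<in> {..<d}" "w i = w j"
    then show "i = j" using unit[of i j] unit[of j j] by (auto split: if_splits)
  qed
  have sub: "w ` {..<d} \<subseteq> mat_kernel A" using w by auto
  have "lin_indpt (w ` {..<d})"
  proof (rule Ker.finite_lin_indpt2)
    show "finite (w ` {..<d})" by simp
    show "w ` {..<d} \<subseteq> mat_kernel A" by (fact sub)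
    fix a assume z: "lincomb a (w ` {..<d}) = 0\<^sub>v n"
    show "\<forall>v\<in>w ` {..<d}. a v = 0"
    proof
      fix v assume "v \<in> w ` {..<d}"
      then obtain j where j: "j < d" "v = w j" by auto
      have "0 = lincomb a (w ` {..<d}) $ s j" using z s[OF j(1)] by simp
      also have "\<dots> = (\<Sum>x\<in>w ` {..<d}. a x * x $ s j)" by (rule lincomb_index[OF s[OF j(1)] sub])
      also have "\<dots> = (\<Sum>i<d. a (w i) * w i $ s j)" by (simp add: sum.reindex[OF inj])
      also have "\<dots> = (\<Sum>i<d. if i = j then a (w i) else 0)"
        by (rule sum.cong) (auto simp: unit j)
      also have "\<dots> = a (w j)" using j by simp
      finally show "a v = 0" using j by simp
    qed
  qed
  moreover have "Ker.fin_dim"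
    using kernel_basis_exists[OF A] unfolding Ker.fin_dim_def Ker.basis_def by auto
  ultimately have "card (w ` {..<d}) \<le> dim" using Ker.li_le_dim sub by auto
  then show ?thesis by (simp add: card_image[OF inj])
qed

lemma kernel_dim_le:
  fixes A :: "'a::field mat"
  shows "kernel_dim A \<le> dim_col A"
  unfolding kernel_dim_code by simp

section \<open>Quadratic forms and negative eigenvalues\<close>

lemma scalar_prod_self_pos:
  fixes x :: "real vec"
  assumes "x \<in> carrier_vec n" "x \<noteq> 0\<^sub>v n"
  shows "x \<bullet> x > 0"
proof -
  obtain i where i: "i < n" "x $ i \<noteq> 0" using assms by (metis carrier_vecD eq_vecI index_zero_vec)
  have "0 < (\<Sum>i\<in>{0..<n}. x $ i * x $ i)"
    by (rule sum_pos2[of _ i]) (use i in \<open>auto simp: zero_less_mult_iff\<close>)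
  then show ?thesis using assms by (simp add: scalar_prod_def)
qed

text \<open>Supplies the finite constants for which one might use compactness of the unit sphere.
  Any constant will do, hence the crude sum of all absolute entries.\<close>

lemma quadratic_form_bound:
  fixes N :: "real mat"
  assumes N: "N \<in> carrier_mat n n"
  obtains K where "K \<ge> 0" "\<And>x. x \<in> carrier_vec n \<Longrightarrow> \<bar>x \<bullet> (N *\<^sub>v x)\<bar> \<le> K * (x \<bullet> x)"
proof
  let ?K = "\<Sum>i<n. \<Sum>j<n. \<bar>N $$ (i,j)\<bar>"
  show "?K \<ge> 0" by (intro sum_nonneg) auto
  fix x :: "real vec" assume x: "x \<in> carrier_vec n"
  have sq: "\<bar>x $ i * x $ j\<bar> \<le> x \<bullet> x" if "i < n" "j < n" for i j
  proof -
    have le: "(x $ k)\<^sup>2 \<le> x \<bullet> x" if "k < n" for k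
      using x that member_le_sum[of k "{0..<n}" "\<lambda>i. (x $ i)\<^sup>2"]
      by (simp add: scalar_prod_def power2_eq_square)
    have "0 \<le> (\<bar>x $ i\<bar> - \<bar>x $ j\<bar>)\<^sup>2" by simp
    then have "2 * \<bar>x $ i * x $ j\<bar> \<le> (x $ i)\<^sup>2 + (x $ j)\<^sup>2"
      by (simp add: power2_diff abs_mult)
    then show ?thesis using le[OF that(1)] le[OF that(2)] by linarith
  qed
  have "x \<bullet> (N *\<^sub>v x) = (\<Sum>i<n. \<Sum>j<n. N $$ (i,j) * (x $ i * x $ j))"
    using x N by (auto simp: scalar_prod_def sum_distrib_left atLeast0LessThan algebra_simps intro!: sum.cong)
  also have "\<bar>\<dots>\<bar> \<le> (\<Sum>i<n. \<Sum>j<n. \<bar>N $$ (i,j)\<bar> * (x \<bullet> x))"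
    by (intro order_trans[OF sum_abs] sum_mono)
       (auto simp: abs_mult[of "N $$ _"] intro!: mult_left_mono sq)
  also have "\<dots> = ?K * (x \<bullet> x)" by (simp add: sum_distrib_right)
  finally show "\<bar>x \<bullet> (N *\<^sub>v x)\<bar> \<le> ?K * (x \<bullet> x)" .
qed

lemma symmetric_scalar_prod:
  fixes M :: "real mat"
  assumes M: "M \<in> carrier_mat n n" "transpose_mat M = M"
    and x: "x \<in> carrier_vec n" and y: "y \<in> carrier_vec n"
  shows "x \<bullet> (M *\<^sub>v y) = y \<bullet> (M *\<^sub>v x)"
proof -
  have "M $$ (i,j) = M $$ (j,i)" if "i < n" "j < n" for i j
    using M that by (metis carrier_matD index_transpose_mat(1))
  then have "x \<bullet> (M *\<^sub>v y) = (\<Sum>i<n. \<Sum>j<n. M $$ (j,i) * x $ i * y $ j)"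
    using x y M by (auto simp: scalar_prod_def sum_distrib_left atLeast0LessThan algebra_simps intro!: sum.cong)
  also have "\<dots> = (\<Sum>j<n. \<Sum>i<n. M $$ (j,i) * x $ i * y $ j)" by (rule sum.swap)
  also have "\<dots> = y \<bullet> (M *\<^sub>v x)"
    using x y M by (auto simp: scalar_prod_def sum_distrib_left atLeast0LessThan algebra_simps intro!: sum.cong)
  finally show ?thesis .
qed

text \<open>The Cauchy--Schwarz inequality of the form \<open>q\<close>, applied to \<open>x\<close> and \<open>M\<^sup>-\<^sup>1 x\<close>, bounds \<open>q x\<close>
  from below.\<close>

lemma psd_nonsingular_imp_pd:
  fixes M :: "real mat"
  assumes M: "M \<in> carrier_mat n n" "transpose_mat M = M"
    and psd: "\<And>x. x \<in> carrier_vec n \<Longrightarrow> x \<bullet> (M *\<^sub>v x) \<ge> 0"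
    and det: "det M \<noteq> 0"
  obtains c where "c > 0" "\<And>x. x \<in> carrier_vec n \<Longrightarrow> x \<bullet> (M *\<^sub>v x) \<ge> c * (x \<bullet> x)"
proof -
  from det_non_zero_imp_unit[OF M(1) det, unfolded Units_def, of "()"]
  obtain N where N: "N \<in> carrier_mat n n" and MN: "M * N = 1\<^sub>m n"
    by (auto simp: ring_mat_def)
  obtain K where K: "K \<ge> 0" "\<And>x. x \<in> carrier_vec n \<Longrightarrow> \<bar>x \<bullet> (N *\<^sub>v x)\<bar> \<le> K * (x \<bullet> x)"
    using quadratic_form_bound[OF N] by blast
  have main: "x \<bullet> (M *\<^sub>v x) \<ge> 1 / (K + 1) * (x \<bullet> x)" if x: "x \<in> carrier_vec n" for x
  proof (cases "x = 0\<^sub>v n")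
    case True
    then show ?thesis using psd[OF x] by simp
  next
    case False
    define a where "a = x \<bullet> x"
    have a: "a > 0" using scalar_prod_self_pos[OF x False] a_def by simp
    define z where "z = N *\<^sub>v x"
    have z: "z \<in> carrier_vec n" using N x z_def by simp
    have Mz: "M *\<^sub>v z = x" unfolding z_def
      by (subst assoc_mult_mat_vec[symmetric]) (use M N MN x in auto)
    define b where "b = x \<bullet> z"
    have b: "b \<le> K * a" using K(2)[OF x] unfolding b_def z_def a_def by linarith
    define Q where "Q = x \<bullet> (M *\<^sub>v x)"
    have zMx: "z \<bullet> (M *\<^sub>v x) = a"
      using symmetric_scalar_prod[OF M z x] Mz a_def by simp
    have zx: "z \<bullet> x = b" using comm_scalar_prod[OF x z] b_def by simp
    \<comment> \<open>The form at \<open>x - s z\<close>, where \<open>M z = x\<close>.\<close>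
    have expand: "0 \<le> Q - 2 * s * a + s * s * b" for s
    proof -
      have sz: "- s \<cdot>\<^sub>v z \<in> carrier_vec n" using z by simp
      have "0 \<le> (x + - s \<cdot>\<^sub>v z) \<bullet> (M *\<^sub>v (x + - s \<cdot>\<^sub>v z))"
        by (rule psd) (use x z in simp)
      also have "M *\<^sub>v (x + - s \<cdot>\<^sub>v z) = M *\<^sub>v x + - s \<cdot>\<^sub>v x"
        using mult_add_distrib_mat_vec[OF M(1) x sz] mult_mat_vec[OF M(1) z] Mz by simp
      also have "(x + - s \<cdot>\<^sub>v z) \<bullet> (M *\<^sub>v x + - s \<cdot>\<^sub>v x) = Q - 2 * s * a + s * s * b"
        using x z M by (simp add: add_scalar_prod_distrib[of _ n] scalar_prod_add_distrib[of _ n]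
            Q_def[symmetric] a_def[symmetric] zMx zx algebra_simps)
      finally show ?thesis .
    qed
    \<comment> \<open>With this \<open>s\<close> the term \<open>s * s * b\<close> is at most
      \<open>s * a\<close>, which leaves \<open>s * a\<close> of the gain
      \<open>2 * s * a\<close>.\<close>
    define s where "s = 1 / (K + 1)"
    have s: "s > 0" "s * K \<le> 1" using K(1) by (auto simp: s_def field_simps)
    have "s * s * b \<le> s * s * (K * a)" using b by (intro mult_left_mono) auto
    also have "\<dots> = s * a * (s * K)" by simp
    also have "\<dots> \<le> s * a * 1" using s a by (intro mult_left_mono) auto
    finally have "Q \<ge> s * a" using expand[of s] by simp
    then show ?thesis unfolding Q_def a_def s_def .
  qed
  show thesis by (rule that[of "1 / (K + 1)"]) (use K(1) main in auto)
qed

lemma add_smult_one_mult_vec: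
  fixes M :: "real mat"
  assumes M: "M \<in> carrier_mat n n" and x: "x \<in> carrier_vec n"
  shows "(M + s \<cdot>\<^sub>m 1\<^sub>m n) *\<^sub>v x = M *\<^sub>v x + s \<cdot>\<^sub>v x"
proof -
  have "(s \<cdot>\<^sub>m 1\<^sub>m n) *\<^sub>v x = s \<cdot>\<^sub>v x"
    by (rule eq_vecI) (use x in \<open>auto simp: row_smult scalar_prod_smult_left\<close>)
  then show ?thesis using add_mult_distrib_mat_vec[OF M _ x, of "s \<cdot>\<^sub>m 1\<^sub>m n"] by simp
qed

lemma add_smult_one_quadratic:
  fixes M :: "real mat"
  assumes M: "M \<in> carrier_mat n n" and x: "x \<in> carrier_vec n"
  shows "x \<bullet> ((M + s \<cdot>\<^sub>m 1\<^sub>m n) *\<^sub>v x) = x \<bullet> (M *\<^sub>v x) + s * (x \<bullet> x)"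
  unfolding add_smult_one_mult_vec[OF M x]
  using M x by (simp add: scalar_prod_add_distrib[of _ n])

text \<open>Minus the least shift that makes the form positive semidefinite is an eigenvalue.\<close>

lemma exists_negative_eigenvalue:
  fixes M :: "real mat"
  assumes M: "M \<in> carrier_mat n n" "transpose_mat M = M"
    and x0: "x0 \<in> carrier_vec n" "x0 \<bullet> (M *\<^sub>v x0) < 0"
  shows "\<exists>k<0. eigenvalue M k"
proof -
  define S where "S = {s. s \<ge> 0 \<and> (\<forall>x\<in>carrier_vec n. x \<bullet> (M *\<^sub>v x) + s * (x \<bullet> x) \<ge> 0)}"
  obtain K where K: "K \<ge> 0" "\<And>x. x \<in> carrier_vec n \<Longrightarrow> \<bar>x \<bullet> (M *\<^sub>v x)\<bar> \<le> K * (x \<bullet> x)"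
    using quadratic_form_bound[OF M(1)] by blast
  have KS: "K \<in> S" unfolding S_def using K by (force simp: abs_le_iff)
  have bdd: "bdd_below S" by (rule bdd_belowI[of _ 0]) (auto simp: S_def)
  define s where "s = Inf S"
  have psd: "x \<bullet> (M *\<^sub>v x) + s * (x \<bullet> x) \<ge> 0" if x: "x \<in> carrier_vec n" for x
  proof (cases "x = 0\<^sub>v n")
    case True then show ?thesis using M by simp
  next
    case False
    have a: "x \<bullet> x > 0" using scalar_prod_self_pos[OF x False] .
    have "- (x \<bullet> (M *\<^sub>v x)) / (x \<bullet> x) \<le> s" unfolding s_def
    proof (rule cInf_greatest)
      show "S \<noteq> {}" using KS by auto
      fix r assume "r \<in> S"
      then show "- (x \<bullet> (M *\<^sub>v x)) / (x \<bullet> x) \<le> r"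
        using x a by (auto simp: S_def field_simps)
    qed
    then show ?thesis using a by (simp add: field_simps) 
  qed
  have "s \<ge> 0" unfolding s_def by (rule cInf_greatest) (use KS in \<open>auto simp: S_def\<close>)
  moreover have "s \<noteq> 0" using psd[OF x0(1)] x0(2) by auto
  ultimately have s: "s > 0" by simp
  let ?M = "M + s \<cdot>\<^sub>m 1\<^sub>m n"
  have M': "?M \<in> carrier_mat n n" "transpose_mat ?M = ?M"
    using M by (auto simp: transpose_add[of _ n n]) 
  \<comment> \<open>Otherwise the shifted form would dominate a positive multiple of
    \<open>x \<bullet> x\<close>, and a smaller shift would still be in \<open>S\<close>.\<close>
  have "det ?M = 0"
  proof (rule ccontr)
    assume "det ?M \<noteq> 0"
    moreover have "x \<bullet> (?M *\<^sub>v x) \<ge> 0" if "x \<in> carrier_vec n" for x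
      using psd[OF that] add_smult_one_quadratic[OF M(1) that, of s] by simp
    ultimately obtain c where c: "c > 0" "\<And>x. x \<in> carrier_vec n \<Longrightarrow> x \<bullet> (?M *\<^sub>v x) \<ge> c * (x \<bullet> x)"
      using psd_nonsingular_imp_pd[OF M'] by blast
    \<comment> \<open>The minimum with \<open>s\<close> keeps the smaller shift nonnegative, as
      membership in \<open>S\<close> demands.\<close>
    define d where "d = min c s"
    have "s - d \<in> S"
      unfolding S_def
    proof (intro CollectI conjI ballI)
      show "0 \<le> s - d" by (simp add: d_def)
      fix x :: "real vec" assume x: "x \<in> carrier_vec n"
      have "0 \<le> x \<bullet> x" using x scalar_prod_self_pos[OF x] by (cases "x = 0\<^sub>v n") auto
      then have "d * (x \<bullet> x) \<le> c * (x \<bullet> x)" by (intro mult_right_mono) (auto simp: d_def)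
      then show "0 \<le> x \<bullet> (M *\<^sub>v x) + (s - d) * (x \<bullet> x)"
        using c(2)[OF x] add_smult_one_quadratic[OF M(1) x, of s] by (simp add: algebra_simps)
    qed
    then have "s \<le> s - d" unfolding s_def[symmetric] using cInf_lower[OF _ bdd] s_def by blast
    then show False using c(1) s by (simp add: d_def)
  qed
  then obtain v where v: "v \<in> carrier_vec n" "v \<noteq> 0\<^sub>v n" "?M *\<^sub>v v = 0\<^sub>v n"
    using det_0_iff_vec_prod_zero[OF M'(1)] by auto
  have "char_matrix M (-s) = ?M" unfolding char_matrix_def using M by simp
  then have "eigenvalue M (-s)" unfolding eigenvalue_char_matrix[OF M(1)] using v by auto
  then show ?thesis using s by (intro exI[of _ "-s"]) simp
qed

text \<open>The matrix determinant lemma: the block matrix with rows \<open>1, -w\<close> and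
  \<open>v, 1\<close> is a product of block triangular matrices in two ways, and the two
  factorizations give the two sides.\<close>

lemma det_one_add_outer:
  fixes v w :: "real vec"
  assumes v: "v \<in> carrier_vec n" and w: "w \<in> carrier_vec n"
  shows "det (1\<^sub>m n + mat n n (\<lambda>(i,j). v $ i * w $ j)) = 1 + w \<bullet> v"
proof -
  define V where "V = mat n 1 (\<lambda>(i,j). v $ i)"
  define W where "W = mat 1 n (\<lambda>(i,j). - w $ j)"
  define P where "P = 1\<^sub>m n + mat n n (\<lambda>(i,j). v $ i * w $ j)"
  define D where "D = mat 1 1 (\<lambda>_. 1 + w \<bullet> v)"
  have c: "V \<in> carrier_mat n 1" "W \<in> carrier_mat 1 n" "P \<in> carrier_mat n n" "D \<in> carrier_mat 1 1"
    by (auto simp: V_def W_def P_def D_def)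
  have VW: "V * W = mat n n (\<lambda>(i,j). - (v $ i * w $ j))"
    unfolding V_def W_def by (rule eq_matI) (auto simp: scalar_prod_def)
  have WV: "W * V = mat 1 1 (\<lambda>_. - (w \<bullet> v))"
    unfolding V_def W_def using v w by (intro eq_matI) (auto simp: scalar_prod_def sum_negf)
  let ?X = "four_block_mat (1\<^sub>m 1) W V (1\<^sub>m n)"
  have "four_block_mat (1\<^sub>m 1) (0\<^sub>m 1 n) V (1\<^sub>m n) * four_block_mat (1\<^sub>m 1) W (0\<^sub>m n 1) P = ?X"
  proof -
    have "V * W + P = 1\<^sub>m n" unfolding VW P_def by (rule eq_matI) auto
    then show ?thesis
      using c by (subst mult_four_block_mat[of _ 1 1 _ n _ n _ _ 1 _ n]) auto
  qed
  then have "det ?X = det (four_block_mat (1\<^sub>m 1) (0\<^sub>m 1 n) V (1\<^sub>m n)) * det (four_block_mat (1\<^sub>m 1) W (0\<^sub>m n 1) P)"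
    using c by (metis det_mult four_block_carrier_mat one_carrier_mat)
  also have "\<dots> = det P"
    using c by (simp add: det_four_block_mat_upper_right_zero[of _ 1 _ n] det_four_block_mat_lower_left_zero[of _ 1 _ n])
  finally have 1: "det ?X = det P" .
  have "four_block_mat D W (0\<^sub>m n 1) (1\<^sub>m n) * four_block_mat (1\<^sub>m 1) (0\<^sub>m 1 n) V (1\<^sub>m n) = ?X"
  proof -
    have "D + W * V = 1\<^sub>m 1" unfolding WV D_def by (rule eq_matI) auto
    then show ?thesis
      using c by (subst mult_four_block_mat[of _ 1 1 _ n _ n _ _ 1 _ n]) auto
  qed
  then have "det ?X = det (four_block_mat D W (0\<^sub>m n 1) (1\<^sub>m n)) * det (four_block_mat (1\<^sub>m 1) (0\<^sub>m 1 n) V (1\<^sub>m n))"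
    using c by (metis det_mult four_block_carrier_mat one_carrier_mat)
  also have "\<dots> = det D"
    using c by (simp add: det_four_block_mat_upper_right_zero[of _ 1 _ n] det_four_block_mat_lower_left_zero[of _ 1 _ n])
  also have "\<dots> = 1 + w \<bullet> v" by (simp add: D_def det_single)
  finally show ?thesis using 1 P_def by simp
qed

text \<open>Adding \<open>v v\<^sup>T\<close> to \<open>s - M\<close> moves the eigenvalue of \<open>v\<close> and leaves the rest of the
  characteristic polynomial in place; the multiplicity can then be read off at \<open>lam\<close>.\<close>

lemma simple_eigenvalue_order:
  fixes M :: "real mat"
  assumes M: "M \<in> carrier_mat n n" "transpose_mat M = M"
    and v: "eigenvector M v lam"
    and unique: "\<And>y. y \<in> carrier_vec n \<Longrightarrow> M *\<^sub>v y = lam \<cdot>\<^sub>v y \<Longrightarrow> v \<bullet> y = 0 \<Longrightarrow> y = 0\<^sub>v n"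
  shows "Polynomial.order lam (char_poly M) = 1"
proof -
  have vc: "v \<in> carrier_vec n" and v0: "v \<noteq> 0\<^sub>v n" and Mv: "M *\<^sub>v v = lam \<cdot>\<^sub>v v"
    using v M by (auto simp: eigenvector_def)
  define a where "a = v \<bullet> v"
  have a: "a > 0" using scalar_prod_self_pos[OF vc v0] a_def by simp
  define R where "R = mat n n (\<lambda>(i,j). v $ i * v $ j)"
  have R: "R \<in> carrier_mat n n" by (simp add: R_def)
  have Ry: "R *\<^sub>v y = (v \<bullet> y) \<cdot>\<^sub>v v" if "y \<in> carrier_vec n" for y
    unfolding R_def by (rule eq_vecI) (use that vc in \<open>auto simp: scalar_prod_def sum_distrib_left sum_distrib_right algebra_simps\<close>)
  define N where "N = M - R"
  have N: "N \<in> carrier_mat n n" unfolding N_def using R by (rule minus_carrier_mat)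
  have Ny: "N *\<^sub>v y = M *\<^sub>v y - (v \<bullet> y) \<cdot>\<^sub>v v" if "y \<in> carrier_vec n" for y
    unfolding N_def using minus_mult_distrib_mat_vec[OF M(1) R that] Ry[OF that] by simp
  have MR: "M * R = lam \<cdot>\<^sub>m R"
  proof (rule eq_matI)
    fix i j assume ij: "i < dim_row (lam \<cdot>\<^sub>m R)" "j < dim_col (lam \<cdot>\<^sub>m R)"
    then have ij': "i < n" "j < n" using R by auto
    have "(M * R) $$ (i,j) = (M *\<^sub>v v) $ i * v $ j"
      using ij' M vc by (simp add: R_def scalar_prod_def sum_distrib_right mult.assoc)
    then show "(M * R) $$ (i,j) = (lam \<cdot>\<^sub>m R) $$ (i,j)"
      using ij' vc by (simp add: Mv R_def)
  qed (use M R in auto)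
  \<comment> \<open>Since \<open>(s - M) v = (s - lam) v\<close>, the matrix \<open>s - N\<close> is
    \<open>s - M\<close> times a rank-one update of the identity.\<close>
  have dets: "(s - lam) * det (- char_matrix N s) = (s - lam + a) * det (- char_matrix M s)"
    if s: "s \<noteq> lam" for s
  proof -
    define c where "c = 1 / (s - lam)"
    have cs: "c * (s - lam) = 1" using s by (simp add: c_def)
    define C where "C = - char_matrix M s"
    have C: "C \<in> carrier_mat n n" using M by (simp add: C_def)
    have CR: "C * (c \<cdot>\<^sub>m R) = R"
    proof -
      have "C * R = (s - lam) \<cdot>\<^sub>m R"
      proof -
        have "C = s \<cdot>\<^sub>m 1\<^sub>m n - M" unfolding C_def char_matrix_def
          using M by (intro eq_matI) auto
        then have "C * R = (s \<cdot>\<^sub>m 1\<^sub>m n) * R - M * R"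
          using minus_mult_distrib_mat[of "s \<cdot>\<^sub>m 1\<^sub>m n" n n M R n] M R by simp
        also have "(s \<cdot>\<^sub>m 1\<^sub>m n) * R = s \<cdot>\<^sub>m R" using mult_smult_assoc_mat[OF one_carrier_mat R, of s] R by simp
        finally show ?thesis unfolding MR using R by (intro eq_matI) (auto simp: algebra_simps)
      qed
      then have "C * (c \<cdot>\<^sub>m R) = c \<cdot>\<^sub>m ((s - lam) \<cdot>\<^sub>m R)" using mult_smult_distrib[OF C R] by simp
      also have "\<dots> = R" using R cs by (intro eq_matI) (auto simp flip: mult.assoc)
      finally show ?thesis .
    qed
    have "C * (1\<^sub>m n + c \<cdot>\<^sub>m R) = C + R"
      using mult_add_distrib_mat[OF C one_carrier_mat, of "c \<cdot>\<^sub>m R"] C R CR by simp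
    also have "\<dots> = - char_matrix N s"
      unfolding C_def char_matrix_def N_def using M R by (intro eq_matI) auto
    finally have "det (- char_matrix N s) = det C * det (1\<^sub>m n + c \<cdot>\<^sub>m R)"
      using det_mult[OF C, of "1\<^sub>m n + c \<cdot>\<^sub>m R"] R by simp
    also have "c \<cdot>\<^sub>m R = mat n n (\<lambda>(i,j). (c \<cdot>\<^sub>v v) $ i * v $ j)"
      unfolding R_def using vc by (intro eq_matI) auto
    also have "det (1\<^sub>m n + \<dots>) = 1 + c * a"
      using det_one_add_outer[of "c \<cdot>\<^sub>v v" n v] vc by (simp add: a_def)
    finally have "(s - lam) * det (- char_matrix N s) = det C * ((s - lam) + (c * (s - lam)) * a)"
      by (simp add: algebra_simps)
    then show ?thesis by (simp add: cs C_def)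
  qed
  have poly_eq: "[:- lam, 1:] * char_poly N = char_poly M * [:a - lam, 1:]" (is "?p = ?q")
  proof (rule ccontr)
    assume "?p \<noteq> ?q"
    then have "finite {s. poly (?p - ?q) s = 0}" by (intro poly_roots_finite) simp
    moreover have "UNIV - {lam} \<subseteq> {s. poly (?p - ?q) s = 0}"
      using dets by (auto simp: char_poly_matrix[OF M(1)] char_poly_matrix[OF N] algebra_simps)
    ultimately have "finite (UNIV - {lam} :: real set)" by (rule finite_subset[rotated])
    then show False using infinite_UNIV_char_0 by auto
  qed
  have nz: "char_poly M \<noteq> 0" "char_poly N \<noteq> 0"
    using degree_monic_char_poly[OF M(1)] degree_monic_char_poly[OF N] by auto
  \<comment> \<open>Pairing an eigenvector \<open>y\<close> of \<open>N\<close> with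
    \<open>v\<close> leaves \<open>(v \<bullet> y) * a = 0\<close>. So \<open>y\<close> is
    orthogonal to \<open>v\<close> and an eigenvector of \<open>M\<close> for \<open>lam\<close>,
    which \<open>unique\<close> excludes.\<close>
  have "\<not> eigenvalue N lam"
  proof
    assume "eigenvalue N lam"
    then obtain y where y: "y \<in> carrier_vec n" "y \<noteq> 0\<^sub>v n" "N *\<^sub>v y = lam \<cdot>\<^sub>v y"
      using N by (auto simp: eigenvalue_def eigenvector_def)
    have "v \<bullet> (N *\<^sub>v y) = v \<bullet> (M *\<^sub>v y) - (v \<bullet> y) * a"
      unfolding Ny[OF y(1)] using vc M y(1) by (simp add: scalar_prod_minus_distrib[of _ n] a_def)
    also have "v \<bullet> (M *\<^sub>v y) = lam * (v \<bullet> y)"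
      using symmetric_scalar_prod[OF M vc y(1)] Mv y(1) vc comm_scalar_prod[OF vc y(1)] by simp
    finally have "(v \<bullet> y) * a = 0" using y vc by simp
    then have vy: "v \<bullet> y = 0" using a by simp
    have "M *\<^sub>v y = lam \<cdot>\<^sub>v y" using y(3) vc M y(1) unfolding Ny[OF y(1)] vy
      by (simp add: vec_eq_iff)
    then show False using unique[OF y(1) _ vy] y(2) by simp
  qed
  then have "poly (char_poly N) lam \<noteq> 0" using eigenvalue_root_char_poly[OF N] by simp
  then have oN: "Polynomial.order lam (char_poly N) = 0" by (rule order_0I)
  have oa: "Polynomial.order lam [:a - lam, 1:] = 0" by (rule order_0I) (use a in simp)
  have "Polynomial.order lam ([:- lam, 1:] * char_poly N) = Suc 0"
  proof -
    have o1: "Polynomial.order lam [:- lam, 1:] = 1" using order_power_n_n[of lam 1] by simp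
    have nz': "[:- lam, 1:] * char_poly N \<noteq> 0" using nz(2) by (simp only: mult_eq_0_iff pCons_eq_0_iff) simp
    show ?thesis unfolding order_mult[OF nz'] o1 oN by simp
  qed
  moreover have "Polynomial.order lam (char_poly M * [:a - lam, 1:]) = Polynomial.order lam (char_poly M)"
  proof -
    have nz': "char_poly M * [:a - lam, 1:] \<noteq> 0" using nz(1) by (simp only: mult_eq_0_iff pCons_eq_0_iff) simp
    show ?thesis unfolding order_mult[OF nz'] oa by simp
  qed
  ultimately show ?thesis using poly_eq by simp
qed

text \<open>Two orthogonal eigenvectors with negative eigenvalues, equal or not, would span a plane
  on which the form is negative definite, and every plane meets the hyperplane
  \<open>f \<bullet> x = 0\<close> in a nonzero vector. The case of equal eigenvalues gives
  multiplicity one.\<close>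

lemma unique_negative_eigenvalue:
  fixes M :: "real mat"
  assumes M: "M \<in> carrier_mat n n" "transpose_mat M = M"
    and f: "f \<in> carrier_vec n"
    and hyper: "\<And>x. x \<in> carrier_vec n \<Longrightarrow> f \<bullet> x = 0 \<Longrightarrow> x \<bullet> (M *\<^sub>v x) \<ge> 0"
    and x0: "x0 \<in> carrier_vec n" "x0 \<bullet> (M *\<^sub>v x0) < 0"
  shows "\<exists>!k. k < 0 \<and> eigenvalue M k"
    and "k < 0 \<Longrightarrow> eigenvalue M k \<Longrightarrow> Polynomial.order k (char_poly M) = 1"
proof -
  have indep: "y = 0\<^sub>v n"
    if k: "k < 0" "l < 0" and x: "eigenvector M x k" and y: "y \<in> carrier_vec n" "M *\<^sub>v y = l \<cdot>\<^sub>v y"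
      and o: "x \<bullet> y = 0" for k l x y
  proof (rule ccontr)
    assume y0: "y \<noteq> 0\<^sub>v n"
    have xc: "x \<in> carrier_vec n" and x0: "x \<noteq> 0\<^sub>v n" and Mx: "M *\<^sub>v x = k \<cdot>\<^sub>v x"
      using x M by (auto simp: eigenvector_def)
    have xx: "x \<bullet> x > 0" and yy: "y \<bullet> y > 0"
      using scalar_prod_self_pos[OF xc x0] scalar_prod_self_pos[OF y(1) y0] by auto
    have yx: "y \<bullet> x = 0" using o comm_scalar_prod[OF xc y(1)] by simp
    \<comment> \<open>A nonzero combination of \<open>x\<close> and \<open>y\<close> in the kernel
      of \<open>f\<close>.\<close>
    define al be where "al = (if f \<bullet> x = 0 then 1 else f \<bullet> y)" and "be = (if f \<bullet> x = 0 then 0 else - (f \<bullet> x))"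
    have ab: "al \<noteq> 0 \<or> be \<noteq> 0" by (auto simp: al_def be_def)
    let ?z = "al \<cdot>\<^sub>v x + be \<cdot>\<^sub>v y"
    have z: "?z \<in> carrier_vec n" using xc y by simp
    have "f \<bullet> ?z = al * (f \<bullet> x) + be * (f \<bullet> y)"
      using f xc y by (simp add: scalar_prod_add_distrib[of _ n])
    then have "f \<bullet> ?z = 0" by (auto simp: al_def be_def)
    then have "0 \<le> ?z \<bullet> (M *\<^sub>v ?z)" by (rule hyper[OF z])
    also have "M *\<^sub>v ?z = (al * k) \<cdot>\<^sub>v x + (be * l) \<cdot>\<^sub>v y"
      using mult_add_distrib_mat_vec[OF M(1), of "al \<cdot>\<^sub>v x" "be \<cdot>\<^sub>v y"] xc y
        mult_mat_vec[OF M(1) xc] mult_mat_vec[OF M(1) y(1)] Mx by (simp add: smult_smult_assoc)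
    also have "?z \<bullet> \<dots> = k * (al * al * (x \<bullet> x)) + l * (be * be * (y \<bullet> y))"
      using xc y by (simp add: scalar_prod_add_distrib[of _ n] add_scalar_prod_distrib[of _ n] o yx algebra_simps)
    also have "\<dots> < 0"
    proof -
      have p: "0 \<le> al * al * (x \<bullet> x)" "0 \<le> be * be * (y \<bullet> y)" using xx yy by auto
      then have np: "k * (al * al * (x \<bullet> x)) \<le> 0" "l * (be * be * (y \<bullet> y)) \<le> 0"
        using k by (auto intro: mult_nonpos_nonneg)
      from ab show ?thesis
      proof
        assume "al \<noteq> 0"
        then have "0 < al * al * (x \<bullet> x)" using xx by (simp add: zero_less_mult_iff) linarith
        then have "k * (al * al * (x \<bullet> x)) < 0" using k by (intro mult_neg_pos)
        then show ?thesis using np by linarith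
      next
        assume "be \<noteq> 0"
        then have "0 < be * be * (y \<bullet> y)" using yy by (simp add: zero_less_mult_iff) linarith
        then have "l * (be * be * (y \<bullet> y)) < 0" using k by (intro mult_neg_pos)
        then show ?thesis using np by linarith
      qed
    qed
    finally show False by simp
  qed
  have unique: "k = l" if "k < 0" "eigenvalue M k" "l < 0" "eigenvalue M l" for k l
  proof (rule ccontr)
    assume kl: "k \<noteq> l"
    obtain x y where x: "eigenvector M x k" and y: "eigenvector M y l"
      using \<open>eigenvalue M k\<close> \<open>eigenvalue M l\<close> by (auto simp: eigenvalue_def)
    have xc: "x \<in> carrier_vec n" "M *\<^sub>v x = k \<cdot>\<^sub>v x" and yc: "y \<in> carrier_vec n" "y \<noteq> 0\<^sub>v n" "M *\<^sub>v y = l \<cdot>\<^sub>v y"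
      using x y M by (auto simp: eigenvector_def)
    have "l * (x \<bullet> y) = k * (x \<bullet> y)"
      using symmetric_scalar_prod[OF M xc(1) yc(1)] xc yc comm_scalar_prod[OF xc(1) yc(1)] by simp
    then have "x \<bullet> y = 0" using kl by simp
    then show False using indep[OF _ _ x yc(1,3)] that yc(2) by blast
  qed
  show "\<exists>!k. k < 0 \<and> eigenvalue M k"
    using exists_negative_eigenvalue[OF M x0] unique by blast
  assume k: "k < 0" "eigenvalue M k"
  then obtain v where v: "eigenvector M v k" by (auto simp: eigenvalue_def)
  show "Polynomial.order k (char_poly M) = 1"
    by (rule simple_eigenvalue_order[OF M v]) (use indep[OF k(1) k(1) v] in blast)
qed

section \<open>A perturbed fixed point equation\<close>

text \<open>Bounded and Lipschitz in the l1 distance on the unit cube around \<open>x0\<close>,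
  uniformly in the parameter. Boundedness is included because closure under products requires it and
  because it keeps the iteration below in the cube.\<close>

definition tame_bound :: "'i set \<Rightarrow> ('i \<Rightarrow> real) \<Rightarrow> (real \<Rightarrow> ('i \<Rightarrow> real) \<Rightarrow> real) \<Rightarrow> real \<Rightarrow> bool" where
  "tame_bound I x0 f L \<longleftrightarrow> L \<ge> 0 \<and> (\<forall>e x y. 0 \<le> e \<longrightarrow> e \<le> 1 \<longrightarrow>
     (\<forall>k\<in>I. \<bar>x k - x0 k\<bar> \<le> 1) \<longrightarrow> (\<forall>k\<in>I. \<bar>y k - x0 k\<bar> \<le> 1) \<longrightarrow>
     \<bar>f e x\<bar> \<le> L \<and> \<bar>f e x - f e y\<bar> \<le> L * (\<Sum>k\<in>I. \<bar>x k - y k\<bar>))"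

definition tame :: "'i set \<Rightarrow> ('i \<Rightarrow> real) \<Rightarrow> (real \<Rightarrow> ('i \<Rightarrow> real) \<Rightarrow> real) \<Rightarrow> bool" where
  "tame I x0 f \<longleftrightarrow> (\<exists>L. tame_bound I x0 f L)"

lemma tameI:
  assumes "L \<ge> 0" "\<And>e x y. 0 \<le> e \<Longrightarrow> e \<le> 1 \<Longrightarrow> (\<forall>k\<in>I. \<bar>x k - x0 k\<bar> \<le> 1) \<Longrightarrow>
    (\<forall>k\<in>I. \<bar>y k - x0 k\<bar> \<le> 1) \<Longrightarrow>
    \<bar>f e x\<bar> \<le> L \<and> \<bar>f e x - f e y\<bar> \<le> L * (\<Sum>k\<in>I. \<bar>x k - y k\<bar>)"
  shows "tame I x0 f"
  unfolding tame_def tame_bound_def using assms by (intro exI[of _ L]) simp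

lemma tame_boundD:
  assumes "tame_bound I x0 f L"
  shows "L \<ge> 0" "0 \<le> e \<Longrightarrow> e \<le> 1 \<Longrightarrow> \<forall>k\<in>I. \<bar>x k - x0 k\<bar> \<le> 1 \<Longrightarrow>
    \<forall>k\<in>I. \<bar>y k - x0 k\<bar> \<le> 1 \<Longrightarrow>
    \<bar>f e x\<bar> \<le> L \<and> \<bar>f e x - f e y\<bar> \<le> L * (\<Sum>k\<in>I. \<bar>x k - y k\<bar>)"
  using assms unfolding tame_bound_def by blast+

lemma tame_const: "tame I x0 (\<lambda>e x. c)"
  by (rule tameI[of "\<bar>c\<bar>"]) (auto intro!: mult_nonneg_nonneg sum_nonneg)

lemma tame_param: "tame I x0 (\<lambda>e x. e)"
  by (rule tameI[of 1]) (auto intro!: sum_nonneg)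

lemma tame_coord:
  assumes "finite I" "k \<in> I"
  shows "tame I x0 (\<lambda>e x. x k)"
proof (rule tameI[of "\<bar>x0 k\<bar> + 1"])
  show "0 \<le> \<bar>x0 k\<bar> + 1" by simp
  fix x y :: "'a \<Rightarrow> real"
  assume x: "\<forall>k\<in>I. \<bar>x k - x0 k\<bar> \<le> 1"
  have "\<bar>x k - y k\<bar> \<le> 1 * (\<Sum>k\<in>I. \<bar>x k - y k\<bar>)"
    using member_le_sum[of k I "\<lambda>k. \<bar>x k - y k\<bar>"] assms by simp
  also have "\<dots> \<le> (\<bar>x0 k\<bar> + 1) * (\<Sum>k\<in>I. \<bar>x k - y k\<bar>)"
    by (intro mult_right_mono sum_nonneg) auto
  finally show "\<bar>x k\<bar> \<le> \<bar>x0 k\<bar> + 1 \<and> \<bar>x k - y k\<bar> \<le> (\<bar>x0 k\<bar> + 1) * (\<Sum>k\<in>I. \<bar>x k - y k\<bar>)"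
    using x assms(2) by force
qed

lemma tame_add:
  assumes "tame I x0 f" "tame I x0 g"
  shows "tame I x0 (\<lambda>e x. f e x + g e x)"
proof -
  obtain L where "tame_bound I x0 f L" using assms(1) by (auto simp: tame_def)
  note L = tame_boundD[OF this]
  obtain K where "tame_bound I x0 g K" using assms(2) by (auto simp: tame_def)
  note K = tame_boundD[OF this]
  show ?thesis
  proof (rule tameI[of "L + K"])
    show "L + K \<ge> 0" using L(1) K(1) by simp
    fix e :: real and x y :: "'a \<Rightarrow> real"
    assume a: "0 \<le> e" "e \<le> 1" "\<forall>k\<in>I. \<bar>x k - x0 k\<bar> \<le> 1" "\<forall>k\<in>I. \<bar>y k - x0 k\<bar> \<le> 1"
    show "\<bar>f e x + g e x\<bar> \<le> L + K \<and> \<bar>f e x + g e x - (f e y + g e y)\<bar> \<le> (L + K) * (\<Sum>k\<in>I. \<bar>x k - y k\<bar>)"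
      unfolding distrib_right using L(2)[OF a] K(2)[OF a] by linarith
  qed
qed

lemma tame_mult:
  assumes "tame I x0 f" "tame I x0 g"
  shows "tame I x0 (\<lambda>e x. f e x * g e x)"
proof -
  obtain L where "tame_bound I x0 f L" using assms(1) by (auto simp: tame_def)
  note L = tame_boundD[OF this]
  obtain K where "tame_bound I x0 g K" using assms(2) by (auto simp: tame_def)
  note K = tame_boundD[OF this]
  show ?thesis
  proof (rule tameI[of "L * K + L * K"])
    show "L * K + L * K \<ge> 0" using L(1) K(1) by simp
    fix e :: real and x y :: "'a \<Rightarrow> real"
    assume a: "0 \<le> e" "e \<le> 1" "\<forall>k\<in>I. \<bar>x k - x0 k\<bar> \<le> 1" "\<forall>k\<in>I. \<bar>y k - x0 k\<bar> \<le> 1"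
    define d where "d = (\<Sum>k\<in>I. \<bar>x k - y k\<bar>)"
    have d: "d \<ge> 0" by (auto simp: d_def intro: sum_nonneg)
    have f: "\<bar>f e x\<bar> \<le> L" "\<bar>f e x - f e y\<bar> \<le> L * d" using L(2)[OF a] by (auto simp: d_def)
    have g: "\<bar>g e x\<bar> \<le> K" "\<bar>g e y\<bar> \<le> K" "\<bar>g e x - g e y\<bar> \<le> K * d"
      using K(2)[OF a] K(2)[OF a(1,2,4,3)] by (auto simp: d_def)
    have "\<bar>f e x * g e x\<bar> \<le> L * K" unfolding abs_mult using f(1) g(1) L(1) by (intro mult_mono) auto
    moreover have "0 \<le> L * K" using L(1) K(1) by simp
    moreover have "\<bar>f e x * g e x - f e y * g e y\<bar> \<le> (L * K + L * K) * d"
    proof -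
      have "f e x * g e x - f e y * g e y = f e x * (g e x - g e y) + (f e x - f e y) * g e y"
        by (simp add: algebra_simps)
      also have "\<bar>\<dots>\<bar> \<le> \<bar>f e x\<bar> * \<bar>g e x - g e y\<bar> + \<bar>f e x - f e y\<bar> * \<bar>g e y\<bar>"
        by (metis abs_mult abs_triangle_ineq)
      also have "\<dots> \<le> L * (K * d) + (L * d) * K"
        using f g L(1) K(1) d by (intro add_mono mult_mono) auto
      finally show ?thesis by (simp add: algebra_simps)
    qed
    ultimately show "\<bar>f e x * g e x\<bar> \<le> L * K + L * K \<and>
        \<bar>f e x * g e x - f e y * g e y\<bar> \<le> (L * K + L * K) * (\<Sum>k\<in>I. \<bar>x k - y k\<bar>)"
      unfolding d_def by linarith
  qed
qed

lemma tame_sum: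
  assumes "\<And>a. a \<in> A \<Longrightarrow> tame I x0 (f a)"
  shows "tame I x0 (\<lambda>e x. \<Sum>a\<in>A. f a e x)"
  using assms
proof (induction A rule: infinite_finite_induct)
  case (insert a A)
  then show ?case by (auto intro!: tame_add)
qed (auto intro: tame_const)

lemma tame_uminus: "tame I x0 f \<Longrightarrow> tame I x0 (\<lambda>e x. - f e x)"
  using tame_mult[OF tame_const[of I x0 "-1"], of f] by simp

text \<open>Banach's argument: for small \<open>e\<close> the map
  \<open>z \<mapsto> x0 + e F z\<close> sends the cube into itself and halves l1 distances, so its
  iterates from \<open>x0\<close> converge to a fixed point. Boundedness of \<open>F\<close> gives
  the distance \<open>c * e\<close>.\<close>

lemma perturbed_fixed_point:
  fixes x0 :: "'i \<Rightarrow> real"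
  assumes I: "finite I" and F: "\<And>k. k \<in> I \<Longrightarrow> tame I x0 (F k)"
  obtains c e0 where "c > 0" "e0 > 0"
    "\<And>e. 0 < e \<Longrightarrow> e \<le> e0 \<Longrightarrow> \<exists>x. \<forall>k\<in>I. x k = x0 k + e * F k e x \<and> \<bar>x k - x0 k\<bar> \<le> c * e"
proof -
  have "\<exists>L. \<forall>k\<in>I. tame_bound I x0 (F k) (L k)"
    using F by (intro bchoice) (auto simp: tame_def)
  then obtain Lf where "\<And>k. k \<in> I \<Longrightarrow> tame_bound I x0 (F k) (Lf k)" by blast
  note Lf = tame_boundD[OF this]
  \<comment> \<open>The summand 1 gives \<open>e \<le> e * L \<le> 1\<close>, so that
    \<open>e\<close> is in the range where the bounds hold.\<close>
  define L where "L = 1 + (\<Sum>k\<in>I. Lf k)"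
  have L1: "L \<ge> 1" using Lf(1) by (auto simp: L_def intro: sum_nonneg)
  have LfL: "Lf k \<le> L" if "k \<in> I" for k
    using member_le_sum[of k I Lf] that I Lf(1) by (auto simp: L_def)
  define n where "n = real (card I)"
  \<comment> \<open>Chosen for \<open>e * L \<le> 1\<close>, staying in the cube, and
    \<open>n * (e * L) \<le> 1/2\<close>, the contraction factor after summing over the
    \<open>n\<close> coordinates.\<close>
  define e0 where "e0 = 1 / (2 * (n + 1) * L)"
  have n0: "n \<ge> 0" by (simp add: n_def)
  have e0: "e0 > 0" using n0 L1 by (simp add: e0_def)
  show thesis
  proof (rule that[of L e0])
    show "L > 0" using L1 by simp
    show "e0 > 0" by fact
    fix e :: real assume e: "0 < e" "e \<le> e0"
    have "e * (2 * (n + 1) * L) \<le> e0 * (2 * (n + 1) * L)" using e n0 L1 by (intro mult_right_mono) auto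
    also have "\<dots> = 1" using n0 L1 by (simp add: e0_def)
    finally have small: "2 * (e * L) + 2 * (n * (e * L)) \<le> 1" by (simp add: algebra_simps)
    have eL: "0 \<le> e * L" using e L1 by simp
    have neL: "0 \<le> n * (e * L)" using n0 eL by simp
    have s1: "e * L \<le> 1" "n * (e * L) \<le> 1/2" using small eL neL by linarith+
    have "e * 1 \<le> e * L" using L1 e by (intro mult_left_mono) auto
    then have e1: "e \<le> 1" using s1(1) by linarith
    define x where "x = rec_nat x0 (\<lambda>_ z k. x0 k + e * F k e z)"
    have x_0: "x 0 = x0" and x_Suc: "x (Suc m) k = x0 k + e * F k e (x m)" for m k
      by (auto simp: x_def)
    define Cube where "Cube = {z. \<forall>k\<in>I. \<bar>z k - x0 k\<bar> \<le> 1}"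
    have Fb: "\<bar>F k e z\<bar> \<le> L" if "z \<in> Cube" "k \<in> I" for z k
      using Lf(2)[of k e z z] that e e1 LfL[of k] by (auto simp: Cube_def)
    have Fl: "\<bar>F k e z - F k e w\<bar> \<le> L * (\<Sum>k\<in>I. \<bar>z k - w k\<bar>)" if "z \<in> Cube" "w \<in> Cube" "k \<in> I" for z w k
    proof -
      have "\<bar>F k e z - F k e w\<bar> \<le> Lf k * (\<Sum>k\<in>I. \<bar>z k - w k\<bar>)"
        using Lf(2)[of k e z w] that e e1 by (auto simp: Cube_def)
      also have "\<dots> \<le> L * (\<Sum>k\<in>I. \<bar>z k - w k\<bar>)"
        using LfL that by (intro mult_right_mono sum_nonneg) auto
      finally show ?thesis .
    qed
    have dist: "\<bar>e * F k e z\<bar> \<le> e * L" if "z \<in> Cube" "k \<in> I" for z k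
      using Fb[OF that] e by (simp add: abs_mult)
    have cube: "x m \<in> Cube" for m
    proof (induction m)
      case 0 then show ?case by (simp add: x_0 Cube_def)
    next
      case (Suc m)
      then show ?case using dist s1 by (force simp: Cube_def x_Suc)
    qed
    define d where "d m = (\<Sum>k\<in>I. \<bar>x (Suc m) k - x m k\<bar>)" for m
    have step: "d (Suc m) \<le> d m / 2" for m
    proof -
      have "d (Suc m) \<le> (\<Sum>k\<in>I. e * (L * d m))"
        unfolding d_def[of "Suc m"]
      proof (rule sum_mono)
        fix k assume k: "k \<in> I"
        have "\<bar>x (Suc (Suc m)) k - x (Suc m) k\<bar> = e * \<bar>F k e (x (Suc m)) - F k e (x m)\<bar>"
          unfolding x_Suc[of "Suc m"] x_Suc[of m] using e by (simp add: right_diff_distrib[symmetric] abs_mult)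
        also have "\<dots> \<le> e * (L * d m)"
          unfolding d_def using e by (intro mult_left_mono Fl cube k) auto
        finally show "\<bar>x (Suc (Suc m)) k - x (Suc m) k\<bar> \<le> e * (L * d m)" .
      qed
      also have "\<dots> = n * (e * L) * d m" by (simp add: n_def)
      also have "\<dots> \<le> 1/2 * d m" using s1 by (intro mult_right_mono) (auto simp: d_def intro: sum_nonneg)
      finally show ?thesis by simp
    qed
    have geo: "d m \<le> d 0 * (1/2)^m" for m
    proof (induction m)
      case (Suc m) then show ?case using step[of m] by simp
    qed simp
    have conv: "\<exists>l. (\<lambda>m. x m k) \<longlonglongrightarrow> l" if k: "k \<in> I" for k
    proof -
      have "summable (\<lambda>m. x (Suc m) k - x m k)"
      proof (rule summable_comparison_test'[of "\<lambda>m. d 0 * (1/2)^m"])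
        show "summable (\<lambda>m. d 0 * (1 / 2) ^ m)" by (intro summable_mult summable_geometric) simp
        fix m
        have "\<bar>x (Suc m) k - x m k\<bar> \<le> d m"
          unfolding d_def using member_le_sum[of k I "\<lambda>k. \<bar>x (Suc m) k - x m k\<bar>"] k I by simp
        then show "norm (x (Suc m) k - x m k) \<le> d 0 * (1/2)^m" using geo[of m] by simp
      qed
      then have "(\<lambda>m. \<Sum>i<m. x (Suc i) k - x i k) \<longlonglongrightarrow> (\<Sum>m. x (Suc m) k - x m k)"
        by (rule summable_LIMSEQ)
      then have "(\<lambda>m. (x m k - x 0 k) + x 0 k) \<longlonglongrightarrow> (\<Sum>m. x (Suc m) k - x m k) + x 0 k"
        unfolding sum_lessThan_telescope[of "\<lambda>i. x i k", symmetric] by (intro tendsto_add tendsto_const)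
      then show ?thesis by auto
    qed
    then obtain l where l: "\<And>k. k \<in> I \<Longrightarrow> (\<lambda>m. x m k) \<longlonglongrightarrow> l k" by metis
    have lc: "l \<in> Cube" unfolding Cube_def
    proof (intro CollectI ballI)
      fix k assume k: "k \<in> I"
      have "(\<lambda>m. \<bar>x m k - x0 k\<bar>) \<longlonglongrightarrow> \<bar>l k - x0 k\<bar>" by (intro tendsto_intros l k)
      then show "\<bar>l k - x0 k\<bar> \<le> 1"
        by (rule LIMSEQ_le_const2) (use cube k in \<open>auto simp: Cube_def\<close>)
    qed
    have fixed: "l k = x0 k + e * F k e l" if k: "k \<in> I" for k
    proof -
      have "(\<lambda>m. F k e (x m) - F k e l) \<longlonglongrightarrow> 0"
      proof (rule tendsto_0_le)
        have "(\<lambda>m. (\<Sum>k\<in>I. \<bar>x m k - l k\<bar>)) \<longlonglongrightarrow> (\<Sum>k\<in>I. \<bar>l k - l k\<bar>)"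
          by (intro tendsto_intros l)
        then show "(\<lambda>m. (\<Sum>k\<in>I. \<bar>x m k - l k\<bar>)) \<longlonglongrightarrow> 0" by simp
        show "\<forall>\<^sub>F m in sequentially. norm (F k e (x m) - F k e l) \<le> norm (\<Sum>k\<in>I. \<bar>x m k - l k\<bar>) * L"
          using Fl[OF cube lc k] by (simp add: mult.commute sum_nonneg)
      qed
      then have "(\<lambda>m. x0 k + e * F k e (x m)) \<longlonglongrightarrow> x0 k + e * F k e l"
        by (intro tendsto_intros) (simp add: LIM_zero_iff)
      then have "(\<lambda>m. x (Suc m) k) \<longlonglongrightarrow> x0 k + e * F k e l" by (simp add: x_Suc)
      moreover have "(\<lambda>m. x (Suc m) k) \<longlonglongrightarrow> l k" using l[OF k] by (rule LIMSEQ_Suc)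
      ultimately show ?thesis using LIMSEQ_unique by blast
    qed
    moreover have "\<bar>l k - x0 k\<bar> \<le> L * e" if "k \<in> I" for k
      using fixed[OF that] dist[OF lc that] by (simp add: mult.commute)
    ultimately show "\<exists>x. \<forall>k\<in>I. x k = x0 k + e * F k e x \<and> \<bar>x k - x0 k\<bar> \<le> L * e" by blast
  qed
qed

section \<open>A matrix for a graph with a complete minor\<close>

lemma right_inverse_of_injective:
  fixes B :: "nat \<Rightarrow> nat \<Rightarrow> real"
  assumes inj: "\<And>x. (\<And>u. u < n \<Longrightarrow> (\<Sum>w<n. B u w * x w) = 0) \<Longrightarrow> \<forall>u<n. x u = 0"
  obtains G where "\<And>u v. u < n \<Longrightarrow> v < n \<Longrightarrow> (\<Sum>w<n. B u w * G w v) = (if u = v then 1 else 0)"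
proof -
  define M where "M = mat n n (\<lambda>(i,j). B i j)"
  have M: "M \<in> carrier_mat n n" by (simp add: M_def)
  have "det M \<noteq> 0"
  proof
    assume "det M = 0"
    then obtain v where v: "v \<in> carrier_vec n" "v \<noteq> 0\<^sub>v n" "M *\<^sub>v v = 0\<^sub>v n"
      using det_0_iff_vec_prod_zero[OF M] by auto
    have "(\<Sum>w<n. B u w * v $ w) = 0" if "u < n" for u
    proof -
      have "(M *\<^sub>v v) $ u = (\<Sum>w<n. B u w * v $ w)"
        using that v(1) by (simp add: M_def scalar_prod_def atLeast0LessThan)
      then show ?thesis using v(3) that by simp
    qed
    then have "\<forall>u<n. v $ u = 0" by (rule inj)
    then show False using v by (auto simp: vec_eq_iff)
  qed
  from det_non_zero_imp_unit[OF M this, unfolded Units_def, of "()"]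
  obtain N where N: "N \<in> carrier_mat n n" and MN: "M * N = 1\<^sub>m n"
    by (auto simp: ring_mat_def)
  show thesis
  proof (rule that)
    fix u v assume uv: "u < n" "v < n"
    have "(M * N) $$ (u,v) = (\<Sum>w<n. B u w * N $$ (w,v))"
      using uv N by (simp add: M_def scalar_prod_def atLeast0LessThan)
    then show "(\<Sum>w<n. B u w * N $$ (w,v)) = (if u = v then 1 else 0)"
      using uv by (simp add: MN)
  qed
qed

text \<open>Vertices are \<open>0, \<dots>, n - 1\<close>; the branch sets of the \<open>K\<^sub>t\<close>-model are the fibres of the label \<open>b\<close>
  over \<open>{..<t}\<close>, each with a root; vertices with larger label lie outside the model.\<close>

locale clique_model =
  fixes n t :: nat and A :: "nat \<Rightarrow> nat \<Rightarrow> bool" and b r :: "nat \<Rightarrow> nat"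
  assumes sym: "A u w \<Longrightarrow> A w u"
    and irrefl: "\<not> A u u"
    and root_less: "k < t \<Longrightarrow> r k < n"
    and label_root: "k < t \<Longrightarrow> b (r k) = k"
    and branch_connected: "u < n \<Longrightarrow> b u < t \<Longrightarrow>
      (r (b u), u) \<in> {(x, y). x < n \<and> y < n \<and> A x y \<and> b x = b u \<and> b y = b u}\<^sup>*"
    and branch_adjacent: "k < l \<Longrightarrow> l < t \<Longrightarrow> \<exists>u<n. \<exists>w<n. A u w \<and> b u = k \<and> b w = l"
begin

section \<open>The Laplacian of the branch sets\<close>

definition nonroot :: "nat \<Rightarrow> bool" where "nonroot u \<longleftrightarrow> (\<forall>k<t. u \<noteq> r k)"

definition intra :: "nat \<Rightarrow> nat \<Rightarrow> real" where
  "intra u w = (if A u w \<and> b u = b w \<and> b u < t then 1 else 0)"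

definition dg :: "nat \<Rightarrow> real" where "dg u = (if b u < t then \<Sum>w<n. intra u w else 1)"

text \<open>The graph Laplacian of the edges inside branch sets. Outside the model the artificial
  degree 1 makes it the identity, so these vertices can be eliminated without a root.\<close>

definition lap :: "(nat \<Rightarrow> real) \<Rightarrow> nat \<Rightarrow> real" where
  "lap x u = dg u * x u - (\<Sum>w<n. intra u w * x w)"

lemma A_commute: "A u w \<longleftrightarrow> A w u"
  using sym by blast

lemma intra_sym: "intra u w = intra w u"
  unfolding intra_def A_commute[of w u] by (cases "b u = b w") simp_all

lemma intra_outside: "t \<le> b u \<Longrightarrow> intra u w = 0"
  by (simp add: intra_def)

lemma lap_branch: "b u < t \<Longrightarrow> lap x u = (\<Sum>w<n. intra u w * (x u - x w))"
  by (simp add: lap_def dg_def sum_distrib_right right_diff_distrib sum_subtractf)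

lemma lap_outside: "t \<le> b u \<Longrightarrow> lap x u = x u"
  by (simp add: lap_def dg_def intra_outside)

lemma lap_add_scale: "lap (\<lambda>w. x w + e * y w) u = lap x u + e * lap y u"
  by (simp add: lap_def sum.distrib sum_distrib_left algebra_simps)

text \<open>Summation by parts: the double sum is averaged with its transpose.\<close>

lemma energy:
  "(\<Sum>u<n. x u * lap x u) =
     (\<Sum>u<n. \<Sum>w<n. intra u w * (x u - x w)\<^sup>2) / 2 + (\<Sum>u<n. if t \<le> b u then (x u)\<^sup>2 else 0)"
proof -
  let ?S = "\<Sum>u<n. \<Sum>w<n. intra u w * (x u * (x u - x w))"
  let ?T = "\<Sum>u<n. \<Sum>w<n. intra u w * (x w * (x w - x u))"
  have "x u * lap x u = (\<Sum>w<n. intra u w * (x u * (x u - x w))) + (if t \<le> b u then (x u)\<^sup>2 else 0)" for u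
    by (cases "b u < t") (auto simp: lap_branch lap_outside intra_outside power2_eq_square
        sum_distrib_left intro!: sum.cong)
  then have "(\<Sum>u<n. x u * lap x u) = ?S + (\<Sum>u<n. if t \<le> b u then (x u)\<^sup>2 else 0)"
    by (simp add: sum.distrib)
  moreover have "?S = ?T"
    by (subst sum.swap) (simp only: intra_sym)
  moreover have "?S + ?T = (\<Sum>u<n. \<Sum>w<n. intra u w * (x u - x w)\<^sup>2)"
    unfolding sum.distrib[symmetric]
    by (intro sum.cong refl) (simp add: power2_eq_square algebra_simps)
  ultimately show ?thesis by linarith
qed

text \<open>From the root, where \<open>x\<close> vanishes, a path inside the branch set leads to
  each vertex \<open>u\<close>, so \<open>x u\<close> is at most the path length times the largest
  difference along an edge, which the energy controls. Outside the model
  \<open>(x u)\<^sup>2\<close> itself is a term of the energy.\<close>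

lemma poincare:
  obtains K where "K > 0"
    "\<And>x. (\<And>k. k < t \<Longrightarrow> x (r k) = 0) \<Longrightarrow> (\<Sum>u<n. (x u)\<^sup>2) \<le> K * (\<Sum>u<n. x u * lap x u)"
proof -
  \<comment> \<open>\<open>m\<close> is a path length. The vector and the bound are quantified
    inside, so that \<open>m\<close> depends on \<open>u\<close> only and \<open>K\<close> becomes
    uniform.\<close>
  have "\<exists>m::nat. \<forall>(x :: nat \<Rightarrow> real) D. (\<forall>k<t. x (r k) = 0) \<longrightarrow> (\<forall>u<n. \<forall>w<n. intra u w = 1 \<longrightarrow> \<bar>x u - x w\<bar> \<le> D) \<longrightarrow>
      \<bar>x u\<bar> \<le> real m * D" if u: "u < n" "b u < t" for u
    using branch_connected[OF u]
  proof (induction rule: rtrancl_induct)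
    case base
    show ?case using u by (intro exI[of _ 0]) auto
  next
    case (step y z)
    then obtain m :: nat where m: "\<And>(x :: nat \<Rightarrow> real) D. (\<forall>k<t. x (r k) = 0) \<Longrightarrow> (\<forall>u<n. \<forall>w<n. intra u w = 1 \<longrightarrow> \<bar>x u - x w\<bar> \<le> D) \<Longrightarrow>
      \<bar>x y\<bar> \<le> real m * D" by blast
    have yz: "y < n" "z < n" "intra y z = 1" using step(2) u by (auto simp: intra_def)
    show ?case
    proof (intro exI[of _ "Suc m"] allI impI)
      fix x :: "nat \<Rightarrow> real" and D
      assume x: "\<forall>k<t. x (r k) = 0" "\<forall>u<n. \<forall>w<n. intra u w = 1 \<longrightarrow> \<bar>x u - x w\<bar> \<le> D"
      have "\<bar>x y - x z\<bar> \<le> D" using x(2) yz by blast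
      then show "\<bar>x z\<bar> \<le> real (Suc m) * D" using m[OF x] by (simp add: algebra_simps)
    qed
  qed
  then obtain m :: "nat \<Rightarrow> nat" where m: "\<And>u (x :: nat \<Rightarrow> real) D. u < n \<Longrightarrow> b u < t \<Longrightarrow> (\<forall>k<t. x (r k) = 0) \<Longrightarrow>
      (\<forall>u<n. \<forall>w<n. intra u w = 1 \<longrightarrow> \<bar>x u - x w\<bar> \<le> D) \<Longrightarrow> \<bar>x u\<bar> \<le> real (m u) * D"
    by metis
  \<comment> \<open>In each summand, 1 serves the vertices outside the model and
    \<open>2 * (real (m u))\<^sup>2\<close> those inside, the 2 coming from
    \<open>sqrt (2 * Q)\<close>.\<close>
  define K where "K = 1 + (\<Sum>u<n. 1 + 2 * (real (m u))\<^sup>2)"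
  show thesis
  proof (rule that[of K])
    show "K > 0" unfolding K_def by (intro add_pos_nonneg sum_nonneg) auto
    fix x :: "nat \<Rightarrow> real" assume x: "\<And>k. k < t \<Longrightarrow> x (r k) = 0"
    define Q where "Q = (\<Sum>u<n. x u * lap x u)"
    define Q1 where "Q1 = (\<Sum>u<n. \<Sum>w<n. intra u w * (x u - x w)\<^sup>2)"
    define Q2 where "Q2 = (\<Sum>u<n. if t \<le> b u then (x u)\<^sup>2 else 0)"
    have nn: "intra u w * (x u - x w)\<^sup>2 \<ge> 0" for u w by (simp add: intra_def)
    have Q: "Q = Q1 / 2 + Q2" unfolding Q_def Q1_def Q2_def by (rule energy)
    have Q12: "Q1 \<ge> 0" "Q2 \<ge> 0" unfolding Q1_def Q2_def using nn by (auto intro!: sum_nonneg)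
    have D: "\<bar>x u - x w\<bar> \<le> sqrt (2 * Q)" if "u < n" "w < n" "intra u w = 1" for u w
    proof -
      have "(x u - x w)\<^sup>2 \<le> (\<Sum>w<n. intra u w * (x u - x w)\<^sup>2)"
        using member_le_sum[of w "{..<n}" "\<lambda>w. intra u w * (x u - x w)\<^sup>2"] nn that by simp
      also have "\<dots> \<le> Q1" unfolding Q1_def
        using member_le_sum[of u "{..<n}" "\<lambda>u. \<Sum>w<n. intra u w * (x u - x w)\<^sup>2"] nn that
        by (simp add: sum_nonneg)
      also have "\<dots> \<le> 2 * Q" using Q Q12 by simp
      finally have "sqrt ((x u - x w)\<^sup>2) \<le> sqrt (2 * Q)" by (rule real_sqrt_le_mono)
      then show ?thesis by simp
    qed
    have "(x u)\<^sup>2 \<le> (1 + 2 * (real (m u))\<^sup>2) * Q" if u: "u < n" for u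
    proof (cases "b u < t")
      case True
      have "\<bar>x u\<bar> \<le> real (m u) * sqrt (2 * Q)" by (rule m[OF u True]) (use x D in auto)
      then have "\<bar>x u\<bar>\<^sup>2 \<le> (real (m u) * sqrt (2 * Q))\<^sup>2" by (intro power_mono) auto
      also have "\<dots> = 2 * (real (m u))\<^sup>2 * Q" using Q Q12 by (simp add: power_mult_distrib)
      finally show ?thesis using Q Q12 by (simp add: algebra_simps)
    next
      case False
      have "(x u)\<^sup>2 \<le> Q2" unfolding Q2_def
        using member_le_sum[of u "{..<n}" "\<lambda>u. if t \<le> b u then (x u)\<^sup>2 else 0"] u False by simp
      also have "\<dots> \<le> Q" using Q Q12 by simp
      also have "\<dots> \<le> (1 + 2 * (real (m u))\<^sup>2) * Q"
        using Q Q12 mult_right_mono[of 1 "1 + 2 * (real (m u))\<^sup>2" Q] by simp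
      finally show ?thesis .
    qed
    then have "(\<Sum>u<n. (x u)\<^sup>2) \<le> (\<Sum>u<n. (1 + 2 * (real (m u))\<^sup>2) * Q)" by (intro sum_mono) auto
    also have "\<dots> = (\<Sum>u<n. 1 + 2 * (real (m u))\<^sup>2) * Q" by (rule sum_distrib_right[symmetric])
    also have "\<dots> \<le> K * Q" unfolding K_def using Q Q12 by (intro mult_right_mono) auto
    finally show "(\<Sum>u<n. (x u)\<^sup>2) \<le> K * (\<Sum>u<n. x u * lap x u)" unfolding Q_def .
  qed
qed

text \<open>The Green matrix of the Dirichlet problem: \<open>G y\<close> solves the Laplace
  equation with right-hand side \<open>y\<close> off the roots and takes the boundary values
  \<open>y\<close> at the roots.\<close>

definition green :: "(nat \<Rightarrow> nat \<Rightarrow> real) \<Rightarrow> bool" where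
  "green G \<longleftrightarrow> (\<forall>y u. u < n \<longrightarrow>
    (if nonroot u then lap (\<lambda>w. \<Sum>v<n. G w v * y v) u else (\<Sum>v<n. G u v * y v)) = y u)"

text \<open>The system is square, so injectivity is enough: a homogeneous solution vanishes at the
  roots and has zero energy, hence is zero by \<open>poincare\<close>.\<close>

lemma exists_green: "\<exists>G. green G"
proof -
  define B where "B u w = (if nonroot u then (if u = w then dg u else 0) - intra u w
      else if u = w then 1 else 0)" for u w
  have B: "(\<Sum>w<n. B u w * x w) = (if nonroot u then lap x u else x u)" if "u < n" for u x
  proof -
    have "(\<Sum>w<n. (if u = w then dg u else 0) * x w) = (\<Sum>w<n. if u = w then dg u * x w else 0)"
      "(\<Sum>w<n. (if u = w then 1 else 0) * x w) = (\<Sum>w<n. if u = w then x w else 0)"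
      by (intro sum.cong; simp)+
    then show ?thesis using that by (simp add: B_def lap_def left_diff_distrib sum_subtractf)
  qed
  obtain K where K: "K > 0"
    "\<And>x. (\<And>k. k < t \<Longrightarrow> x (r k) = 0) \<Longrightarrow> (\<Sum>u<n. (x u)\<^sup>2) \<le> K * (\<Sum>u<n. x u * lap x u)"
    using poincare by blast
  have inj: "\<forall>u<n. x u = 0" if "\<And>u. u < n \<Longrightarrow> (\<Sum>w<n. B u w * x w) = 0" for x
  proof -
    from that have z: "u < n \<Longrightarrow> (if nonroot u then lap x u else x u) = 0" for u using B by metis
    have "x (r k) = 0" if "k < t" for k
      using z[of "r k"] root_less[OF that] that by (auto simp: nonroot_def split: if_splits)
    then have "(\<Sum>u<n. (x u)\<^sup>2) \<le> K * (\<Sum>u<n. x u * lap x u)" by (rule K(2))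
    also have "(\<Sum>u<n. x u * lap x u) = 0"
    proof (intro sum.neutral ballI)
      fix u assume "u \<in> {..<n}"
      then show "x u * lap x u = 0" using z[of u] by (cases "nonroot u") auto
    qed
    finally have "(\<Sum>u<n. (x u)\<^sup>2) = 0" using sum_nonneg[of "{..<n}" "\<lambda>u. (x u)\<^sup>2"] by simp
    then show ?thesis by (simp add: sum_nonneg_eq_0_iff)
  qed
  obtain G where G: "\<And>u v. u < n \<Longrightarrow> v < n \<Longrightarrow> (\<Sum>w<n. B u w * G w v) = (if u = v then 1 else 0)"
    using right_inverse_of_injective[OF inj] by blast
  have "green G" unfolding green_def
  proof (intro allI impI)
    fix y u assume u: "u < n"
    have "(if nonroot u then lap (\<lambda>w. \<Sum>v<n. G w v * y v) u else (\<Sum>v<n. G u v * y v))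
        = (\<Sum>w<n. B u w * (\<Sum>v<n. G w v * y v))" using B[OF u] by simp
    also have "\<dots> = (\<Sum>w<n. \<Sum>v<n. B u w * G w v * y v)" by (simp add: sum_distrib_left mult.assoc)
    also have "\<dots> = (\<Sum>v<n. (\<Sum>w<n. B u w * G w v) * y v)" by (subst sum.swap) (simp add: sum_distrib_right)
    also have "\<dots> = (\<Sum>v<n. if u = v then y v else 0)" using G u by (intro sum.cong) auto
    also have "\<dots> = y u" using u by simp
    finally show "(if nonroot u then lap (\<lambda>w. \<Sum>v<n. G w v * y v) u else (\<Sum>v<n. G u v * y v)) = y u" .
  qed
  then show ?thesis by blast
qed

text \<open>Edges between branch sets \<open>i < j\<close> carry a common unknown weight \<open>p i j\<close>.\<close>

definition cross :: "(nat \<Rightarrow> nat \<Rightarrow> real) \<Rightarrow> nat \<Rightarrow> nat \<Rightarrow> real" where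
  "cross p u w = (if A u w \<and> intra u w = 0
     then if b u < t \<and> b w < t then p (min (b u) (b w)) (max (b u) (b w)) else 1 else 0)"

section \<open>Solving for the weights between branch sets\<close>

definition cross_count :: "nat \<Rightarrow> nat \<Rightarrow> real" where
  "cross_count i j = (\<Sum>u<n. \<Sum>w<n. if A u w \<and> b u = i \<and> b w = j then 1 else 0)"

lemma cross_sym: "cross p u w = cross p w u"
  unfolding cross_def A_commute[of w u] intra_sym[of w u] min.commute[of "b w"] max.commute[of "b w"]
  by (simp add: conj_commute)

lemma cross_count_ge:
  assumes "i < j" "j < t"
  shows "cross_count i j \<ge> 1"
proof -
  obtain u w where uw: "u < n" "w < n" "A u w" "b u = i" "b w = j" using branch_adjacent[OF assms] by blast
  have "1 \<le> (\<Sum>w<n. if A u w \<and> b u = i \<and> b w = j then 1 else 0 :: real)"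
    using member_le_sum[of w "{..<n}" "\<lambda>w. if A u w \<and> b u = i \<and> b w = j then 1 else 0 :: real"] uw by simp
  also have "\<dots> \<le> cross_count i j" unfolding cross_count_def
    using member_le_sum[of u "{..<n}" "\<lambda>u. \<Sum>w<n. if A u w \<and> b u = i \<and> b w = j then 1 else 0 :: real"] uw
    by (simp add: sum_nonneg)
  finally show ?thesis .
qed

lemma cross_count_le: "cross_count i j \<le> real n * real n"
proof -
  have "cross_count i j \<le> (\<Sum>u<n. \<Sum>w<n. 1)" unfolding cross_count_def by (intro sum_mono) auto
  then show ?thesis by simp
qed

lemma lap_indicator:
  assumes "j < t"
  shows "lap (\<lambda>w. of_bool (b w = j)) u = 0"
proof (cases "b u < t")
  case True
  then show ?thesis unfolding lap_branch[OF True] by (intro sum.neutral) (auto simp: intra_def)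
next
  case False
  then show ?thesis using lap_outside[of u] assms by simp
qed

lemma nonroot_root: "k < t \<Longrightarrow> \<not> nonroot (r k)"
  by (auto simp: nonroot_def)

text \<open>With \<open>\<epsilon> = e\<^sup>2\<close>, column \<open>j\<close> of \<open>E\<close>
  extends the unit vector of root \<open>j\<close> so that its image under the matrix vanishes off
  the roots. The last equation, summed over a branch set, makes the entry for \<open>i < j\<close>
  of the eliminated matrix equal to \<open>- \<epsilon>\<close>; diagonal entries are corrected
  later through the diagonal of the matrix.\<close>

definition solution :: "real \<Rightarrow> real \<Rightarrow> (nat \<Rightarrow> nat \<Rightarrow> real) \<Rightarrow> (nat \<Rightarrow> nat \<Rightarrow> real) \<Rightarrow> bool" where
  "solution c e p E \<longleftrightarrow>
      (\<forall>i j. i < j \<longrightarrow> j < t \<longrightarrow> \<bar>p i j - 1 / cross_count i j\<bar> \<le> c * e) \<and>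
      (\<forall>u<n. \<forall>j<t. \<bar>E u j - of_bool (b u = j)\<bar> \<le> c * e\<^sup>2) \<and>
      (\<forall>k<t. \<forall>j<t. E (r k) j = of_bool (k = j)) \<and>
      (\<forall>u<n. nonroot u \<longrightarrow> (\<forall>j<t. lap (\<lambda>w. E w j) u = e\<^sup>2 * (\<Sum>w<n. cross p u w * E w j))) \<and>
      (\<forall>i j. i < j \<longrightarrow> j < t \<longrightarrow> (\<Sum>u<n. if b u = i then \<Sum>w<n. cross p u w * E w j else 0) = 1)"

text \<open>Put \<open>E u j = of_bool (b u = j) + e * Y u j\<close>. The indicator is annihilated
  by \<open>lap\<close>, so the equations become \<open>Y = e G(...)\<close> and
  \<open>p = 1 / cross_count + e (...)\<close>, a system to which
  \<open>perturbed_fixed_point\<close> applies.\<close>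

lemma exists_solution:
  "\<exists>c>0. \<exists>e0>0. \<forall>e. 0 < e \<longrightarrow> e \<le> e0 \<longrightarrow> (\<exists>p E. solution c e p E)"
proof -
  obtain G where "green G" using exists_green by blast
  then have G: "(if nonroot u then lap (\<lambda>w. \<Sum>v<n. G w v * y v) u else (\<Sum>v<n. G u v * y v)) = y u"
    if "u < n" for y u
    using that unfolding green_def by (elim allE impE)
  \<comment> \<open>The left summand indexes the weights \<open>p i j\<close>, the right one the
    corrections \<open>Y u j\<close>.\<close>
  define I :: "(nat \<times> nat + nat \<times> nat) set" where
    "I = Inl ` {(i, j). i < j \<and> j < t} \<union> Inr ` ({..<n} \<times> {..<t})"
  have "{(i, j). i < j \<and> j < t} \<subseteq> {..<t} \<times> {..<t}" by auto
  then have "finite {(i, j). i < j \<and> j < t}" by (rule finite_subset) simp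
  then have I: "finite I" unfolding I_def by simp
  define x0 :: "nat \<times> nat + nat \<times> nat \<Rightarrow> real" where
    "x0 = case_sum (\<lambda>(i, j). 1 / cross_count i j) (\<lambda>_. 0)"
  define cr where "cr x = cross (\<lambda>i j. x (Inl (i, j)))" for x :: "nat \<times> nat + nat \<times> nat \<Rightarrow> real"
  \<comment> \<open>\<open>F1\<close> compensates the contribution of \<open>Y\<close> to the last
    equation of \<open>solution\<close>; \<open>F2\<close> is the Green matrix applied to the cross
    terms, set to zero at the roots.\<close>
  define F1 where "F1 i j e x = - (\<Sum>u<n. \<Sum>w<n. if b u = i then cr x u w * x (Inr (w, j)) else 0) * (1 / cross_count i j)"
    for i j and e :: real and x
  define F2 where "F2 u j e x = (\<Sum>v<n. G u v * (if nonroot v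
      then \<Sum>w<n. cr x v w * (of_bool (b w = j) + e * x (Inr (w, j))) else 0))"
    for u j and e :: real and x
  define F where "F = case_sum (\<lambda>(i, j). F1 i j) (\<lambda>(u, j). F2 u j)"
  have tame_cr: "tame I x0 (\<lambda>e x. cr x u w)" if "u < n" "w < n" for u w
  proof (cases "A u w \<and> intra u w = 0 \<and> b u < t \<and> b w < t")
    case True
    then have "min (b u) (b w) < max (b u) (b w)" "max (b u) (b w) < t" by (auto simp: intra_def split: if_splits)
    then have "Inl (min (b u) (b w), max (b u) (b w)) \<in> I" unfolding I_def by (intro UnI1 imageI) simp
    from tame_coord[OF I this] show ?thesis using True by (simp add: cr_def cross_def)
  next
    case False
    have "(\<lambda>(e::real) x. cr x u w) = (\<lambda>e x. if A u w \<and> intra u w = 0 then 1 else 0)"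
      using False by (auto simp: cr_def cross_def fun_eq_iff)
    then show ?thesis by (simp add: tame_const)
  qed
  have tame_Y: "tame I x0 (\<lambda>e x. x (Inr (w, j)))" if "w < n" "j < t" for w j
    by (rule tame_coord[OF I]) (use that in \<open>auto simp: I_def\<close>)
  have tame_F1: "tame I x0 (F1 i j)" if "j < t" for i j
  proof -
    have "tame I x0 (\<lambda>e x. if b u = i then cr x u w * x (Inr (w, j)) else 0)" if "u < n" "w < n" for u w
      using tame_mult[OF tame_cr tame_Y] that \<open>j < t\<close> by (cases "b u = i") (auto intro: tame_const)
    then show ?thesis unfolding F1_def by (intro tame_mult tame_uminus tame_sum tame_const) auto
  qed
  have tame_F2: "tame I x0 (F2 u j)" if "j < t" for u j
  proof -
    have "tame I x0 (\<lambda>e x. if nonroot v then \<Sum>w<n. cr x v w * (of_bool (b w = j) + e * x (Inr (w, j))) else 0)"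
      if "v < n" for v
    proof (cases "nonroot v")
      case True
      have "tame I x0 (\<lambda>e x. \<Sum>w<n. cr x v w * (of_bool (b w = j) + e * x (Inr (w, j))))"
        using that \<open>j < t\<close> by (intro tame_sum tame_mult tame_add tame_const tame_param tame_cr tame_Y) auto
      then show ?thesis using True by simp
    qed (simp add: tame_const)
    then show ?thesis unfolding F2_def by (intro tame_sum tame_mult tame_const) auto
  qed
  have tame_F: "tame I x0 (F k)" if "k \<in> I" for k
    using that tame_F1 tame_F2 by (auto simp: I_def F_def)
  obtain c e0 where c: "c > 0" "e0 > 0"
    and sol: "\<And>e. 0 < e \<Longrightarrow> e \<le> e0 \<Longrightarrow> \<exists>x. \<forall>k\<in>I. x k = x0 k + e * F k e x \<and> \<bar>x k - x0 k\<bar> \<le> c * e"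
    by (rule perturbed_fixed_point[of I x0 F, OF I tame_F], assumption, rule that)
  have "\<exists>p E. solution c e p E" if e: "0 < e" "e \<le> e0" for e
  proof -
    obtain x where x: "\<And>k. k \<in> I \<Longrightarrow> x k = x0 k + e * F k e x" "\<And>k. k \<in> I \<Longrightarrow> \<bar>x k - x0 k\<bar> \<le> c * e"
      using sol[OF e] by blast
    define p where "p = (\<lambda>i j. x (Inl (i, j)))"
    define Y where "Y u j = x (Inr (u, j))" for u j
    define E where "E u j = of_bool (b u = j) + e * Y u j" for u j
    define y where "y j v = (if nonroot v then \<Sum>w<n. cross p v w * E w j else 0)" for j v
    have cr: "cr x = cross p" by (simp add: cr_def p_def)
    have p: "p i j = 1 / cross_count i j + e * F1 i j e x" "\<bar>p i j - 1 / cross_count i j\<bar> \<le> c * e"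
      if "i < j" "j < t" for i j
      using x[of "Inl (i, j)"] that by (auto simp: I_def p_def x0_def F_def)
    have Y: "Y u j = e * (\<Sum>v<n. G u v * y j v)" "\<bar>Y u j\<bar> \<le> c * e" if "u < n" "j < t" for u j
    proof -
      have "F2 u j e x = (\<Sum>v<n. G u v * y j v)"
        unfolding F2_def y_def E_def Y_def cr by (rule refl)
      moreover have "Inr (u, j) \<in> I" using that by (simp add: I_def)
      ultimately show "Y u j = e * (\<Sum>v<n. G u v * y j v)" "\<bar>Y u j\<bar> \<le> c * e"
        using x[of "Inr (u, j)"] by (simp_all add: x0_def F_def Y_def)
    qed
    \<comment> \<open>The right-hand side \<open>y j\<close> is zero at the roots, and there the
      Green matrix reproduces it.\<close>
    have Y_root: "Y (r k) j = 0" if "k < t" "j < t" for k j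
      using G[OF root_less, of k "y j"] Y[OF root_less, of k j] that nonroot_root[of k] by (simp add: y_def)
    have lapY: "lap (\<lambda>w. Y w j) u = e * y j u" if "u < n" "j < t" "nonroot u" for u j
    proof -
      have "lap (\<lambda>w. Y w j) u = lap (\<lambda>w. 0 + e * (\<Sum>v<n. G w v * y j v)) u"
        using Y that by (auto simp: lap_def intro!: sum.cong)
      also have "\<dots> = e * y j u"
        unfolding lap_add_scale using G[of u "y j"] that by (simp add: lap_def)
      finally show ?thesis .
    qed
    have "solution c e p E"
      unfolding solution_def
    proof (intro conjI allI impI)
      fix i j assume "i < j" "j < t" then show "\<bar>p i j - 1 / cross_count i j\<bar> \<le> c * e" by (rule p(2))
    next
      fix u j assume "u < n" "j < t"
      from Y(2)[OF this] have "e * \<bar>Y u j\<bar> \<le> e * (c * e)" using e by (intro mult_left_mono) auto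
      then show "\<bar>E u j - of_bool (b u = j)\<bar> \<le> c * e\<^sup>2"
        using e by (simp add: E_def abs_mult power2_eq_square algebra_simps)
    next
      fix k j assume "k < t" "j < t"
      then show "E (r k) j = of_bool (k = j)" using Y_root label_root by (simp add: E_def)
    next
      fix u j assume u: "u < n" "nonroot u" "j < t"
      have "lap (\<lambda>w. E w j) u = e * (e * y j u)"
        unfolding E_def lap_add_scale lap_indicator[OF u(3)] lapY[OF u(1,3,2)] by simp
      then show "lap (\<lambda>w. E w j) u = e\<^sup>2 * (\<Sum>w<n. cross p u w * E w j)"
        using u by (simp add: y_def power2_eq_square)
    next
      fix i j assume ij: "i < j" "j < t"
      let ?S = "\<Sum>u<n. \<Sum>w<n. if b u = i then cross p u w * Y w j else 0"
      have cc: "cross_count i j \<noteq> 0" using cross_count_ge[OF ij] by auto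
      have "cross p u w * of_bool (b w = j) = p i j * (if A u w \<and> b u = i \<and> b w = j then 1 else 0)"
        if "b u = i" for u w
        using ij that by (auto simp: cross_def intra_def)
      then have "(if b u = i then \<Sum>w<n. cross p u w * E w j else 0) =
          (\<Sum>w<n. p i j * (if A u w \<and> b u = i \<and> b w = j then 1 else 0)) +
          (\<Sum>w<n. e * (if b u = i then cross p u w * Y w j else 0))" for u
        unfolding sum.distrib[symmetric] E_def distrib_left
        by (cases "b u = i") (simp_all add: mult.left_commute[of e])
      then have "(\<Sum>u<n. if b u = i then \<Sum>w<n. cross p u w * E w j else 0) =
          p i j * cross_count i j + e * ?S"
        by (simp add: sum.distrib sum_distrib_left cross_count_def)
      also have "p i j * cross_count i j = 1 - e * ?S"
        unfolding p(1)[OF ij] F1_def cr Y_def using cc by (simp add: field_simps)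
      finally show "(\<Sum>u<n. if b u = i then \<Sum>w<n. cross p u w * E w j else 0) = 1" by simp
    qed
    then show ?thesis by blast
  qed
  then show ?thesis using c by blast
qed

text \<open>Block elimination in disguise: the matrix is positive definite on the vectors that
  vanish at the roots, and the equation for \<open>M\<close> times \<open>E\<close> says that the
  Schur complement on the roots is \<open>- eps\<close> times the all-ones matrix. Closeness of
  \<open>E\<close> to the indicators is kept for the Strong Arnold Property.\<close>

definition model_matrix :: "real \<Rightarrow> real \<Rightarrow> (nat \<Rightarrow> nat \<Rightarrow> real) \<Rightarrow> (nat \<Rightarrow> nat \<Rightarrow> real) \<Rightarrow> bool" where
  "model_matrix d eps M E \<longleftrightarrow>
     (\<forall>u w. M u w = M w u) \<and>
     (\<forall>u<n. \<forall>w<n. u \<noteq> w \<longrightarrow> (if A u w then M u w < 0 else M u w = 0)) \<and>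
     (\<forall>k<t. \<forall>j<t. E (r k) j = of_bool (k = j)) \<and>
     (\<forall>u<n. \<forall>j<t. (\<Sum>w<n. M u w * E w j) = (if nonroot u then 0 else - eps)) \<and>
     (\<forall>x. (\<forall>k<t. x (r k) = 0) \<longrightarrow> (\<exists>u<n. x u \<noteq> 0) \<longrightarrow> (\<Sum>u<n. x u * (\<Sum>w<n. M u w * x w)) > 0) \<and>
     (\<forall>u<n. \<forall>j<t. \<bar>E u j - of_bool (b u = j)\<bar> \<le> d)"

lemma root_eqI: "k < t \<Longrightarrow> \<not> nonroot u \<Longrightarrow> b u = k \<Longrightarrow> u = r k"
  using label_root by (auto simp: nonroot_def)

text \<open>Off the roots the rows of \<open>M\<close> are \<open>lap\<close> minus
  \<open>eps\<close> times the cross weights, so positive definiteness is \<open>poincare\<close> up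
  to a small error. The rows at the roots are determined by summing over a branch set.\<close>

lemma exists_model_matrix:
  fixes d :: real
  assumes d: "d > 0"
  shows "\<exists>eps>0. \<exists>M E. model_matrix d eps M E"
proof -
  obtain c e0 where c: "c > 0" and e0: "e0 > 0"
    and sol: "\<And>e. 0 < e \<Longrightarrow> e \<le> e0 \<Longrightarrow> \<exists>p E. solution c e p E"
    using exists_solution by blast
  obtain K where K: "K > 0"
    "\<And>x. (\<And>k. k < t \<Longrightarrow> x (r k) = 0) \<Longrightarrow> (\<Sum>u<n. (x u)\<^sup>2) \<le> K * (\<Sum>u<n. x u * lap x u)"
    using poincare by blast
  define m where "m = real n"
  have m: "m \<ge> 0" by (simp add: m_def)
  \<comment> \<open>Exceeds all cross weights: they are 1 or at most \<open>1 + c\<close>.\<close>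
  define B where "B = 2 + c"
  have B: "B > 0" using c by (simp add: B_def)
  \<comment> \<open>In this order the bounds on \<open>e\<close> serve the existence of the
    solution, \<open>e\<^sup>2 \<le> e\<close>, closeness of \<open>E\<close> to the indicators,
    positivity of the weights, and positive definiteness.\<close>
  define S where "S = {e0, 1, d / c, 1 / (2 * c * (m * m + 1)), 1 / (2 * B * (m + 1) * K)}"
  define e where "e = Min S"
  have e_pos: "e > 0"
    using c d e0 m B K(1) unfolding e_def S_def by (simp add: add_nonneg_pos)
  have "e \<le> s" if "s \<in> S" for s unfolding e_def using that by (intro Min_le) (auto simp: S_def)
  then have e_le: "e \<le> e0" "e \<le> 1" "e \<le> d / c" "e \<le> 1 / (2 * c * (m * m + 1))" "e \<le> 1 / (2 * B * (m + 1) * K)"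
    by (auto simp: S_def)
  have ee: "e\<^sup>2 \<le> e" using e_pos e_le(2) by (simp add: power2_eq_square mult_left_le)
  have ce: "c * e \<le> d" using e_le(3) c by (simp add: field_simps)
  have "0 < 2 * c * (m * m + 1)" using c m by (intro mult_pos_pos add_nonneg_pos) auto
  with e_le(4) have "e * (2 * c * (m * m + 1)) \<le> 1" by (simp only: pos_le_divide_eq)
  then have ce_small: "2 * (c * e) * (m * m + 1) \<le> 1" by (simp only: mult_ac)
  have "0 < 2 * B * (m + 1) * K" using B K(1) m by (intro mult_pos_pos add_nonneg_pos) auto
  with e_le(5) have e_B: "e * (2 * B * (m + 1) * K) \<le> 1" by (simp only: pos_le_divide_eq)
  obtain p E where pE: "solution c e p E"
    using sol[OF e_pos e_le(1)] by blast
  have p: "\<bar>p i j - 1 / cross_count i j\<bar> \<le> c * e" if "i < j" "j < t" for i j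
    using pE that by (simp add: solution_def)
  have E: "\<bar>E u j - of_bool (b u = j)\<bar> \<le> c * e\<^sup>2" if "u < n" "j < t" for u j
    using pE that by (simp add: solution_def)
  have E_root: "E (r k) j = of_bool (k = j)" if "k < t" "j < t" for k j
    using pE that by (simp add: solution_def)
  have E_lap: "lap (\<lambda>w. E w j) u = e\<^sup>2 * (\<Sum>w<n. cross p u w * E w j)"
    if "u < n" "nonroot u" "j < t" for u j
    using pE that by (simp add: solution_def)
  have E_sum: "(\<Sum>u<n. if b u = i then \<Sum>w<n. cross p u w * E w j else 0) = 1" if "i < j" "j < t" for i j
    using pE that by (simp add: solution_def)
  have p_bounds: "0 < p i j" "p i j \<le> B" if ij: "i < j" "j < t" for i j
  proof -
    have cc: "1 \<le> cross_count i j" "cross_count i j \<le> m * m"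
      using cross_count_ge[OF ij] cross_count_le by (auto simp: m_def)
    have "c * e * cross_count i j \<le> c * e * (m * m + 1)" using cc c e_pos by (intro mult_left_mono) auto
    then have "c * e * cross_count i j < 1" using ce_small by linarith
    then have "c * e < 1 / cross_count i j" using cc by (simp add: field_simps)
    then show "0 < p i j" using p[OF ij] by linarith
    have "1 / cross_count i j \<le> 1" using cc by simp
    moreover have "c * e \<le> c" using e_le(2) c by simp
    ultimately show "p i j \<le> B" using p[OF ij] unfolding B_def by linarith
  qed
  have cross_pos: "cross p u w > 0" if "A u w" "intra u w = 0" for u w
    using that p_bounds(1)[of "min (b u) (b w)" "max (b u) (b w)"] unfolding cross_def
    by (auto simp: intra_def split: if_splits)
  have cross_abs: "\<bar>cross p u w\<bar> \<le> B" for u w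
  proof (cases "A u w \<and> intra u w = 0")
    case True
    then have "cross p u w \<le> B"
      using p_bounds(2)[of "min (b u) (b w)" "max (b u) (b w)"] c unfolding cross_def B_def
      by (auto simp: intra_def split: if_splits)
    then show ?thesis using cross_pos[of u w] True by simp
  next
    case False
    then show ?thesis using B by (auto simp: cross_def)
  qed
  define eps where "eps = e\<^sup>2"
  have eps: "eps > 0" using e_pos by (simp add: eps_def)
  \<comment> \<open>At a root the diagonal entry is solved from the requirement that its row times
    its own column of \<open>E\<close> be \<open>- eps\<close>.\<close>
  define D where "D u = (if nonroot u then dg u
      else (\<Sum>w<n. (intra u w + eps * cross p u w) * E w (b u)) - eps)" for u
  define M where "M u w = (if u = w then D u else 0) - intra u w - eps * cross p u w" for u w
  have M_sym: "M u w = M w u" for u w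
    by (simp add: M_def intra_sym[of u] cross_sym[of _ u])
  have Mx: "(\<Sum>w<n. M u w * x w) = D u * x u - (\<Sum>w<n. intra u w * x w) - eps * (\<Sum>w<n. cross p u w * x w)"
    if "u < n" for u x
  proof -
    have "(\<Sum>w<n. M u w * x w) = (\<Sum>w<n. (if u = w then D u * x w else 0) - intra u w * x w - eps * (cross p u w * x w))"
      by (intro sum.cong refl) (simp add: M_def algebra_simps)
    then show ?thesis using that by (simp add: sum_subtractf sum_distrib_left)
  qed
  have Mx_lap: "(\<Sum>w<n. M u w * x w) = lap x u - eps * (\<Sum>w<n. cross p u w * x w)"
    if "u < n" "nonroot u \<or> x u = 0" for u x
    using that by (auto simp: Mx lap_def D_def)
  define R where "R u j = (\<Sum>w<n. M u w * E w j)" for u j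
  have R_nonroot: "R u j = 0" if "u < n" "nonroot u" "j < t" for u j
    using that unfolding R_def by (simp add: Mx_lap E_lap eps_def)
  have R_diag: "R (r k) k = - eps" if k: "k < t" for k
    unfolding R_def Mx[OF root_less[OF k]] D_def
    using k by (simp add: nonroot_root label_root E_root distrib_right sum.distrib sum_distrib_left mult.assoc)
  \<comment> \<open>No edge counted by \<open>intra\<close> leaves a branch set, so the differences
    cancel in pairs.\<close>
  have lap_sum: "(\<Sum>u<n. if b u = i then lap x u else 0) = 0" if "i < t" for i x
  proof -
    let ?S = "\<Sum>u<n. \<Sum>w<n. if b u = i then intra u w * (x u - x w) else 0"
    let ?T = "\<Sum>u<n. \<Sum>w<n. if b w = i then intra w u * (x w - x u) else 0"
    have "(if b u = i then lap x u else 0) = (\<Sum>w<n. if b u = i then intra u w * (x u - x w) else 0)" for u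
      using that by (cases "b u = i") (simp_all add: lap_branch)
    then have "(\<Sum>u<n. if b u = i then lap x u else 0) = ?S" by simp
    moreover have "?S = ?T" by (rule sum.swap)
    moreover have "?S + ?T = 0" unfolding sum.distrib[symmetric]
      by (intro sum.neutral ballI) (auto simp: intra_def A_commute algebra_simps)
    ultimately show ?thesis by linarith
  qed
  \<comment> \<open>In the sum over branch set \<open>i\<close> only the row of the root survives.
    Its special diagonal entry does not enter, being multiplied by \<open>E (r i) j = 0\<close>; the
    Laplacian part sums to zero and the cross part to 1.\<close>
  have R_upper: "R (r i) j = - eps" if ij: "i < j" "j < t" for i j
  proof -
    have i: "i < t" using ij by simp
    have "(\<Sum>u<n. if b u = i then R u j else 0) = (\<Sum>u<n. if u = r i then R u j else 0)"
      using R_nonroot ij label_root[OF i] root_eqI[OF i] by (intro sum.cong refl) auto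
    also have "\<dots> = R (r i) j" using root_less[OF i] by simp
    finally have "R (r i) j = (\<Sum>u<n. if b u = i then R u j else 0)" by simp
    also have "\<dots> = (\<Sum>u<n. (if b u = i then lap (\<lambda>w. E w j) u else 0)
        - eps * (if b u = i then \<Sum>w<n. cross p u w * E w j else 0))"
    proof (intro sum.cong refl)
      fix u assume u: "u \<in> {..<n}"
      have "nonroot u \<or> E u j = 0" if "b u = i"
        using root_eqI[OF i _ that] E_root[OF i ij(2)] ij by auto
      then show "(if b u = i then R u j else 0) = (if b u = i then lap (\<lambda>w. E w j) u else 0)
        - eps * (if b u = i then \<Sum>w<n. cross p u w * E w j else 0)"
        using u unfolding R_def by (simp add: Mx_lap)
    qed
    also have "\<dots> = - eps"
      unfolding sum_subtractf sum_distrib_left[symmetric] lap_sum[OF i] E_sum[OF ij] by simp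
    finally show ?thesis .
  qed
  have R_form: "(\<Sum>u<n. E u i * R u j) = R (r i) j" if ij: "i < t" "j < t" for i j
  proof -
    have "(\<Sum>u<n. E u i * R u j) = (\<Sum>u<n. if u = r i then R u j else 0)"
    proof (intro sum.cong refl)
      fix u assume "u \<in> {..<n}"
      then show "E u i * R u j = (if u = r i then R u j else 0)"
        using ij R_nonroot[of u j] E_root by (cases "nonroot u") (auto simp: nonroot_def)
    qed
    then show ?thesis using root_less[OF ij(1)] by simp
  qed
  \<comment> \<open>The equations were imposed for \<open>i < j\<close> only; the other half follows
    because \<open>R\<close> at the roots is the symmetric matrix with entries
    \<open>E\<^sup>T M E\<close>.\<close>
  have R_sym: "R (r i) j = R (r j) i" if ij: "i < t" "j < t" for i j
  proof -
    have "R (r i) j = (\<Sum>u<n. E u i * R u j)" using R_form[OF ij] by simp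
    also have "\<dots> = (\<Sum>u<n. \<Sum>w<n. E u i * M u w * E w j)"
      unfolding R_def by (simp add: sum_distrib_left mult.assoc)
    also have "\<dots> = (\<Sum>w<n. \<Sum>u<n. E u i * M u w * E w j)" by (rule sum.swap)
    also have "\<dots> = (\<Sum>w<n. \<Sum>u<n. E w j * (M w u * E u i))"
    proof (intro sum.cong refl)
      fix u w show "E u i * M u w * E w j = E w j * (M w u * E u i)"
        using M_sym[of u w] by simp
    qed
    also have "\<dots> = (\<Sum>w<n. E w j * R w i)"
      unfolding R_def by (simp add: sum_distrib_left)
    also have "\<dots> = R (r j) i" by (rule R_form[OF ij(2,1)])
    finally show ?thesis .
  qed
  have R_root: "R (r i) j = - eps" if "i < t" "j < t" for i j
    using R_upper R_diag R_sym that by (metis linorder_neqE_nat)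
  have pd: "(\<Sum>u<n. x u * (\<Sum>w<n. M u w * x w)) > 0"
    if x: "\<forall>k<t. x (r k) = 0" and nz: "\<exists>u<n. x u \<noteq> 0" for x
  proof -
    define X where "X = (\<Sum>u<n. (x u)\<^sup>2)"
    obtain u0 where u0: "u0 < n" "x u0 \<noteq> 0" using nz by blast
    have X: "X > 0" unfolding X_def by (rule sum_pos2[of _ u0]) (use u0 in auto)
    define C where "C = (\<Sum>u<n. \<Sum>w<n. cross p u w * (x u * x w))"
    have "x u * (\<Sum>w<n. M u w * x w) = x u * lap x u - eps * (\<Sum>w<n. cross p u w * (x u * x w))"
      if "u < n" for u
    proof -
      have "nonroot u \<or> x u = 0" using x by (auto simp: nonroot_def)
      then have "(\<Sum>w<n. M u w * x w) = lap x u - eps * (\<Sum>w<n. cross p u w * x w)"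
        using that by (rule Mx_lap[rotated])
      then show ?thesis by (simp add: right_diff_distrib sum_distrib_left mult_ac)
    qed
    then have q: "(\<Sum>u<n. x u * (\<Sum>w<n. M u w * x w)) = (\<Sum>u<n. x u * lap x u) - eps * C"
      by (simp add: sum_subtractf sum_distrib_left C_def)
    have "\<bar>C\<bar> \<le> (\<Sum>u<n. \<Sum>w<n. B * (((x u)\<^sup>2 + (x w)\<^sup>2) / 2))"
      unfolding C_def
    proof (intro order_trans[OF sum_abs] sum_mono order_trans[OF sum_abs])
      fix u w
      have "0 \<le> (\<bar>x u\<bar> - \<bar>x w\<bar>)\<^sup>2" by simp
      then have "\<bar>x u * x w\<bar> \<le> ((x u)\<^sup>2 + (x w)\<^sup>2) / 2"
        by (simp add: power2_diff abs_mult)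
      then show "\<bar>cross p u w * (x u * x w)\<bar> \<le> B * (((x u)\<^sup>2 + (x w)\<^sup>2) / 2)"
        unfolding abs_mult[of "cross p u w"] using cross_abs B by (intro mult_mono) auto
    qed
    also have "\<dots> = B * m * X"
      by (simp add: sum_distrib_left[symmetric] sum_divide_distrib[symmetric] sum.distrib X_def m_def)
    finally have C: "\<bar>C\<bar> \<le> B * m * X" .
    have "eps * C \<le> eps * (B * m * X)" using C eps by (intro mult_left_mono) auto
    also have "\<dots> \<le> e * (B * m * X)"
      using ee B m X unfolding eps_def by (intro mult_right_mono) auto
    \<comment> \<open>The factor 2 ensures that the cross terms consume at most half of the
      energy.\<close>
    finally have "2 * K * (eps * C) \<le> 2 * K * (e * (B * m * X))" using K(1) by (intro mult_left_mono) auto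
    also have "\<dots> \<le> e * (2 * B * (m + 1) * K) * X"
      using e_pos B K(1) X by (simp add: algebra_simps)
    also have "\<dots> \<le> 1 * X" using e_B X by (intro mult_right_mono) auto
    finally have "2 * K * (eps * C) \<le> X" by simp
    moreover have "X \<le> K * (\<Sum>u<n. x u * lap x u)" unfolding X_def by (rule K(2)) (use x in auto)
    ultimately have "0 < 2 * K * ((\<Sum>u<n. x u * lap x u) - eps * C)"
      using X by (simp add: algebra_simps)
    then show ?thesis unfolding q using K(1) by (simp add: zero_less_mult_iff)
  qed
  have "model_matrix d eps M E"
    unfolding model_matrix_def
  proof (intro conjI allI impI)
    show "M u w = M w u" for u w by (rule M_sym)
    show "if A u w then M u w < 0 else M u w = 0" if "u \<noteq> w" for u w
    proof (cases "A u w")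
      case True
      then show ?thesis
        using that cross_pos[OF True] eps by (cases "intra u w = 0") (auto simp: M_def intra_def cross_def split: if_splits)
    next
      case False
      then show ?thesis using that by (simp add: M_def intra_def cross_def)
    qed
    show "E (r k) j = of_bool (k = j)" if "k < t" "j < t" for k j using E_root that .
    show "(\<Sum>w<n. M u w * E w j) = (if nonroot u then 0 else - eps)" if "u < n" "j < t" for u j
      using R_nonroot[of u j] R_root that unfolding R_def[symmetric] by (auto simp: nonroot_def)
    show "\<bar>E u j - of_bool (b u = j)\<bar> \<le> d" if "u < n" "j < t" for u j
    proof -
      have "c * e\<^sup>2 \<le> c * e" using ee c by (intro mult_left_mono) auto
      then show ?thesis using E[OF that] ce by linarith
    qed
  qed (use pd in auto)
  then show ?thesis using eps by blast
qed

section \<open>Signature, corank and Strong Arnold Property of the matrix\<close>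

context
  fixes d eps :: real and M E :: "nat \<Rightarrow> nat \<Rightarrow> real"
  assumes mm: "model_matrix d eps M E" and eps: "eps > 0"
begin

lemma M_sym: "M u w = M w u"
  and E_root: "k < t \<Longrightarrow> j < t \<Longrightarrow> E (r k) j = of_bool (k = j)"
  and M_E: "u < n \<Longrightarrow> j < t \<Longrightarrow> (\<Sum>w<n. M u w * E w j) = (if nonroot u then 0 else - eps)"
  and M_pd: "\<forall>k<t. x (r k) = 0 \<Longrightarrow> \<exists>u<n. x u \<noteq> 0 \<Longrightarrow> (\<Sum>u<n. x u * (\<Sum>w<n. M u w * x w)) > 0"
  and E_near: "u < n \<Longrightarrow> j < t \<Longrightarrow> \<bar>E u j - of_bool (b u = j)\<bar> \<le> d"
  using mm unfolding model_matrix_def by blast+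

lemma M_psd:
  assumes "\<forall>k<t. x (r k) = 0"
  shows "(\<Sum>u<n. x u * (\<Sum>w<n. M u w * x w)) \<ge> 0"
proof (cases "\<exists>u<n. x u \<noteq> 0")
  case True
  then show ?thesis using M_pd[OF assms] by simp
next
  case False
  then show ?thesis by (intro sum_nonneg) auto
qed

lemma sum_roots: "(\<Sum>u<n. if nonroot u then 0 else x u) = (\<Sum>k<t. x (r k))"
proof -
  have inj: "inj_on r {..<t}" using label_root by (metis inj_onI lessThan_iff)
  have "(\<Sum>k<t. x (r k)) = (\<Sum>u\<in>r ` {..<t}. x u)" using sum.reindex[OF inj, of x] by simp
  also have "\<dots> = (\<Sum>u\<in>r ` {..<t}. if nonroot u then 0 else x u)"
    by (intro sum.cong refl) (auto simp: nonroot_def)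
  also have "\<dots> = (\<Sum>u<n. if nonroot u then 0 else x u)"
    by (rule sum.mono_neutral_left) (use root_less in \<open>auto simp: nonroot_def\<close>)
  finally show ?thesis by simp
qed

text \<open>The coordinates of block elimination: what is left of \<open>x\<close> after subtracting
  the extension of its root values.\<close>

definition reduced :: "(nat \<Rightarrow> real) \<Rightarrow> nat \<Rightarrow> real" where
  "reduced x u = x u - (\<Sum>j<t. E u j * x (r j))"

lemma reduced_root: "k < t \<Longrightarrow> reduced x (r k) = 0"
  by (simp add: reduced_def E_root)

lemma M_reduced:
  assumes "u < n"
  shows "(\<Sum>w<n. M u w * x w) =
    (\<Sum>w<n. M u w * reduced x w) - (if nonroot u then 0 else eps * (\<Sum>j<t. x (r j)))"
proof -
  have "(\<Sum>w<n. M u w * x w) = (\<Sum>w<n. M u w * reduced x w + (\<Sum>j<t. M u w * E w j * x (r j)))"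
    by (intro sum.cong refl) (simp add: reduced_def right_diff_distrib sum_distrib_left mult.assoc)
  also have "\<dots> = (\<Sum>w<n. M u w * reduced x w) + (\<Sum>j<t. \<Sum>w<n. M u w * E w j * x (r j))"
    unfolding sum.distrib by (subst sum.swap[of _ "{..<t}"]) (rule refl)
  also have "(\<Sum>j<t. \<Sum>w<n. M u w * E w j * x (r j)) = (\<Sum>j<t. (if nonroot u then 0 else - eps) * x (r j))"
    using M_E[OF assms] by (intro sum.cong refl) (simp add: sum_distrib_right[symmetric])
  also have "\<dots> = - (if nonroot u then 0 else eps * (\<Sum>j<t. x (r j)))"
    by (simp add: sum_distrib_left sum_negf)
  finally show ?thesis by simp
qed

text \<open>Completing the square. Subtracting the extension changes \<open>M x\<close> at the roots
  only, where \<open>reduced x\<close> is zero, so there are no mixed terms.\<close>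

lemma quadratic_reduced:
  "(\<Sum>u<n. x u * (\<Sum>w<n. M u w * x w)) =
     (\<Sum>u<n. reduced x u * (\<Sum>w<n. M u w * reduced x w)) - eps * (\<Sum>j<t. x (r j))\<^sup>2"
proof -
  let ?s = "\<Sum>j<t. x (r j)" and ?z = "reduced x"
  have "x u * (\<Sum>w<n. M u w * x w) =
      x u * (\<Sum>w<n. M u w * ?z w) - eps * ?s * (if nonroot u then 0 else x u)" if "u < n" for u
    unfolding M_reduced[OF that, of x] by (simp add: right_diff_distrib)
  then have "(\<Sum>u<n. x u * (\<Sum>w<n. M u w * x w)) =
      (\<Sum>u<n. x u * (\<Sum>w<n. M u w * ?z w)) - eps * ?s * (\<Sum>u<n. if nonroot u then 0 else x u)"
    by (simp add: sum_subtractf sum_distrib_left)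
  also have "(\<Sum>u<n. if nonroot u then 0 else x u) = ?s" by (rule sum_roots)
  also have "eps * ?s * ?s = eps * ?s\<^sup>2" by (simp add: power2_eq_square)
  also have "(\<Sum>u<n. x u * (\<Sum>w<n. M u w * ?z w)) = (\<Sum>w<n. (\<Sum>u<n. M w u * x u) * ?z w)"
    by (simp add: sum_distrib_left sum_distrib_right, subst sum.swap)
       (intro sum.cong refl, simp add: M_sym)
  also have "\<dots> = (\<Sum>w<n. ?z w * (\<Sum>u<n. M w u * ?z u))"
  proof (intro sum.cong refl)
    fix w assume "w \<in> {..<n}"
    then show "(\<Sum>u<n. M w u * x u) * ?z w = ?z w * (\<Sum>u<n. M w u * ?z u)"
      using M_reduced[of w x] reduced_root[of _ x] by (cases "nonroot w") (auto simp: nonroot_def)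
  qed
  finally show ?thesis .
qed

text \<open>For \<open>x\<close> in the kernel, the image of \<open>reduced x\<close> is supported
  on the roots, where \<open>reduced x\<close> vanishes; so its form is zero and positive
  definiteness gives \<open>reduced x = 0\<close>.\<close>

lemma kernel_reduced:
  assumes z: "\<And>u. u < n \<Longrightarrow> (\<Sum>w<n. M u w * x w) = 0" and u: "u < n"
  shows "x u = (\<Sum>j<t. E u j * x (r j))"
proof -
  have "reduced x u * (\<Sum>w<n. M u w * reduced x w) = 0" if "u < n" for u
    using M_reduced[OF that, of x] z[OF that] reduced_root[of _ x]
    by (cases "nonroot u") (auto simp: nonroot_def)
  then have "(\<Sum>u<n. reduced x u * (\<Sum>w<n. M u w * reduced x w)) = 0"
    by (intro sum.neutral) blast
  then have "\<forall>u<n. reduced x u = 0" using M_pd[of "reduced x"] reduced_root by fastforce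
  then show ?thesis using u by (simp add: reduced_def)
qed

definition MM :: "real mat" where "MM = mat n n (\<lambda>(u, w). M u w)"

lemma MM_carrier: "MM \<in> carrier_mat n n" "transpose_mat MM = MM"
  by (auto simp: MM_def M_sym[of _ "_ :: nat"] intro!: eq_matI)

lemma MM_mult_vec: "x \<in> carrier_vec n \<Longrightarrow> u < n \<Longrightarrow> (MM *\<^sub>v x) $ u = (\<Sum>w<n. M u w * x $ w)"
  by (simp add: MM_def scalar_prod_def atLeast0LessThan)

lemma MM_quadratic:
  assumes "x \<in> carrier_vec n"
  shows "x \<bullet> (MM *\<^sub>v x) = (\<Sum>u<n. x $ u * (\<Sum>w<n. M u w * x $ w))"
  using assms MM_carrier(1) by (auto simp: scalar_prod_def[of x] atLeast0LessThan MM_mult_vec simp del: index_mult_mat_vec)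

text \<open>By \<open>quadratic_reduced\<close> the form is nonnegative on the hyperplane where the
  root values sum to zero, and it is \<open>- eps\<close> at column 0 of \<open>E\<close>.\<close>

lemma MM_negative_eigenvalue:
  assumes "0 < t"
  shows "\<exists>!k. k < 0 \<and> eigenvalue MM k"
    and "k < 0 \<Longrightarrow> eigenvalue MM k \<Longrightarrow> Polynomial.order k (char_poly MM) = 1"
proof -
  define f where "f = vec n (\<lambda>u. if nonroot u then 0 else 1 :: real)"
  have f: "f \<in> carrier_vec n" by (simp add: f_def)
  have hyper: "x \<bullet> (MM *\<^sub>v x) \<ge> 0" if x: "x \<in> carrier_vec n" "f \<bullet> x = 0" for x
  proof -
    have "f \<bullet> x = (\<Sum>u<n. if nonroot u then 0 else x $ u)"
      using x(1) by (auto simp: f_def scalar_prod_def atLeast0LessThan intro!: sum.cong)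
    then have "(\<Sum>j<t. x $ r j) = 0" using x(2) sum_roots[of "\<lambda>u. x $ u"] by simp
    then show ?thesis
      using quadratic_reduced[of "\<lambda>u. x $ u"] M_psd[of "reduced (\<lambda>u. x $ u)"]
      by (simp add: MM_quadratic[OF x(1)] reduced_root)
  qed
  define x0 where "x0 = vec n (\<lambda>u. E u 0)"
  have x0: "x0 \<in> carrier_vec n" by (simp add: x0_def)
  have "(\<Sum>w<n. M u w * x0 $ w) = (if nonroot u then 0 else - eps)" if "u < n" for u
    using M_E[OF that assms] by (simp add: x0_def)
  then have "x0 \<bullet> (MM *\<^sub>v x0) = (\<Sum>u<n. - eps * (if nonroot u then 0 else x0 $ u))"
    unfolding MM_quadratic[OF x0] by (intro sum.cong refl) auto
  also have "\<dots> = - eps * (\<Sum>k<t. x0 $ r k)"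
    unfolding sum_distrib_left[symmetric] sum_roots by simp
  also have "(\<Sum>k<t. x0 $ r k) = 1"
    using assms root_less by (simp add: x0_def E_root)
  finally have "x0 \<bullet> (MM *\<^sub>v x0) < 0" using eps by simp
  note * = unique_negative_eigenvalue[OF MM_carrier f hyper x0 this]
  show "\<exists>!k. k < 0 \<and> eigenvalue MM k" by (rule *(1))
  show "k < 0 \<Longrightarrow> eigenvalue MM k \<Longrightarrow> Polynomial.order k (char_poly MM) = 1" by (rule *(2))
qed

text \<open>All columns of \<open>E\<close> have the same image under the matrix, so their
  differences lie in the kernel. At the roots other than \<open>r 0\<close> these differences form
  an identity matrix.\<close>

lemma MM_kernel_dim: "t - 1 \<le> kernel_dim MM"
proof (rule kernel_dim_ge[OF MM_carrier(1)])
  fix i assume i: "i < t - 1"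
  show "r (Suc i) < n" using root_less i by simp
  show "vec n (\<lambda>u. E u (Suc i) - E u 0) \<in> mat_kernel MM"
  proof (rule mat_kernelI[OF MM_carrier(1)])
    show "MM *\<^sub>v vec n (\<lambda>u. E u (Suc i) - E u 0) = 0\<^sub>v n"
    proof (rule eq_vecI)
      fix u assume "u < dim_vec (0\<^sub>v n :: real vec)"
      then have u: "u < n" by simp
      have "(MM *\<^sub>v vec n (\<lambda>u. E u (Suc i) - E u 0)) $ u = (\<Sum>w<n. M u w * E w (Suc i)) - (\<Sum>w<n. M u w * E w 0)"
        using u by (subst MM_mult_vec) (simp_all add: right_diff_distrib sum_subtractf)
      also have "\<dots> = 0" using M_E[OF u] i by simp
      finally show "(MM *\<^sub>v vec n (\<lambda>u. E u (Suc i) - E u 0)) $ u = 0\<^sub>v n $ u" using u by simp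
    qed (use MM_carrier in simp)
  qed simp
  fix j assume j: "j < t - 1"
  show "vec n (\<lambda>u. E u (Suc i) - E u 0) $ r (Suc j) = (if i = j then 1 else 0)"
    using i j root_less by (auto simp: E_root)
qed

text \<open>A matrix \<open>X\<close> annihilated by \<open>M\<close> is \<open>E Y E\<^sup>T\<close> where \<open>Y\<close> is its restriction to the roots, so its entry
  at an edge between branch sets \<open>i, j\<close> is close to \<open>Y i j\<close>.\<close>

lemma MM_strong_arnold:
  fixes X :: "real mat"
  assumes X: "X \<in> carrier_mat n n" "transpose_mat X = X" and MX: "MM * X = 0\<^sub>m n n"
    and zero: "\<And>u w. u < n \<Longrightarrow> w < n \<Longrightarrow> u = w \<or> A u w \<Longrightarrow> X $$ (u, w) = 0"
    and d: "0 \<le> d" "3 * d * real t * real t < 1" "d \<le> 1"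
  shows "X = 0\<^sub>m n n"
proof -
  have X_sym: "X $$ (u, w) = X $$ (w, u)" if "u < n" "w < n" for u w
    using X that by (metis carrier_matD index_transpose_mat(1))
  have ker: "X $$ (u, v) = (\<Sum>j<t. E u j * X $$ (r j, v))" if "u < n" "v < n" for u v
  proof (rule kernel_reduced[of "\<lambda>u. X $$ (u, v)"])
    fix u assume "u < n"
    then have "(MM * X) $$ (u, v) = (\<Sum>w<n. M u w * X $$ (w, v))"
      using that X(1) by (simp add: MM_def scalar_prod_def atLeast0LessThan)
    then show "(\<Sum>w<n. M u w * X $$ (w, v)) = 0" using MX \<open>u < n\<close> that by simp
  qed (rule that)
  define Y where "Y i j = X $$ (r i, r j)" for i j
  \<comment> \<open>Kernel vectors are determined by their root values; this is applied to the
    columns and, by symmetry, to the rows of \<open>X\<close>.\<close>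
  have expand: "X $$ (u, v) = (\<Sum>i<t. \<Sum>j<t. E u i * E v j * Y i j)" if "u < n" "v < n" for u v
  proof -
    have "X $$ (r i, v) = (\<Sum>j<t. E v j * Y i j)" if "i < t" for i
    proof -
      have "X $$ (r i, v) = X $$ (v, r i)" using X_sym root_less that \<open>v < n\<close> by simp
      also have "\<dots> = (\<Sum>j<t. E v j * X $$ (r j, r i))" using \<open>v < n\<close> root_less[OF that] by (rule ker)
      also have "\<dots> = (\<Sum>j<t. E v j * Y i j)"
        unfolding Y_def using X_sym root_less that by (intro sum.cong refl) auto
      finally show ?thesis .
    qed
    then show ?thesis unfolding ker[OF that] by (simp add: sum_distrib_left mult.assoc)
  qed
  define S where "S = (\<Sum>i<t. \<Sum>j<t. \<bar>Y i j\<bar>)"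
  have S: "S \<ge> 0" unfolding S_def by (intro sum_nonneg) auto
  \<comment> \<open>Exchanging the two indicators for entries of \<open>E\<close> costs at most
    \<open>d\<close> and \<open>d * 2\<close>, as entries of \<open>E\<close> are bounded by
    2.\<close>
  have edge: "\<bar>Y (b u) (b v)\<bar> \<le> 3 * d * S" if "u < n" "v < n" "b u < t" "b v < t" "X $$ (u, v) = 0" for u v
  proof -
    let ?e = "\<lambda>i. of_bool (b u = i) :: real" and ?f = "\<lambda>j. of_bool (b v = j) :: real"
    have "(\<Sum>j<t. ?e i * ?f j * Y i j) = ?e i * Y i (b v)" for i
    proof -
      have "(\<Sum>j<t. ?e i * ?f j * Y i j) = (\<Sum>j<t. if b v = j then ?e i * Y i j else 0)"
        by (intro sum.cong refl) auto
      then show ?thesis using that by simp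
    qed
    then have "(\<Sum>i<t. \<Sum>j<t. ?e i * ?f j * Y i j) = (\<Sum>i<t. if b u = i then Y i (b v) else 0)"
      by (simp only:) (intro sum.cong refl, auto)
    also have "\<dots> = Y (b u) (b v)" using that by simp
    finally have "Y (b u) (b v) = (\<Sum>i<t. \<Sum>j<t. ?e i * ?f j * Y i j) - (\<Sum>i<t. \<Sum>j<t. E u i * E v j * Y i j)"
      using expand[OF that(1,2)] that(5) by simp
    also have "\<dots> = (\<Sum>i<t. \<Sum>j<t. (?e i * ?f j - E u i * E v j) * Y i j)"
      by (simp add: sum_subtractf left_diff_distrib)
    also have "\<bar>\<dots>\<bar> \<le> (\<Sum>i<t. \<Sum>j<t. 3 * d * \<bar>Y i j\<bar>)"
    proof (intro order_trans[OF sum_abs] sum_mono order_trans[OF sum_abs])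
      fix i j assume ij: "i \<in> {..<t}" "j \<in> {..<t}"
      have e: "\<bar>?e i - E u i\<bar> \<le> d" and f: "\<bar>?f j - E v j\<bar> \<le> d"
        using E_near[OF that(1), of i] E_near[OF that(2), of j] ij by (auto simp: abs_minus_commute)
      have "\<bar>?f j\<bar> \<le> 1" by simp
      with f have "\<bar>E v j\<bar> \<le> 2" using d(3) by linarith
      have "?e i * ?f j - E u i * E v j = ?e i * (?f j - E v j) + (?e i - E u i) * E v j"
        by (simp add: algebra_simps)
      also have "\<bar>\<dots>\<bar> \<le> \<bar>?e i\<bar> * \<bar>?f j - E v j\<bar> + \<bar>?e i - E u i\<bar> * \<bar>E v j\<bar>"
        by (metis abs_mult abs_triangle_ineq)
      also have "\<dots> \<le> 1 * d + d * 2"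
        using e f \<open>\<bar>E v j\<bar> \<le> 2\<close> d(1) by (intro add_mono mult_mono) auto
      finally show "\<bar>(?e i * ?f j - E u i * E v j) * Y i j\<bar> \<le> 3 * d * \<bar>Y i j\<bar>"
        unfolding abs_mult[of _ "Y i j"] by (intro mult_right_mono) auto
    qed
    also have "\<dots> = 3 * d * S" by (simp add: S_def sum_distrib_left)
    finally show ?thesis .
  qed
  \<comment> \<open>Every pair of labels is realized by a place where \<open>X\<close> vanishes: an
    edge if the labels differ, a diagonal entry if they agree.\<close>
  have "\<bar>Y i j\<bar> \<le> 3 * d * S" if ij: "i < t" "j < t" for i j
  proof -
    have "\<exists>u<n. \<exists>v<n. b u = i \<and> b v = j \<and> (u = v \<or> A u v)"
    proof (cases i j rule: linorder_cases)
      case less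
      then show ?thesis using branch_adjacent[of i j] ij by blast
    next
      case equal
      then show ?thesis using root_less[of i] label_root[of i] ij by blast
    next
      case greater
      then show ?thesis using branch_adjacent[of j i] ij sym by blast
    qed
    then show ?thesis using edge zero ij by blast
  qed
  \<comment> \<open>Summed over all pairs, \<open>S\<close> is at most
    \<open>3 * d * real t * real t\<close> times itself, a factor below 1.\<close>
  then have "S \<le> (\<Sum>i<t. \<Sum>j<t. 3 * d * S)" unfolding S_def by (intro sum_mono) auto
  also have "\<dots> = (3 * d * real t * real t) * S" by simp
  finally have "(1 - 3 * d * real t * real t) * S \<le> 0" by (simp add: algebra_simps)
  then have "S = 0" using S d(2) by (simp add: mult_le_0_iff)
  then have "(\<Sum>j<t. \<bar>Y i j\<bar>) = 0" if "i < t" for i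
    using that unfolding S_def by (subst (asm) sum_nonneg_eq_0_iff) (auto intro: sum_nonneg)
  then have "Y i j = 0" if "i < t" "j < t" for i j
    using that by (subst (asm) sum_nonneg_eq_0_iff) auto
  then show ?thesis using X expand by (intro eq_matI) auto
qed

end
end

section \<open>Complete minors bound the Colin de Verdiere invariant\<close>

definition connected_in :: "('a \<times> 'a) set \<Rightarrow> 'a set \<Rightarrow> bool" where
  "connected_in E X \<longleftrightarrow> X \<noteq> {} \<and> (\<forall>x\<in>X. \<forall>y\<in>X. (x, y) \<in> (E \<inter> X \<times> X)\<^sup>*)"

definition touching :: "('a \<times> 'a) set \<Rightarrow> 'a set \<Rightarrow> 'a set \<Rightarrow> bool" where
  "touching E X Y \<longleftrightarrow> (\<exists>x\<in>X. \<exists>y\<in>Y. (x, y) \<in> E)"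

text \<open>What has to be checked is that the maximum is over a finite set; the number of vertices
  bounds every corank.\<close>

lemma kernel_dim_le_colin_de_verdiere:
  assumes "finite (pverts G)" "distinct vs" "set vs = pverts G" "colin_de_verdiere_matrix G vs M"
  shows "kernel_dim M \<le> colin_de_verdiere G"
proof -
  let ?S = "{kernel_dim M | M vs. distinct vs \<and> set vs = pverts G \<and> colin_de_verdiere_matrix G vs M}"
  have "k \<le> card (pverts G)" if k: "k \<in> ?S" for k
  proof -
    obtain M vs where M: "k = kernel_dim M" "distinct vs" "set vs = pverts G" "colin_de_verdiere_matrix G vs M"
      using k by blast
    then have "dim_col M = card (pverts G)"
      by (auto simp: colin_de_verdiere_matrix_def Let_def symmetric_real_mat_def distinct_card[symmetric])
    then show ?thesis using kernel_dim_le[of M] M(1) by simp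
  qed
  then have "?S \<subseteq> {..card (pverts G)}" by blast
  then have "finite ?S" by (rule finite_subset) simp
  moreover have "kernel_dim M \<in> ?S" using assms by blast
  ultimately show ?thesis unfolding colin_de_verdiere_def by (rule Max_ge)
qed

lemma clique_minor_le:
  fixes W :: "nat \<Rightarrow> 'a set"
  assumes G: "pair_graph G" and t: "0 < t"
    and sub: "\<And>k. k < t \<Longrightarrow> W k \<subseteq> pverts G"
    and conn: "\<And>k. k < t \<Longrightarrow> connected_in (parcs G) (W k)"
    and disj: "\<And>k l. k < t \<Longrightarrow> l < t \<Longrightarrow> k \<noteq> l \<Longrightarrow> W k \<inter> W l = {}"
    and adj: "\<And>k l. k < l \<Longrightarrow> l < t \<Longrightarrow> touching (parcs G) (W k) (W l)"
  shows "t \<le> colin_de_verdiere G + 1"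
proof -
  interpret pair_graph G by (fact G)
  have fin: "finite (pverts G)" by simp
  obtain vs where vs: "set vs = pverts G" "distinct vs" using finite_distinct_list[OF fin] by blast
  define n where "n = length vs"
  define A where "A u w \<longleftrightarrow> u < n \<and> w < n \<and> (vs ! u, vs ! w) \<in> parcs G" for u w
  \<comment> \<open>The label \<open>t\<close> marks the vertices outside all branch sets.\<close>
  define b where "b u = (if \<exists>k<t. vs ! u \<in> W k then THE k. k < t \<and> vs ! u \<in> W k else t)" for u
  have b_eq: "b u = k" if "k < t" "vs ! u \<in> W k" for u k
  proof -
    have "(THE k. k < t \<and> vs ! u \<in> W k) = k"
      by (rule the_equality) (use that disj in blast)+
    then show ?thesis using that by (auto simp: b_def)
  qed
  have b_in: "vs ! u \<in> W (b u)" if "b u < t" for u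
  proof -
    have "\<exists>k<t. vs ! u \<in> W k" using that by (rule contrapos_pp) (auto simp: b_def)
    then show ?thesis using b_eq by metis
  qed
  have index: "\<exists>u<n. vs ! u = x" if "x \<in> W k" "k < t" for x k
    using that sub vs(1) by (metis in_set_conv_nth n_def subsetD)
  define r where "r k = (SOME u. u < n \<and> vs ! u \<in> W k)" for k
  have r: "r k < n \<and> vs ! r k \<in> W k" if k: "k < t" for k
  proof -
    obtain x where "x \<in> W k" using conn[OF k] by (auto simp: connected_in_def)
    then have "\<exists>u. u < n \<and> vs ! u \<in> W k" using index[OF _ k] by blast
    then show ?thesis unfolding r_def by (rule someI_ex)
  qed
  interpret clique_model n t A b r
  proof
    show "A u w \<Longrightarrow> A w u" for u w using arcs_symmetric by (auto simp: A_def)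
    show "\<not> A u u" for u using no_loops by (force simp: A_def)
    show "r k < n" if "k < t" for k using r that by blast
    show "b (r k) = k" if "k < t" for k using r that b_eq by blast
    show "(r (b u), u) \<in> {(x, y). x < n \<and> y < n \<and> A x y \<and> b x = b u \<and> b y = b u}\<^sup>*" (is "_ \<in> ?R\<^sup>*")
      if u: "u < n" "b u < t" for u
    proof -
      let ?k = "b u"
      have "(vs ! r ?k, vs ! u) \<in> (parcs G \<inter> W ?k \<times> W ?k)\<^sup>*"
        using conn[OF u(2)] r[OF u(2)] b_in[OF u(2)] by (auto simp: connected_in_def)
      \<comment> \<open>Stated for every index of the end vertex, which lets the induction along a
        path of vertices carry over to indices.\<close>
      then have "\<forall>j<n. vs ! j = vs ! u \<longrightarrow> (r ?k, j) \<in> ?R\<^sup>*"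
      proof (induction rule: rtrancl_induct)
        case base
        show ?case
        proof (intro allI impI)
          fix j assume "j < n" "vs ! j = vs ! r ?k"
          then have "j = r ?k" using r[OF u(2)] nth_eq_iff_index_eq[OF vs(2)] by (simp add: n_def)
          then show "(r ?k, j) \<in> ?R\<^sup>*" by simp
        qed
      next
        case (step y z)
        show ?case
        proof (intro allI impI)
          fix j assume j: "j < n" "vs ! j = z"
          obtain i where i: "i < n" "vs ! i = y" using index[of y ?k] step(2) u by blast
          have "(i, j) \<in> ?R" using i j step(2) b_eq[OF u(2)] by (auto simp: A_def)
          moreover have "(r ?k, i) \<in> ?R\<^sup>*" using step(3) i by blast
          ultimately show "(r ?k, j) \<in> ?R\<^sup>*" by (rule rtrancl_into_rtrancl[rotated])
        qed
      qed
      then show ?thesis using u by blast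
    qed
    show "\<exists>u<n. \<exists>w<n. A u w \<and> b u = k \<and> b w = l" if kl: "k < l" "l < t" for k l
    proof -
      obtain x y where xy: "x \<in> W k" "y \<in> W l" "(x, y) \<in> parcs G"
        using adj[OF kl] by (auto simp: touching_def)
      have k: "k < t" using kl by simp
      obtain u w where "u < n" "vs ! u = x" "w < n" "vs ! w = y" using index xy(1,2) k kl(2) by metis
      then show ?thesis using xy b_eq[OF k] b_eq[OF kl(2)] by (auto simp: A_def)
    qed
  qed
  \<comment> \<open>Makes \<open>3 * d * real t * real t = 3/4\<close>, below the threshold 1 of
    \<open>MM_strong_arnold\<close>.\<close>
  define d where "d = 1 / (4 * real t * real t)"
  have t1: "1 \<le> real t" using t by simp
  have tt: "1 \<le> real t * real t" using t1 by (simp add: mult_ge1_I)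
  have d: "0 < d" "3 * d * real t * real t < 1" "d \<le> 1"
    using t1 tt by (auto simp: d_def field_simps)
  obtain eps M E where eps: "eps > 0" and mm: "model_matrix d eps M E"
    using exists_model_matrix[OF d(1)] by blast
  let ?M = "MM M"
  have "colin_de_verdiere_matrix G vs ?M"
    unfolding colin_de_verdiere_matrix_def Let_def n_def[symmetric]
  proof (intro conjI)
    show "symmetric_real_mat n ?M"
      using MM_carrier[OF mm eps] by (simp add: symmetric_real_mat_def)
    show "\<forall>i<n. \<forall>j<n. i \<noteq> j \<longrightarrow> (if (vs ! i, vs ! j) \<in> parcs G then ?M $$ (i, j) < 0 else ?M $$ (i, j) = 0)"
    proof (intro allI impI)
      fix i j assume ij: "i < n" "j < n" "i \<noteq> j"
      then have "if A i j then M i j < 0 else M i j = 0" using mm unfolding model_matrix_def by blast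
      then show "if (vs ! i, vs ! j) \<in> parcs G then ?M $$ (i, j) < 0 else ?M $$ (i, j) = 0"
        using ij by (simp add: MM_def[OF mm eps] A_def)
    qed
    show "\<exists>!k. k < 0 \<and> eigenvalue ?M k" by (rule MM_negative_eigenvalue(1)[OF mm eps t])
    show "\<forall>k. k < 0 \<and> eigenvalue ?M k \<longrightarrow> Polynomial.order k (char_poly ?M) = 1"
      using MM_negative_eigenvalue(2)[OF mm eps t] by blast
    show "strong_arnold_property G vs ?M"
      unfolding strong_arnold_property_def Let_def n_def[symmetric]
    proof
      assume "\<exists>X. symmetric_real_mat n X \<and> X \<noteq> 0\<^sub>m n n \<and> ?M * X = 0\<^sub>m n n \<and>
            (\<forall>i<n. \<forall>j<n. i = j \<or> (vs ! i, vs ! j) \<in> parcs G \<longrightarrow> X $$ (i, j) = 0)"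
      then obtain X where X: "X \<in> carrier_mat n n" "transpose_mat X = X" "X \<noteq> 0\<^sub>m n n" "?M * X = 0\<^sub>m n n"
        and z: "\<And>i j. i < n \<Longrightarrow> j < n \<Longrightarrow> i = j \<or> (vs ! i, vs ! j) \<in> parcs G \<Longrightarrow> X $$ (i, j) = 0"
        unfolding symmetric_real_mat_def by blast
      have "X = 0\<^sub>m n n"
        by (rule MM_strong_arnold[OF mm eps X(1,2,4)]) (use z d in \<open>auto simp: A_def\<close>)
      then show False using X(3) by simp
    qed
  qed
  from kernel_dim_le_colin_de_verdiere[OF fin vs(2,1) this]
  show ?thesis using MM_kernel_dim[OF mm eps] by simp
qed

section \<open>Orderings of graphs without a large complete minor\<close>

text \<open>The branch sets of a complete minor of order \<open>card \<W>\<close>.\<close>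

definition clique_family :: "('a \<times> 'a) set \<Rightarrow> 'a set \<Rightarrow> 'a set set \<Rightarrow> bool" where
  "clique_family E V \<W> \<longleftrightarrow> finite \<W> \<and> (\<forall>W\<in>\<W>. W \<subseteq> V \<and> connected_in E W) \<and>
     (\<forall>W\<in>\<W>. \<forall>W'\<in>\<W>. W \<noteq> W' \<longrightarrow> W \<inter> W' = {} \<and> touching E W W')"

lemma card_clique_family_le:
  assumes G: "pair_graph G" and W: "clique_family (parcs G) (pverts G) \<W>"
  shows "card \<W> \<le> colin_de_verdiere G + 1"
proof (cases "card \<W> = 0")
  case False
  have "finite \<W>" using W by (simp add: clique_family_def)
  then obtain h where h: "bij_betw h {0..<card \<W>} \<W>" using ex_bij_betw_nat_finite by blast
  have in_W: "h k \<in> \<W>" if "k < card \<W>" for k using h that by (auto simp: bij_betw_def)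
  have neq: "h k \<noteq> h l" if "k < card \<W>" "l < card \<W>" "k \<noteq> l" for k l
    using h that by (auto simp: bij_betw_def inj_on_def)
  have pair: "h k \<inter> h l = {} \<and> touching (parcs G) (h k) (h l)" if "k < card \<W>" "l < card \<W>" "k \<noteq> l" for k l
    using W in_W[OF that(1)] in_W[OF that(2)] neq[OF that] unfolding clique_family_def by simp
  show ?thesis
  proof (rule clique_minor_le[OF G, of _ h])
    show "0 < card \<W>" using False by simp
    fix k assume k: "k < card \<W>"
    show "h k \<subseteq> pverts G" "connected_in (parcs G) (h k)"
      using W in_W[OF k] by (auto simp: clique_family_def)
    fix l assume l: "l < card \<W>" "k \<noteq> l"
    then show "h k \<inter> h l = {}" using pair[of k l] k by simp
  next
    fix k l assume "k < l" "l < card \<W>"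
    then show "touching (parcs G) (h k) (h l)"
      using pair[of k l] by simp
  qed
qed simp

section \<open>Connected sets, components and geodesics\<close>

lemma connected_inI:
  assumes "sym E" "x \<in> X" "\<And>y. y \<in> X \<Longrightarrow> (x, y) \<in> (E \<inter> X \<times> X)\<^sup>*"
  shows "connected_in E X"
proof -
  have "sym (E \<inter> X \<times> X)" using assms(1) by (auto simp: sym_def)
  then have s: "sym ((E \<inter> X \<times> X)\<^sup>*)" by (rule sym_rtrancl)
  have "(y, z) \<in> (E \<inter> X \<times> X)\<^sup>*" if "y \<in> X" "z \<in> X" for y z
    using symD[OF s assms(3)[OF that(1)]] assms(3)[OF that(2)] by (rule rtrancl_trans)
  then show ?thesis using assms(2) by (auto simp: connected_in_def)
qed

lemma connected_in_singleton: "connected_in E {x}"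
  by (simp add: connected_in_def)

lemma connected_in_path:
  assumes "connected_in E X" "x \<in> X" "y \<in> X" "X \<subseteq> Y"
  shows "(x, y) \<in> (E \<inter> Y \<times> Y)\<^sup>*"
proof -
  have "(E \<inter> X \<times> X)\<^sup>* \<subseteq> (E \<inter> Y \<times> Y)\<^sup>*" by (rule rtrancl_mono) (use assms(4) in blast)
  then show ?thesis using assms by (auto simp: connected_in_def)
qed

lemma connected_in_Union:
  assumes "sym E" "\<And>P. P \<in> \<P> \<Longrightarrow> x \<in> P \<and> connected_in E P" "\<P> \<noteq> {}"
  shows "connected_in E (\<Union>\<P>)"
proof (rule connected_inI[OF assms(1)])
  show "x \<in> \<Union>\<P>" using assms(2,3) by blast
  fix y assume "y \<in> \<Union>\<P>"
  then obtain P where P: "P \<in> \<P>" "y \<in> P" by blast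
  show "(x, y) \<in> (E \<inter> \<Union>\<P> \<times> \<Union>\<P>)\<^sup>*"
    by (rule connected_in_path[of _ P]) (use assms(2)[OF P(1)] P in auto)
qed

lemma connected_in_insert:
  assumes "sym E" "connected_in E P" "y \<in> P" "(y, x) \<in> E"
  shows "connected_in E (insert x P)"
proof (rule connected_inI[OF assms(1)])
  show "y \<in> insert x P" using assms(3) by simp
  fix z assume z: "z \<in> insert x P"
  show "(y, z) \<in> (E \<inter> insert x P \<times> insert x P)\<^sup>*"
  proof (cases "z = x")
    case True
    then show ?thesis using assms(3,4) by (intro r_into_rtrancl) auto
  next
    case False
    show ?thesis by (rule connected_in_path[OF assms(2,3)]) (use z False in auto)
  qed
qed

definition component :: "('a \<times> 'a) set \<Rightarrow> 'a set \<Rightarrow> 'a \<Rightarrow> 'a set" where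
  "component E U x = {y. (x, y) \<in> (E \<inter> U \<times> U)\<^sup>*}"

lemma component_refl: "x \<in> component E U x"
  by (simp add: component_def)

lemma component_subset: "x \<in> U \<Longrightarrow> component E U x \<subseteq> U"
  by (auto simp: component_def elim: rtranclE)

lemma component_closed:
  assumes "y \<in> component E U x" "(y, z) \<in> E" "x \<in> U" "z \<in> U"
  shows "z \<in> component E U x"
proof -
  have "y \<in> U" using component_subset[OF assms(3)] assms(1) by blast
  then show ?thesis using assms by (auto simp: component_def intro: rtrancl_into_rtrancl)
qed

lemma connected_in_component:
  assumes "sym E" "x \<in> U"
  shows "connected_in E (component E U x)"
proof (rule connected_inI[OF assms(1) component_refl])
  let ?C = "component E U x"
  fix y assume "y \<in> ?C"
  then have "(x, y) \<in> (E \<inter> U \<times> U)\<^sup>*" by (simp add: component_def)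
  then show "(x, y) \<in> (E \<inter> ?C \<times> ?C)\<^sup>*"
  proof (induction rule: rtrancl_induct)
    case (step y z)
    have "y \<in> ?C" "z \<in> ?C"
      using step.hyps(1) rtrancl_into_rtrancl[OF step.hyps] by (simp_all add: component_def)
    then have "(y, z) \<in> E \<inter> ?C \<times> ?C" using step.hyps(2) by blast
    with step.IH show ?case by (rule rtrancl_into_rtrancl)
  qed simp
qed

lemma connected_subset_component:
  assumes K: "connected_in E K" "K \<subseteq> U" and y: "y \<in> K" "y \<in> component E U x"
  shows "K \<subseteq> component E U x"
proof
  fix z assume "z \<in> K"
  then have "(y, z) \<in> (E \<inter> U \<times> U)\<^sup>*" using connected_in_path[OF K(1) y(1) _ K(2)] by blast
  then show "z \<in> component E U x" using y(2) by (auto simp: component_def)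
qed

text \<open>\<open>P x\<close> is the vertex set of a geodesic from \<open>r\<close> to
  \<open>x\<close>. Geodesics matter only through the fact that they meet each distance level at
  most once, which is injectivity of \<open>d\<close>.\<close>

lemma breadth_first_levels:
  assumes E: "sym E" and C: "connected_in E C" and r: "r \<in> C"
  obtains d :: "'a \<Rightarrow> nat" and P where
    "\<And>x y. x \<in> C \<Longrightarrow> y \<in> C \<Longrightarrow> (x, y) \<in> E \<Longrightarrow> d y \<le> d x + 1"
    "\<And>x. x \<in> C \<Longrightarrow> P x \<subseteq> C \<and> r \<in> P x \<and> x \<in> P x \<and> connected_in E (P x) \<and> inj_on d (P x)"
proof -
  let ?R = "E \<inter> C \<times> C"
  define d where "d x = (LEAST n. (r, x) \<in> ?R ^^ n)" for x
  have d: "(r, x) \<in> ?R ^^ d x" if "x \<in> C" for x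
  proof -
    have "(r, x) \<in> ?R\<^sup>*" using C r that by (auto simp: connected_in_def)
    then show ?thesis unfolding d_def by (metis LeastI rtrancl_imp_relpow)
  qed
  have d_le: "d x \<le> n" if "(r, x) \<in> ?R ^^ n" for x n
    unfolding d_def using that by (rule Least_le)
  have step: "d y \<le> d x + 1" if "x \<in> C" "y \<in> C" "(x, y) \<in> E" for x y
  proof -
    have "(r, y) \<in> ?R ^^ Suc (d x)" using d[OF that(1)] that by (intro relpow_Suc_I) auto
    then show ?thesis using d_le by fastforce
  qed
  \<comment> \<open>The bound \<open>d z \<le> d x\<close> strengthens the induction: it shows that
    the next vertex opens a new level.\<close>
  have geodesic: "\<exists>P. P \<subseteq> C \<and> r \<in> P \<and> x \<in> P \<and> connected_in E P \<and> inj_on d P \<and> (\<forall>z\<in>P. d z \<le> d x)"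
    if "x \<in> C" "d x = n" for x n
    using that
  proof (induction n arbitrary: x)
    case 0
    then have "x = r" using d[of x] by simp
    then show ?case using r by (intro exI[of _ "{r}"]) (auto simp: connected_in_singleton)
  next
    case (Suc n)
    then have "(r, x) \<in> ?R ^^ Suc n" using d by metis
    then obtain y where y: "(r, y) \<in> ?R ^^ n" "(y, x) \<in> ?R" by (rule relpow_Suc_E)
    have yC: "y \<in> C" "(y, x) \<in> E" using y by auto
    have "d y \<le> n" using d_le[OF y(1)] .
    moreover have "d x \<le> d y + 1" using step yC Suc.prems by blast
    ultimately have dy: "d y = n" using Suc.prems by simp
    obtain P where P: "P \<subseteq> C" "r \<in> P" "y \<in> P" "connected_in E P" "inj_on d P" "\<forall>z\<in>P. d z \<le> d y"
      using Suc.IH[OF yC(1) dy] by blast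
    have "d x \<notin> d ` P" using P(6) dy Suc.prems by auto
    then have "inj_on d (insert x P)" using P(5) by (auto simp: inj_on_insert)
    moreover have "connected_in E (insert x P)" by (rule connected_in_insert[OF E P(4,3) yC(2)])
    moreover have "\<forall>z\<in>insert x P. d z \<le> d x" using P(6) dy Suc.prems by auto
    ultimately show ?case using P(1,2) Suc.prems by (intro exI[of _ "insert x P"]) auto
  qed
  define P where "P x = (SOME P. P \<subseteq> C \<and> r \<in> P \<and> x \<in> P \<and> connected_in E P \<and> inj_on d P \<and> (\<forall>z\<in>P. d z \<le> d x))" for x
  show thesis
  proof (rule that)
    fix x assume "x \<in> C"
    from someI_ex[OF geodesic[OF this refl]]
    show "P x \<subseteq> C \<and> r \<in> P x \<and> x \<in> P x \<and> connected_in E (P x) \<and> inj_on d (P x)"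
      unfolding P_def by simp
  qed (fact step)
qed

section \<open>Geodesics near a vertex and the ordering\<close>

definition near :: "('a \<times> 'a) set \<Rightarrow> 'a set \<Rightarrow> 'a \<Rightarrow> 'a set \<Rightarrow> 'a set" where
  "near E K v Q = {u \<in> Q. (u, v) \<in> E \<or> (\<exists>w\<in>K. (v, w) \<in> E \<and> (u, w) \<in> E)}"

text \<open>At most two steps inside \<open>C\<close>, or from it, change the level by at most 2. So
  only five levels are concerned, and each geodesic has at most one vertex on each.\<close>

lemma card_near_geodesics_le:
  assumes d: "\<And>x y. x \<in> C \<Longrightarrow> y \<in> C \<Longrightarrow> (x, y) \<in> E \<Longrightarrow> (d y :: nat) \<le> d x + 1"
    and E: "sym E" and fin: "finite X"
    and P: "\<And>x. x \<in> X \<Longrightarrow> P x \<subseteq> C \<and> inj_on d (P x)"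
    and v: "v \<in> C" and K: "K \<subseteq> C"
  shows "card (near E K v (\<Union>x\<in>X. P x)) \<le> 5 * card X"
proof -
  \<comment> \<open>Truncated subtraction is harmless here, since no level is below 0.\<close>
  let ?N = "\<lambda>x. {u \<in> P x. d u \<in> {d v - 2..d v + 2}}"
  have d': "d y \<le> d x + 1 \<and> d x \<le> d y + 1" if "x \<in> C" "y \<in> C" "(x, y) \<in> E" for x y
    using d[of x y] d[of y x] that symD[OF E] by blast
  have sub: "near E K v (\<Union>x\<in>X. P x) \<subseteq> (\<Union>x\<in>X. ?N x)"
  proof
    fix u assume "u \<in> near E K v (\<Union>x\<in>X. P x)"
    then obtain x where x: "x \<in> X" "u \<in> P x"
      and near: "(u, v) \<in> E \<or> (\<exists>w\<in>K. (v, w) \<in> E \<and> (u, w) \<in> E)" by (auto simp: near_def)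
    have u: "u \<in> C" using P x by blast
    from near have "d u \<le> d v + 2 \<and> d v \<le> d u + 2"
    proof
      assume "(u, v) \<in> E"
      then show ?thesis using d'[OF u v] by simp
    next
      assume "\<exists>w\<in>K. (v, w) \<in> E \<and> (u, w) \<in> E"
      then obtain w where w: "w \<in> C" "(v, w) \<in> E" "(u, w) \<in> E" using K by blast
      then show ?thesis using d'[OF u w(1)] d'[OF v w(1)] by linarith
    qed
    then show "u \<in> (\<Union>x\<in>X. ?N x)" using x by auto
  qed
  have N: "finite (?N x) \<and> card (?N x) \<le> 5" if "x \<in> X" for x
  proof -
    have inj: "inj_on d (?N x)" using P[OF that] by (auto intro: inj_on_subset)
    have im: "d ` ?N x \<subseteq> {d v - 2..d v + 2}" by auto
    have "card (?N x) \<le> card {d v - 2..d v + 2}" by (rule card_inj_on_le[OF inj im]) simp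
    moreover have "finite (?N x)" using inj_on_finite[OF inj im] by simp
    ultimately show ?thesis by simp
  qed
  have "card (near E K v (\<Union>x\<in>X. P x)) \<le> card (\<Union>x\<in>X. ?N x)"
    by (rule card_mono[OF _ sub]) (use fin N in auto)
  also have "\<dots> \<le> (\<Sum>x\<in>X. card (?N x))" by (rule card_UN_le[OF fin])
  also have "\<dots> \<le> (\<Sum>x\<in>X. 5)" using N by (intro sum_mono) blast
  finally show ?thesis by simp
qed

text \<open>Strong reachability in at most two steps, for an order that places all vertices outside
  \<open>U\<close> before those of \<open>U\<close>; \<open>rho\<close> thus has to order
  \<open>U\<close> only, which suits the induction.\<close>

definition earlier :: "('a \<times> 'a) set \<Rightarrow> 'a set \<Rightarrow> 'a set \<Rightarrow> ('a \<Rightarrow> nat) \<Rightarrow> 'a \<Rightarrow> 'a set" where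
  "earlier E V U rho v = {u \<in> V. (u \<notin> U \<or> rho u < rho v) \<and>
     ((u, v) \<in> E \<or> (\<exists>w\<in>U. rho v < rho w \<and> (v, w) \<in> E \<and> (u, w) \<in> E))}"

text \<open>The vertices outside \<open>U\<close> have been placed, in connected sets \<open>\<Q>\<close> each of which is a union of few
  geodesics of the part of the graph that was left when it was chosen. Next come the vertices of a
  union \<open>H\<close> of geodesics of a component \<open>C\<close> of \<open>U\<close> that connects all sets of \<open>\<Q>\<close> touching \<open>C\<close>; these
  sets and \<open>C\<close> are the branch sets of a complete minor, hence there are few of them.\<close>

lemma exists_ordering_extension:
  assumes E: "sym E" and V: "finite V"
    and minor: "\<And>\<W>. clique_family E V \<W> \<Longrightarrow> card \<W> < t"
    and fin: "finite \<Q>" and U: "U \<subseteq> V" and cover: "\<Union>\<Q> = V - U"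
    and conn: "\<And>Q. Q \<in> \<Q> \<Longrightarrow> connected_in E Q"
    and disj: "\<And>Q Q'. Q \<in> \<Q> \<Longrightarrow> Q' \<in> \<Q> \<Longrightarrow> Q \<noteq> Q' \<Longrightarrow> Q \<inter> Q' = {}"
    and clique: "\<And>K Q Q'. K \<subseteq> U \<Longrightarrow> connected_in E K \<Longrightarrow> Q \<in> \<Q> \<Longrightarrow> Q' \<in> \<Q> \<Longrightarrow> Q \<noteq> Q' \<Longrightarrow>
      touching E Q K \<Longrightarrow> touching E Q' K \<Longrightarrow> touching E Q Q'"
    and thin: "\<And>K Q v. K \<subseteq> U \<Longrightarrow> connected_in E K \<Longrightarrow> Q \<in> \<Q> \<Longrightarrow> v \<in> K \<Longrightarrow> card (near E K v Q) \<le> 5 * t"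
  shows "\<exists>rho :: 'a \<Rightarrow> nat. inj_on rho U \<and> (\<forall>v\<in>U. card (earlier E V U rho v) \<le> 5 * t * t)"
  using fin U cover conn disj clique thin
proof (induction "card U" arbitrary: U \<Q> rule: less_induct)
  case less
  note fin = less.prems(1) and U = less.prems(2) and cover = less.prems(3) and conn = less.prems(4)
    and disj = less.prems(5) and clique = less.prems(6) and thin = less.prems(7)
  have finU: "finite U" using U V by (rule finite_subset)
  have touching_sym: "touching E X Y \<Longrightarrow> touching E Y X" for X Y
    using symD[OF E] by (auto simp: touching_def)
  show ?case
  proof (cases "U = {}")
    case False
    then obtain v0 where v0: "v0 \<in> U" by blast
    define C where "C = component E U v0"
    have C: "C \<subseteq> U" "v0 \<in> C" "connected_in E C"
      unfolding C_def using component_subset[OF v0] component_refl connected_in_component[OF E v0] by auto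
    have C_closed: "z \<in> C" if "y \<in> C" "(y, z) \<in> E" "z \<in> U" for y z
      using that component_closed[of y E U v0 z] v0 by (simp add: C_def)
    have C_max: "K \<subseteq> C" if "connected_in E K" "K \<subseteq> U" "y \<in> K" "y \<in> C" for K y
      using that(4) unfolding C_def by (rule connected_subset_component[OF that(1-3)])
    define \<N> where "\<N> = {Q \<in> \<Q>. touching E Q C}"
    have finN: "finite \<N>" using fin by (simp add: \<N>_def)
    \<comment> \<open>Two sets in \<open>\<N>\<close> touch each other because both touch the
      connected set \<open>C\<close>; the hypothesis \<open>clique\<close> is carried through the
      induction for this.\<close>
    have "clique_family E V (insert C \<N>)"
      unfolding clique_family_def
    proof (intro conjI ballI impI)
      show "finite (insert C \<N>)" using finN by simp
      fix W assume W: "W \<in> insert C \<N>"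
      show "W \<subseteq> V" using W cover C(1) U by (auto simp: \<N>_def)
      show "connected_in E W" using W C(3) conn by (auto simp: \<N>_def)
      fix W' assume W': "W' \<in> insert C \<N>" "W \<noteq> W'"
      have QC: "Q \<inter> C = {}" if "Q \<in> \<N>" for Q using that cover C(1) by (auto simp: \<N>_def)
      have both: "W \<inter> W' = {} \<and> touching E W W'" if "W \<in> \<N>" "W' \<in> \<N>"
        using that disj[of W W'] clique[OF C(1,3), of W W'] W'(2) by (simp add: \<N>_def)
      have one: "Q \<inter> C = {} \<and> touching E Q C \<and> touching E C Q" if "Q \<in> \<N>" for Q
        using QC[OF that] that touching_sym by (simp add: \<N>_def)
      show "W \<inter> W' = {}" "touching E W W'"
        using W W' both one[of W] one[of W'] by (auto simp: Int_commute)
    qed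
    then have "card (insert C \<N>) < t" by (rule minor)
    moreover have "C \<notin> \<N>" using cover C by (auto simp: \<N>_def)
    ultimately have card_N: "card \<N> + 1 < t" using finN by simp
    have "\<forall>Q\<in>\<N>. \<exists>x. x \<in> C \<and> touching E Q {x}" by (auto simp: \<N>_def touching_def)
    then obtain f where f: "\<forall>Q\<in>\<N>. f Q \<in> C \<and> touching E Q {f Q}" by (rule bchoice[THEN exE])
    obtain d :: "'a \<Rightarrow> nat" and P where
      d: "\<And>x y. x \<in> C \<Longrightarrow> y \<in> C \<Longrightarrow> (x, y) \<in> E \<Longrightarrow> d y \<le> d x + 1" and
      P: "\<And>x. x \<in> C \<Longrightarrow> P x \<subseteq> C \<and> v0 \<in> P x \<and> x \<in> P x \<and> connected_in E (P x) \<and> inj_on d (P x)"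
      using breadth_first_levels[OF E C(3,2)] by blast
    \<comment> \<open>One end point for each neighbouring set. Adding \<open>v0\<close> makes
      \<open>H\<close> nonempty even if there is none, and all geodesics start at \<open>v0\<close>,
      so \<open>H\<close> is connected.\<close>
    define X where "X = insert v0 (f ` \<N>)"
    have X: "X \<subseteq> C" "finite X" "X \<noteq> {}" using C(2) f finN by (auto simp: X_def)
    have "card X \<le> card \<N> + 1"
      unfolding X_def using card_insert_le_m1[of "card \<N> + 1" "f ` \<N>" v0] card_image_le[OF finN, of f] by simp
    then have card_X: "5 * card X \<le> 5 * t" using card_N by simp
    define H where "H = (\<Union>x\<in>X. P x)"
    have H: "H \<subseteq> C" "v0 \<in> H" using P X by (auto simp: H_def)
    have H_conn: "connected_in E H" unfolding H_def
      by (rule connected_in_Union[OF E, of _ v0]) (use P X in auto)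
    have H_thin: "card (near E K v H) \<le> 5 * t" if "K \<subseteq> C" "v \<in> C" for K v
    proof -
      have "card (near E K v (\<Union>x\<in>X. P x)) \<le> 5 * card X"
        by (rule card_near_geodesics_le[OF d E X(2)]) (use P X(1) that in auto)
      then show ?thesis using card_X by (simp add: H_def)
    qed
    have H_touch: "touching E Q H" if "Q \<in> \<N>" for Q
    proof -
      have "f Q \<in> H" using that P f X unfolding H_def X_def by blast
      moreover have "touching E Q {f Q}" using f that by blast
      ultimately show ?thesis unfolding touching_def by blast
    qed
    have finH: "finite H" using H(1) C(1) finU by (meson finite_subset)
    let ?U = "U - H" and ?Q = "insert H \<Q>"
    \<comment> \<open>Only pieces inside \<open>C\<close> can touch \<open>H\<close>, so both
      invariants for \<open>H\<close> need to be checked for those alone.\<close>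
    have near_C: "K \<subseteq> C" if K: "K \<subseteq> ?U" "connected_in E K" and HK: "touching E H K" for K
    proof -
      obtain u z where "u \<in> H" "z \<in> K" "(u, z) \<in> E" using HK unfolding touching_def by blast
      moreover from this have "z \<in> C" using C_closed[of u z] H K by blast
      ultimately show ?thesis using C_max[OF K(2)] K(1) by blast
    qed
    have "\<exists>rho :: 'a \<Rightarrow> nat. inj_on rho ?U \<and> (\<forall>v\<in>?U. card (earlier E V ?U rho v) \<le> 5 * t * t)"
    proof (rule less.hyps)
      show "card ?U < card U" using v0 H finU by (intro psubset_card_mono) auto
      show "finite ?Q" using fin by simp
      show "?U \<subseteq> V" using U by blast
      show "\<Union>?Q = V - ?U" using cover H C U by auto
      show "connected_in E Q" if "Q \<in> ?Q" for Q using that conn H_conn by blast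
      show "Q \<inter> Q' = {}" if "Q \<in> ?Q" "Q' \<in> ?Q" "Q \<noteq> Q'" for Q Q'
        using that disj cover H C by blast
      have in_N: "Q \<in> \<N>" if "Q \<in> \<Q>" "K \<subseteq> C" "touching E Q K" for K Q
        using that by (auto simp: \<N>_def touching_def)
      show "touching E Q Q'" if K: "K \<subseteq> ?U" "connected_in E K" and Q: "Q \<in> ?Q" "Q' \<in> ?Q" "Q \<noteq> Q'"
          "touching E Q K" "touching E Q' K" for K Q Q'
      proof -
        \<comment> \<open>In the first two cases the old set touches \<open>K\<close>, which lies in
          \<open>C\<close>, so it belongs to \<open>\<N>\<close> and \<open>H\<close> contains a
          vertex chosen next to it.\<close>
        consider "Q = H" "Q' \<in> \<Q>" | "Q' = H" "Q \<in> \<Q>" | "Q \<in> \<Q>" "Q' \<in> \<Q>" using Q by blast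
        then show ?thesis
        proof cases
          case 1
          then show ?thesis using near_C[OF K] Q in_N H_touch touching_sym by blast
        next
          case 2
          then show ?thesis using near_C[OF K] Q in_N H_touch by blast
        next
          case 3
          have "K \<subseteq> U" using K by blast
          then show ?thesis using clique[of K Q Q'] K Q 3 by blast
        qed
      qed
      show "card (near E K v Q) \<le> 5 * t" if K: "K \<subseteq> ?U" "connected_in E K" and Q: "Q \<in> ?Q" and v: "v \<in> K" for K Q v
      proof (cases "Q = H")
        case True
        show ?thesis
        proof (cases "near E K v H = {}")
          case False
          then have "touching E H K" using v by (auto simp: near_def touching_def)
          then have "K \<subseteq> C" by (rule near_C[OF K])
          then show ?thesis using H_thin v True by blast
        qed (simp add: True)
      next
        case False
        then have "Q \<in> \<Q>" using Q by simp
        moreover have "K \<subseteq> U" using K by blast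
        ultimately show ?thesis using thin K(2) v by blast
      qed
    qed
    then obtain rho :: "'a \<Rightarrow> nat" where rho: "inj_on rho ?U" "\<And>v. v \<in> ?U \<Longrightarrow> card (earlier E V ?U rho v) \<le> 5 * t * t"
      by blast
    obtain h where h: "bij_betw h H {0..<card H}" using ex_bij_betw_finite_nat[OF finH] by blast
    \<comment> \<open>\<open>H\<close> comes first, in arbitrary order, followed by the rest in the
      order given by induction.\<close>
    define sigma where "sigma v = (if v \<in> H then h v else rho v + card H)" for v
    have h_less: "h v < card H" if "v \<in> H" for v using h that by (auto simp: bij_betw_def)
    have sigma_H: "sigma v < card H \<longleftrightarrow> v \<in> H" for v using h_less by (auto simp: sigma_def)
    have "inj_on sigma U"
    proof (rule inj_onI)
      fix x y assume xy: "x \<in> U" "y \<in> U" "sigma x = sigma y"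
      then have "x \<in> H \<longleftrightarrow> y \<in> H" using sigma_H by metis
      then show "x = y" using xy h rho(1) by (auto simp: sigma_def bij_betw_def dest: inj_onD split: if_splits)
    qed
    moreover have "card (earlier E V U sigma v) \<le> 5 * t * t" if v: "v \<in> U" for v
    proof (cases "v \<in> H")
      case False
      \<comment> \<open>For \<open>v\<close> outside \<open>H\<close> all of \<open>H\<close> counts
        as already placed, in agreement with the recursive order on \<open>?U\<close>.\<close>
      have "earlier E V U sigma v \<subseteq> earlier E V ?U rho v"
      proof
        fix u assume "u \<in> earlier E V U sigma v"
        then have u: "u \<in> V" "u \<notin> U \<or> sigma u < sigma v"
          "(u, v) \<in> E \<or> (\<exists>w\<in>U. sigma v < sigma w \<and> (v, w) \<in> E \<and> (u, w) \<in> E)" by (auto simp: earlier_def)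
        have "u \<notin> ?U \<or> rho u < rho v" using u(2) False by (auto simp: sigma_def split: if_splits)
        moreover have "w \<in> ?U \<and> rho v < rho w" if "w \<in> U" "sigma v < sigma w" for w
          using that False sigma_H[of w] by (auto simp: sigma_def split: if_splits)
        ultimately show "u \<in> earlier E V ?U rho v" using u by (auto simp: earlier_def)
      qed
      then have "card (earlier E V U sigma v) \<le> card (earlier E V ?U rho v)"
        using V by (intro card_mono) (auto simp: earlier_def)
      also have "\<dots> \<le> 5 * t * t" using rho(2) v False by blast
      finally show ?thesis .
    next
      case True
      then have vC: "v \<in> C" using H by blast
      \<comment> \<open>A later middle vertex is a neighbour of \<open>v\<close> in \<open>U\<close>
        and hence in \<open>C\<close>. An earlier vertex is in \<open>H\<close> or in a placed set,
        which then touches \<open>C\<close>.\<close>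
      have sub: "earlier E V U sigma v \<subseteq> (\<Union>Q\<in>insert H \<N>. near E C v Q)"
      proof
        fix u assume "u \<in> earlier E V U sigma v"
        then have u: "u \<in> V" "u \<notin> U \<or> sigma u < sigma v"
          and e: "(u, v) \<in> E \<or> (\<exists>w\<in>U. sigma v < sigma w \<and> (v, w) \<in> E \<and> (u, w) \<in> E)" by (auto simp: earlier_def)
        have e': "(u, v) \<in> E \<or> (\<exists>w\<in>C. (v, w) \<in> E \<and> (u, w) \<in> E)" using e C_closed[OF vC] by blast
        show "u \<in> (\<Union>Q\<in>insert H \<N>. near E C v Q)"
        proof (cases "u \<in> U")
          case True
          then have "sigma u < card H" using u(2) sigma_H[of v] \<open>v \<in> H\<close> by auto
          then show ?thesis using sigma_H e' by (auto simp: near_def)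
        next
          case False
          then obtain Q where Q: "Q \<in> \<Q>" "u \<in> Q" using u(1) cover by blast
          then have "Q \<in> \<N>" using e' vC by (auto simp: \<N>_def touching_def)
          then show ?thesis using Q e' by (auto simp: near_def)
        qed
      qed
      have near_le: "card (near E C v Q) \<le> 5 * t" if "Q \<in> insert H \<N>" for Q
        using that H_thin[OF subset_refl vC] thin[OF C(1,3) _ vC] by (auto simp: \<N>_def)
      have "finite (near E C v Q)" if "Q \<in> insert H \<N>" for Q
      proof -
        have "Q \<subseteq> V" using that H C U cover by (auto simp: \<N>_def)
        then show ?thesis using V by (auto simp: near_def intro: finite_subset)
      qed
      then have "card (earlier E V U sigma v) \<le> card (\<Union>Q\<in>insert H \<N>. near E C v Q)"
        using finN by (intro card_mono[OF _ sub]) auto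
      also have "\<dots> \<le> (\<Sum>Q\<in>insert H \<N>. card (near E C v Q))" by (rule card_UN_le) (use finN in simp)
      also have "\<dots> \<le> (\<Sum>Q\<in>insert H \<N>. 5 * t)" by (rule sum_mono[OF near_le])
      also have "\<dots> = card (insert H \<N>) * (5 * t)" by simp
      \<comment> \<open>\<open>card \<N> + 1 < t\<close> leaves room for \<open>H\<close>.\<close>
      also have "\<dots> \<le> t * (5 * t)"
        using card_N card_insert_le_m1[of "card \<N> + 1" \<N> H] by (intro mult_right_mono) auto
      finally show ?thesis by (simp add: mult_ac)
    qed
    ultimately show ?thesis by blast
  qed simp
qed

lemma exists_ordering:
  assumes "sym E" "finite V" "\<And>\<W>. clique_family E V \<W> \<Longrightarrow> card \<W> < t"
  shows "\<exists>rho :: 'a \<Rightarrow> nat. inj_on rho V \<and> (\<forall>v\<in>V. card (earlier E V V rho v) \<le> 5 * t * t)"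
  using exists_ordering_extension[of E V t "{}" V] assms by auto

section \<open>Boxes from colourings\<close>

text \<open>The vertex added last has the largest rank and so lies in no \<open>B v\<close>; its
  colour only has to avoid the fewer than \<open>k\<close> colours on its own set.\<close>

lemma greedy_colouring:
  fixes rho :: "'a \<Rightarrow> nat" and B :: "'a \<Rightarrow> 'a set"
  assumes "finite V"
    and "\<And>v. v \<in> V \<Longrightarrow> B v \<subseteq> V \<and> card (B v) < k \<and> (\<forall>u\<in>B v. rho u < rho v)"
  shows "\<exists>c :: 'a \<Rightarrow> nat. \<forall>v\<in>V. c v < k \<and> (\<forall>u\<in>B v. c u \<noteq> c v)"
  using assms
proof (induction V rule: finite_ranking_induct[where f = rho])
  case (insert x S)
  show ?case
  proof (cases "x \<in> S")
    case False
    have B_sub: "B v \<subseteq> S" if "v \<in> insert x S" for v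
    proof -
      have "rho v \<le> rho x" using insert.hyps(2)[of v] that by auto
      then have "x \<notin> B v" using insert.prems[OF that] by (auto simp: not_less[symmetric])
      then show ?thesis using insert.prems[OF that] by blast
    qed
    have "\<exists>c :: 'a \<Rightarrow> nat. \<forall>v\<in>S. c v < k \<and> (\<forall>u\<in>B v. c u \<noteq> c v)"
      using insert.prems B_sub by (intro insert.IH) auto
    then obtain c :: "'a \<Rightarrow> nat" where c: "\<And>v. v \<in> S \<Longrightarrow> c v < k \<and> (\<forall>u\<in>B v. c u \<noteq> c v)" by blast
    have fin: "finite (B x)" using B_sub[of x] insert.hyps(1) by (auto intro: finite_subset)
    have "card (c ` B x) < card {..<k}"
      using card_image_le[OF fin, of c] insert.prems[of x] by simp
    then have "\<not> {..<k} \<subseteq> c ` B x" using card_mono[of "c ` B x" "{..<k}"] fin by auto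
    then obtain a where a: "a < k" "a \<notin> c ` B x" by auto
    have "\<forall>v\<in>insert x S. (c(x := a)) v < k \<and> (\<forall>u\<in>B v. (c(x := a)) u \<noteq> (c(x := a)) v)"
    proof
      fix v assume v: "v \<in> insert x S"
      have "x \<notin> B v" using B_sub[OF v] False by blast
      then show "(c(x := a)) v < k \<and> (\<forall>u\<in>B v. (c(x := a)) u \<noteq> (c(x := a)) v)"
        using a c v by (cases "v = x") force+
    qed
    then show ?thesis by blast
  qed (use insert in \<open>simp add: insert_absorb\<close>)
qed simp

text \<open>The two interval graphs are given by \<open>[l v, h v]\<close> and, with
  \<open>d\<close> the depth, by \<open>[d v, d v + 1]\<close>. Intervals of descendants are nested
  in those of their ancestors, and the depth separates a vertex from descendants below its
  children.\<close>

definition forest_representation :: "('a \<times> 'a) set \<Rightarrow> 'a set \<Rightarrow> ('a \<Rightarrow> real) \<Rightarrow> ('a \<Rightarrow> real) \<Rightarrow>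
    ('a \<Rightarrow> real) \<Rightarrow> ('a \<Rightarrow> real) \<Rightarrow> ('a \<Rightarrow> nat) \<Rightarrow> bool" where
  "forest_representation E F l h a b d \<longleftrightarrow>
    (\<forall>v\<in>F. l v \<le> a v \<and> a v < b v \<and> b v \<le> h v) \<and>
    (\<forall>u\<in>F. \<forall>v\<in>F. u \<noteq> v \<longrightarrow> ((u, v) \<in> E \<longleftrightarrow> l u \<le> h v \<and> l v \<le> h u \<and> d u \<le> d v + 1 \<and> d v \<le> d u + 1)) \<and>
    (\<forall>p\<in>F. \<forall>u\<in>F. u \<noteq> p \<longrightarrow> d p \<le> d u \<longrightarrow> h u \<le> a p \<or> b p \<le> l u)"

text \<open>Vertices of a forest are added so that each one is a leaf. The open interval \<open>(a p, b p)\<close> is a part of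
  the interval of \<open>p\<close> that stays free for the children of \<open>p\<close>: it avoids all other vertices of at least
  the same depth.\<close>

lemma forest_intervals:
  fixes rho :: "'a \<Rightarrow> nat" and E :: "('a \<times> 'a) set"
  assumes "finite F" and "sym E" and "inj_on rho F"
    and "\<And>u u' v. u \<in> F \<Longrightarrow> u' \<in> F \<Longrightarrow> v \<in> F \<Longrightarrow> (u, v) \<in> E \<Longrightarrow> (u', v) \<in> E \<Longrightarrow>
      rho u < rho v \<Longrightarrow> rho u' < rho v \<Longrightarrow> u = u'"
  shows "\<exists>l h a b d. forest_representation E F l h a b d"
  using assms(1,3,4)
proof (induction F rule: finite_ranking_induct[where f = rho])
  case empty
  have "forest_representation E {} l h a b d" for l h a b d
    by (simp add: forest_representation_def)
  then show ?case by blast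
next
  case (insert x S)
  show ?case
  proof (cases "x \<in> S")
    case True
    then show ?thesis using insert by (simp add: insert_absorb)
  next
    case x: False
    have "inj_on rho S" using insert.prems(1) by (auto simp: inj_on_def)
    moreover have "u = u'" if "u \<in> S" "u' \<in> S" "v \<in> S" "(u, v) \<in> E" "(u', v) \<in> E" "rho u < rho v" "rho u' < rho v" for u u' v
      using insert.prems(2)[of u u' v] that by blast
    ultimately obtain l h a b d where rep: "forest_representation E S l h a b d"
      using insert.IH by blast
    have labh: "l v \<le> a v" "a v < b v" "b v \<le> h v" if "v \<in> S" for v
      using rep that unfolding forest_representation_def by blast+
    have adj: "(u, v) \<in> E \<longleftrightarrow> l u \<le> h v \<and> l v \<le> h u \<and> d u \<le> d v + 1 \<and> d v \<le> d u + 1"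
      if "u \<in> S" "v \<in> S" "u \<noteq> v" for u v
      using rep that unfolding forest_representation_def by blast
    have free: "h u \<le> a p \<or> b p \<le> l u" if "p \<in> S" "u \<in> S" "u \<noteq> p" "d p \<le> d u" for p u
      using rep that unfolding forest_representation_def by blast
    have sym: "(u, v) \<in> E \<longleftrightarrow> (v, u) \<in> E" for u v using symD[OF assms(2)] by blast
    have rho_x: "rho u < rho x" if "u \<in> S" for u
    proof -
      have "rho u \<noteq> rho x" using insert.prems(1) that x by (auto simp: inj_on_def)
      then show ?thesis using insert.hyps(2)[OF that] by simp
    qed
    \<comment> \<open>Covers both cases of the insertion: a new root and a new leaf. All of the new
      interval is still free for children, so it also serves as the free part.\<close>
    have ins: "forest_representation E (insert x S) (l(x := y)) (h(x := z)) (a(x := y)) (b'(x := z)) (d(x := e))"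
      if yz: "y < z" and b': "\<And>v. v \<in> S \<Longrightarrow> a v < b' v \<and> b' v \<le> b v"
        and E: "\<And>u. u \<in> S \<Longrightarrow> (u, x) \<in> E \<longleftrightarrow> l u \<le> z \<and> y \<le> h u \<and> d u \<le> e + 1 \<and> e \<le> d u + 1"
        and x_free: "\<And>u. u \<in> S \<Longrightarrow> e \<le> d u \<Longrightarrow> h u \<le> y \<or> z \<le> l u"
        and free_x: "\<And>p. p \<in> S \<Longrightarrow> d p \<le> e \<Longrightarrow> z \<le> a p \<or> b' p \<le> y"
      for y z e b'
      unfolding forest_representation_def
    proof (intro conjI ballI impI)
      fix v assume "v \<in> insert x S"
      then show "(l(x := y)) v \<le> (a(x := y)) v" "(a(x := y)) v < (b'(x := z)) v" "(b'(x := z)) v \<le> (h(x := z)) v"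
        using labh[of v] b'[of v] yz by auto
    next
      fix u v assume uv: "u \<in> insert x S" "v \<in> insert x S" "u \<noteq> v"
      then consider "u = x" "v \<in> S" "v \<noteq> x" | "v = x" "u \<in> S" "u \<noteq> x" | "u \<in> S" "v \<in> S" "u \<noteq> x" "v \<noteq> x" by blast
      then show "(u, v) \<in> E \<longleftrightarrow> (l(x := y)) u \<le> (h(x := z)) v \<and> (l(x := y)) v \<le> (h(x := z)) u \<and>
          (d(x := e)) u \<le> (d(x := e)) v + 1 \<and> (d(x := e)) v \<le> (d(x := e)) u + 1"
      proof cases
        case 1
        then show ?thesis using E[of v] sym[of x v] by auto
      next
        case 2
        then show ?thesis using E[of u] by auto
      next
        case 3
        then show ?thesis using adj[of u v] uv(3) by simp
      qed
    next
      fix p u assume pu: "p \<in> insert x S" "u \<in> insert x S" "u \<noteq> p" "(d(x := e)) p \<le> (d(x := e)) u"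
      then consider "p = x" "u \<in> S" "u \<noteq> x" | "u = x" "p \<in> S" "p \<noteq> x" | "u \<in> S" "p \<in> S" "u \<noteq> x" "p \<noteq> x" by blast
      then show "(h(x := z)) u \<le> (a(x := y)) p \<or> (b'(x := z)) p \<le> (l(x := y)) u"
      proof cases
        case 1
        then show ?thesis using x_free[of u] pu(4) by simp
      next
        case 2
        then show ?thesis using free_x[of p] pu(4) by simp
      next
        case 3
        then show ?thesis using free[of p u] b'[of p] pu(3,4) by auto
      qed
    qed
    show ?thesis
    proof (cases "\<exists>p\<in>S. (p, x) \<in> E")
      case False
      \<comment> \<open>A new root goes to the right of all intervals, at depth 0.\<close>
      define y where "y = (\<Sum>u\<in>S. \<bar>h u\<bar>) + 1"
      have hy: "h u < y" if "u \<in> S" for u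
        using member_le_sum[of u S "\<lambda>u. \<bar>h u\<bar>"] that insert.hyps(1) unfolding y_def by simp
      have "forest_representation E (insert x S) (l(x := y)) (h(x := y + 1)) (a(x := y)) (b(x := y + 1)) (d(x := 0))"
      proof (rule ins)
        show "(u, x) \<in> E \<longleftrightarrow> l u \<le> y + 1 \<and> y \<le> h u \<and> d u \<le> 0 + 1 \<and> 0 \<le> d u + 1" if "u \<in> S" for u
          using False hy[OF that] that by auto
        show "h u \<le> y \<or> y + 1 \<le> l u" if "u \<in> S" for u using hy[OF that] by simp
        show "y + 1 \<le> a p \<or> b p \<le> y" if "p \<in> S" for p using hy[OF that] labh[OF that] by linarith
      qed (use labh in auto)
      then show ?thesis by blast
    next
      case True
      then obtain p where p: "p \<in> S" "(p, x) \<in> E" by blast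
      have p_unique: "(u, x) \<in> E \<longleftrightarrow> u = p" if "u \<in> S" for u
        using insert.prems(2)[of u p x] p that rho_x by blast
      \<comment> \<open>The free part of \<open>p\<close> is cut in three: the first third stays
        free, \<open>x\<close> takes the middle one, and the last is a gap. Closed intervals outside
        the free part may end at its ends, and the outer thirds keep \<open>x\<close> away from
        them.\<close>
      define s where "s = (b p - a p) / 3"
      have s: "s > 0" "a p + 3 * s = b p" using labh[OF p(1)] by (simp_all add: s_def field_simps)
      have free_p: "h u \<le> a p \<or> b p \<le> l u" if "u \<in> S" "u \<noteq> p" "d p \<le> d u" for u
        using free p(1) that by blast
      have "forest_representation E (insert x S) (l(x := a p + s)) (h(x := a p + 2 * s)) (a(x := a p + s))
          ((b(p := a p + s))(x := a p + 2 * s)) (d(x := d p + 1))"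
      proof (rule ins)
        show "a p + s < a p + 2 * s" using s by simp
        show "a v < (b(p := a p + s)) v \<and> (b(p := a p + s)) v \<le> b v" if "v \<in> S" for v
          using labh[OF that] s by auto
        show "(u, x) \<in> E \<longleftrightarrow> l u \<le> a p + 2 * s \<and> a p + s \<le> h u \<and> d u \<le> d p + 1 + 1 \<and> d p + 1 \<le> d u + 1"
          if "u \<in> S" for u
        proof (cases "u = p")
          case True
          then show ?thesis using p_unique[OF that] labh[OF p(1)] s by auto
        next
          case False
          then show ?thesis using p_unique[OF that] free_p[OF that] s by auto
        qed
        show "h u \<le> a p + s \<or> a p + 2 * s \<le> l u" if "u \<in> S" "d p + 1 \<le> d u" for u
          using free_p[OF that(1)] that(2) s by (cases "u = p") auto
        show "a p + 2 * s \<le> a q \<or> (b(p := a p + s)) q \<le> a p + s" if q: "q \<in> S" "d q \<le> d p + 1" for q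
        proof (cases "q = p")
          case False
          note l = labh[OF p(1)] labh[OF q(1)]
          \<comment> \<open>If \<open>q\<close> is no deeper than \<open>p\<close>, its free part
            avoids \<open>p\<close> and with it \<open>x\<close>; if it is one level deeper, then
            \<open>q\<close> avoids the free part of \<open>p\<close>, in which \<open>x\<close>
            lies.\<close>
          show ?thesis
          proof (cases "d q \<le> d p")
            case True
            then show ?thesis using free[OF q(1) p(1)] False s l by auto
          next
            case nle: False
            then show ?thesis using free_p[OF q(1) False] False s l by auto
          qed
        qed simp
      qed
      then show ?thesis by blast
    qed
  qed
qed

text \<open>Vertices outside \<open>F\<close> receive an interval that meets all others. Hence no
  edge of the whole graph is lost, while inside \<open>F\<close> the two interval graphs together
  are exact.\<close>

lemma forest_pair_of_interval_graphs:
  fixes rho :: "'a \<Rightarrow> nat" and E :: "('a \<times> 'a) set"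
  assumes V: "finite V" "F \<subseteq> V" and E: "sym E" and rho: "inj_on rho V"
    and unique: "\<And>u u' v. u \<in> F \<Longrightarrow> u' \<in> F \<Longrightarrow> v \<in> F \<Longrightarrow> (u, v) \<in> E \<Longrightarrow> (u', v) \<in> E \<Longrightarrow>
      rho u < rho v \<Longrightarrow> rho u' < rho v \<Longrightarrow> u = u'"
  shows "\<exists>lo hi :: bool \<Rightarrow> 'a \<Rightarrow> real. (\<forall>s. \<forall>v\<in>V. lo s v \<le> hi s v) \<and>
    (\<forall>u\<in>V. \<forall>v\<in>V. u \<noteq> v \<longrightarrow> (u, v) \<in> E \<longrightarrow> (\<forall>s. lo s u \<le> hi s v \<and> lo s v \<le> hi s u)) \<and>
    (\<forall>u\<in>F. \<forall>v\<in>F. u \<noteq> v \<longrightarrow> (\<forall>s. lo s u \<le> hi s v \<and> lo s v \<le> hi s u) \<longrightarrow> (u, v) \<in> E)"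
proof -
  have finF: "finite F" using V by (auto intro: finite_subset)
  have "inj_on rho F" using rho V(2) by (rule inj_on_subset)
  then have "\<exists>l h a b d. forest_representation E F l h a b d"
    by (rule forest_intervals[OF finF E]) (rule unique)
  then obtain l h a b d where rep: "forest_representation E F l h a b d" by blast
  then have labh: "\<forall>v\<in>F. l v \<le> a v \<and> a v < b v \<and> b v \<le> h v"
    and adj: "\<forall>u\<in>F. \<forall>v\<in>F. u \<noteq> v \<longrightarrow> ((u, v) \<in> E \<longleftrightarrow> l u \<le> h v \<and> l v \<le> h u \<and> d u \<le> d v + 1 \<and> d v \<le> d u + 1)"
    unfolding forest_representation_def by blast+
  have lh: "l v \<le> h v" if "v \<in> F" for v using labh that by fastforce
  \<comment> \<open>Exceeds all end points; the summand 1 is for the right end of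
    \<open>[d v, d v + 1]\<close>.\<close>
  define N where "N = (\<Sum>v\<in>F. \<bar>l v\<bar> + \<bar>h v\<bar> + real (d v) + 1)"
  have N: "\<bar>l v\<bar> + \<bar>h v\<bar> + real (d v) + 1 \<le> N" if "v \<in> F" for v
    unfolding N_def using member_le_sum[of v F "\<lambda>v. \<bar>l v\<bar> + \<bar>h v\<bar> + real (d v) + 1"] that finF by simp
  have N0: "N \<ge> 0" unfolding N_def by (intro sum_nonneg) auto
  define lo where "lo s v = (if v \<in> F then if s then l v else real (d v) else - N)" for s v
  define hi where "hi s v = (if v \<in> F then if s then h v else real (d v) + 1 else N)" for s v
  have bounds: "- N \<le> lo s v" "hi s v \<le> N" "lo s v \<le> N" "- N \<le> hi s v" for s v
    using N[of v] N0 by (auto simp: lo_def hi_def)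
  show ?thesis
  proof (rule exI[of _ lo], rule exI[of _ hi], intro conjI ballI allI impI)
    fix s v show "lo s v \<le> hi s v" using lh N0 by (auto simp: lo_def hi_def)
  next
    fix u v s assume uv: "u \<noteq> v" "(u, v) \<in> E"
    have "lo s u \<le> hi s v \<and> lo s v \<le> hi s u"
    proof (cases "u \<in> F \<and> v \<in> F")
      case True
      then show ?thesis using adj uv by (auto simp: lo_def hi_def)
    next
      case False
      then show ?thesis using bounds[of s u] bounds[of s v] by (auto simp: lo_def[of s] hi_def[of s] split: if_splits)
    qed
    then show "lo s u \<le> hi s v" "lo s v \<le> hi s u" by auto
  next
    fix u v assume uv: "u \<in> F" "v \<in> F" "u \<noteq> v" and i: "\<forall>s. lo s u \<le> hi s v \<and> lo s v \<le> hi s u"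
    have "l u \<le> h v \<and> l v \<le> h u" using i[THEN spec, of True] uv by (simp add: lo_def hi_def)
    moreover have "d u \<le> d v + 1 \<and> d v \<le> d u + 1" using i[THEN spec, of False] uv by (auto simp: lo_def hi_def)
    ultimately show "(u, v) \<in> E" using adj uv by blast
  qed
qed

section \<open>From interval graphs to boxes\<close>

lemma boxicity_le:
  fixes lo hi :: "'j \<Rightarrow> 'a \<Rightarrow> real"
  assumes J: "finite J" "J \<noteq> {}"
    and le: "\<And>j v. j \<in> J \<Longrightarrow> v \<in> pverts G \<Longrightarrow> lo j v \<le> hi j v"
    and adj: "\<And>u v. u \<in> pverts G \<Longrightarrow> v \<in> pverts G \<Longrightarrow> u \<noteq> v \<Longrightarrow>
      (u, v) \<in> parcs G \<longleftrightarrow> (\<forall>j\<in>J. lo j u \<le> hi j v \<and> lo j v \<le> hi j u)"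
  shows "boxicity G \<le> card J"
proof -
  obtain e where e: "bij_betw e {0..<card J} J" using ex_bij_betw_nat_finite[OF J(1)] by blast
  then have eJ: "e ` {..<card J} = J" by (simp add: bij_betw_def atLeast0LessThan)
  define B where "B v = (\<Pi>\<^sub>E i\<in>{..<card J}. {lo (e i) v..hi (e i) v})" for v
  have "box_representation G (card J) B"
    unfolding box_representation_def
  proof (intro conjI ballI impI)
    fix v assume v: "v \<in> pverts G"
    have "\<forall>i<card J. lo (e i) v \<le> hi (e i) v" using le v eJ by blast
    then show "is_box (card J) (B v)"
      unfolding is_box_def B_def by (intro exI[of _ "\<lambda>i. lo (e i) v"] exI[of _ "\<lambda>i. hi (e i) v"]) simp
  next
    fix u v assume uv: "u \<in> pverts G" "v \<in> pverts G" "u \<noteq> v"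
    have "B u \<inter> B v = (\<Pi>\<^sub>E i\<in>{..<card J}. {lo (e i) u..hi (e i) u} \<inter> {lo (e i) v..hi (e i) v})"
      unfolding B_def by (rule PiE_Int)
    then have "B u \<inter> B v \<noteq> {} \<longleftrightarrow> (\<forall>i\<in>{..<card J}. {lo (e i) u..hi (e i) u} \<inter> {lo (e i) v..hi (e i) v} \<noteq> {})"
      by (simp add: PiE_eq_empty_iff)
    also have "\<dots> \<longleftrightarrow> (\<forall>j\<in>e ` {..<card J}. {lo j u..hi j u} \<inter> {lo j v..hi j v} \<noteq> {})"
      by simp
    also have "\<dots> \<longleftrightarrow> (\<forall>j\<in>J. {lo j u..hi j u} \<inter> {lo j v..hi j v} \<noteq> {})"
      unfolding eJ ..
    also have "\<dots> \<longleftrightarrow> (\<forall>j\<in>J. lo j u \<le> hi j v \<and> lo j v \<le> hi j u)"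
    proof (rule ball_cong[OF refl])
      fix j assume "j \<in> J"
      then have "lo j u \<le> hi j u" "lo j v \<le> hi j v" using le uv by auto
      then show "{lo j u..hi j u} \<inter> {lo j v..hi j v} \<noteq> {} \<longleftrightarrow> lo j u \<le> hi j v \<and> lo j v \<le> hi j u"
        by (auto simp: Int_atLeastAtMost)
    qed
    also have "\<dots> \<longleftrightarrow> (u, v) \<in> parcs G" using adj uv by blast
    finally show "(u, v) \<in> parcs G \<longleftrightarrow> B u \<inter> B v \<noteq> {}" by blast
  qed
  moreover have "card J \<ge> 1" using J by (simp add: Suc_leI card_gt_0_iff)
  ultimately show ?thesis unfolding boxicity_def by (intro Least_le) blast
qed

text \<open>A colouring that separates each vertex from all it strongly reaches in two steps makes
  any two classes induce a forest, and every nonadjacent pair lies in the forest of its own two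
  colours.\<close>

lemma boxicity_le_of_ordering:
  fixes rho :: "'a \<Rightarrow> nat"
  assumes G: "pair_graph G" "pverts G \<noteq> {}" and rho: "inj_on rho (pverts G)"
    and few: "\<And>v. v \<in> pverts G \<Longrightarrow> card (earlier (parcs G) (pverts G) (pverts G) rho v) < k"
  shows "boxicity G \<le> 2 * k * k"
proof -
  interpret pair_graph G by (fact G)
  let ?V = "pverts G" and ?E = "parcs G"
  have finV: "finite ?V" by simp
  have E: "sym ?E" using arcs_symmetric by (auto simp: sym_def)
  have "\<exists>c :: 'a \<Rightarrow> nat. \<forall>v\<in>?V. c v < k \<and> (\<forall>u\<in>earlier ?E ?V ?V rho v. c u \<noteq> c v)"
    by (rule greedy_colouring[OF finV, of _ _ rho]) (use few in \<open>auto simp: earlier_def\<close>)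
  then obtain c :: "'a \<Rightarrow> nat" where c: "\<And>v. v \<in> ?V \<Longrightarrow> c v < k"
    and c_neq: "\<And>u v. v \<in> ?V \<Longrightarrow> u \<in> earlier ?E ?V ?V rho v \<Longrightarrow> c u \<noteq> c v" by blast
  define F where "F q = {v \<in> ?V. c v = fst q \<or> c v = snd q}" for q
  have unique: "u = u'" if q: "u \<in> F q" "u' \<in> F q" "v \<in> F q" and e: "(u, v) \<in> ?E" "(u', v) \<in> ?E"
      and less: "rho u < rho v" "rho u' < rho v" for q u u' v
  proof (rule ccontr)
    assume "u \<noteq> u'"
    have V: "u \<in> ?V" "u' \<in> ?V" "v \<in> ?V" using q by (auto simp: F_def)
    have "c u \<noteq> c v" "c u' \<noteq> c v" using c_neq[OF V(3)] V e less by (auto simp: earlier_def)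
    then have same: "c u = c u'" using q by (auto simp: F_def)
    \<comment> \<open>Of two earlier neighbours of \<open>v\<close>, the smaller is strongly
      reachable from the larger through \<open>v\<close>. Both would have the second colour of
      \<open>F q\<close>, a contradiction.\<close>
    have neq: "c w \<noteq> c w'" if "w \<in> ?V" "w' \<in> ?V" "(w, v) \<in> ?E" "(w', v) \<in> ?E" "rho w < rho w'" "rho w' < rho v" for w w'
      using c_neq[OF that(2), of w] that V(3) symD[OF E that(4)] by (auto simp: earlier_def)
    have "rho u \<noteq> rho u'" using rho V \<open>u \<noteq> u'\<close> by (auto simp: inj_on_def)
    then show False using neq[of u u'] neq[of u' u] V e less same by (metis linorder_neqE_nat)
  qed
  define good where "good q lo hi \<longleftrightarrow> (\<forall>s. \<forall>v\<in>?V. lo s v \<le> hi s v) \<and>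
    (\<forall>u\<in>?V. \<forall>v\<in>?V. u \<noteq> v \<longrightarrow> (u, v) \<in> ?E \<longrightarrow> (\<forall>s. lo s u \<le> hi s v \<and> lo s v \<le> hi s u)) \<and>
    (\<forall>u\<in>F q. \<forall>v\<in>F q. u \<noteq> v \<longrightarrow> (\<forall>s. lo s u \<le> hi s v \<and> lo s v \<le> hi s u) \<longrightarrow> (u, v) \<in> ?E)"
    for q and lo hi :: "bool \<Rightarrow> 'a \<Rightarrow> real"
  have "\<exists>lo hi. good q lo hi" for q
    unfolding good_def
    by (rule forest_pair_of_interval_graphs[OF finV _ E rho unique]) (auto simp: F_def)
  then obtain lo hi where good: "\<And>q. good q (lo q) (hi q)" by metis
  have le: "lo q s v \<le> hi q s v" if "v \<in> ?V" for q s v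
    using good[of q] that unfolding good_def by blast
  have meet: "lo q s u \<le> hi q s v \<and> lo q s v \<le> hi q s u" if "u \<in> ?V" "v \<in> ?V" "u \<noteq> v" "(u, v) \<in> ?E" for q s u v
    using good[of q] that unfolding good_def by blast
  have sep: "(u, v) \<in> ?E" if "u \<in> F q" "v \<in> F q" "u \<noteq> v"
      "\<And>s. lo q s u \<le> hi q s v \<and> lo q s v \<le> hi q s u" for q u v
    using good[of q] that unfolding good_def by blast
  \<comment> \<open>Pairs of equal colours are included, since they separate nonadjacent vertices of
    one class.\<close>
  define J where "J = ({..<k} \<times> {..<k}) \<times> (UNIV :: bool set)"
  obtain v where "v \<in> ?V" using G(2) by blast
  then have "k > 0" using few by fastforce
  then have J: "finite J" "J \<noteq> {}" by (auto simp: J_def)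
  have "boxicity G \<le> card J"
  proof (rule boxicity_le[OF J, of G "\<lambda>j. lo (fst j) (snd j)" "\<lambda>j. hi (fst j) (snd j)"])
    show "lo (fst j) (snd j) v \<le> hi (fst j) (snd j) v" if "v \<in> ?V" for j v using le that .
    fix u v assume uv: "u \<in> ?V" "v \<in> ?V" "u \<noteq> v"
    show "(u, v) \<in> ?E \<longleftrightarrow> (\<forall>j\<in>J. lo (fst j) (snd j) u \<le> hi (fst j) (snd j) v \<and> lo (fst j) (snd j) v \<le> hi (fst j) (snd j) u)"
    proof
      assume "(u, v) \<in> ?E"
      then show "\<forall>j\<in>J. lo (fst j) (snd j) u \<le> hi (fst j) (snd j) v \<and> lo (fst j) (snd j) v \<le> hi (fst j) (snd j) u"
        using meet uv by blast
    next
      assume a: "\<forall>j\<in>J. lo (fst j) (snd j) u \<le> hi (fst j) (snd j) v \<and> lo (fst j) (snd j) v \<le> hi (fst j) (snd j) u"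
      let ?q = "(c u, c v)"
      have "(?q, s) \<in> J" for s using c uv by (simp add: J_def)
      then have "lo ?q s u \<le> hi ?q s v \<and> lo ?q s v \<le> hi ?q s u" for s using a by fastforce
      then show "(u, v) \<in> ?E" using sep[of u ?q v] uv by (simp add: F_def)
    qed
  qed
  also have "card J = 2 * k * k" by (simp add: J_def card_cartesian_product)
  finally show ?thesis .
qed

theorem proposition1:
  shows "\<exists>c0 :: real. \<forall>G :: nat pair_pre_digraph.
    pair_graph G \<and> pverts G \<noteq> {} \<and> colin_de_verdiere G \<ge> 2 \<longrightarrow>
      real (boxicity G) \<le>
        c0 * real (colin_de_verdiere G) ^ 4 * (ln (real (colin_de_verdiere G)))\<^sup>2"
proof (intro exI[of _ "882 / (ln 2)\<^sup>2"] allI impI)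
  fix G :: "nat pair_pre_digraph"
  assume G: "pair_graph G \<and> pverts G \<noteq> {} \<and> colin_de_verdiere G \<ge> 2"
  interpret pair_graph G using G by blast
  define m where "m = colin_de_verdiere G"
  \<comment> \<open>A family of branch sets has at most \<open>m + 1\<close> members, and the
    ordering asks for a strict bound.\<close>
  define t where "t = m + 2"
  have m: "m \<ge> 2" using G by (simp add: m_def)
  have "sym (parcs G)" using arcs_symmetric by (auto simp: sym_def)
  moreover have "card \<W> < t" if "clique_family (parcs G) (pverts G) \<W>" for \<W>
    using card_clique_family_le[OF _ that] G by (simp add: t_def m_def)
  ultimately obtain rho :: "nat \<Rightarrow> nat" where rho: "inj_on rho (pverts G)"
    "\<And>v. v \<in> pverts G \<Longrightarrow> card (earlier (parcs G) (pverts G) (pverts G) rho v) \<le> 5 * t * t"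
    using exists_ordering[of "parcs G" "pverts G" t] by auto
  define k where "k = 5 * t * t + 1"
  have "boxicity G \<le> 2 * k * k"
    by (rule boxicity_le_of_ordering[OF _ _ rho(1)]) (use G rho(2) in \<open>auto simp: k_def less_Suc_eq_le\<close>)
  also have "\<dots> \<le> 2 * (21 * (m * m)) * (21 * (m * m))"
  proof -
    \<comment> \<open>From \<open>m \<ge> 2\<close> one has \<open>t \<le> 2 * m\<close>, so
      \<open>k\<close> is at most \<open>5 * 4 + 1 = 21\<close> times \<open>m * m\<close>, and
      \<open>2 * 21 * 21 = 882\<close>.\<close>
    have "t * t \<le> (2 * m) * (2 * m)" using m by (intro mult_mono) (auto simp: t_def)
    then have "t * t \<le> 4 * (m * m)" by (simp only: mult_ac)
    moreover have "1 * 1 \<le> m * m" using m by (intro mult_mono) auto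
    moreover have "k = 5 * (t * t) + 1" by (simp only: k_def mult.assoc)
    ultimately have "k \<le> 21 * (m * m)" by linarith
    then show ?thesis by (intro mult_mono) auto
  qed
  finally have "real (boxicity G) \<le> real (2 * (21 * (m * m)) * (21 * (m * m)))" by (rule of_nat_mono)
  also have "\<dots> = 882 * real m ^ 4" by (simp add: power4_eq_xxxx)
  also have "\<dots> \<le> 882 * real m ^ 4 * ((ln (real m))\<^sup>2 / (ln 2)\<^sup>2)"
  proof -
    \<comment> \<open>The logarithm is bounded away from 0, so inserting the quotient only enlarges
      the bound.\<close>
    have "ln 2 \<le> ln (real m)" using m by simp
    then have "(ln 2)\<^sup>2 \<le> (ln (real m))\<^sup>2" by (intro power_mono) auto
    then have "1 \<le> (ln (real m))\<^sup>2 / (ln 2)\<^sup>2" by simp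
    then show ?thesis using mult_left_mono[of 1 "(ln (real m))\<^sup>2 / (ln 2)\<^sup>2" "882 * real m ^ 4"] by simp
  qed
  finally show "real (boxicity G) \<le> 882 / (ln 2)\<^sup>2 * real (colin_de_verdiere G) ^ 4 * (ln (real (colin_de_verdiere G)))\<^sup>2"
    by (simp add: m_def)
qed

end
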